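(* Let $f_i^\varepsilon$, $i=1,\dots,4$, be the Maxwellian-form solutions of the scaled kinetic system described in the context. Then, formally in the limit $\varepsilon\to0$, the energy of the mixture satisfies $$ \frac{\partial}{\partial t}\left[\sum_{i=1}^4\Big(\frac32n_ik_BT+n_i\frac{q_i^*(T)}{q_i(T)}\Big)\right]+\nabla_{\boldsymbol x}\cdot\left[\sum_{i=1}^4\Big(\frac52n_ik_BT\,\boldsymbol u_i+n_i\boldsymbol u_i\frac{q_i^*(T)}{q_i(T)}\Big)\right]=-EA, $$ where $n_i=\lim_{\varepsilon\to0}n_i^\varepsilon$, $\boldsymbol u_i=\lim_{\varepsilon\to0}\boldsymbol u_i^\varepsilon$, $T=\lim_{\varepsilon\to0}(T+\varepsilon T_i^\varepsilon)$, and $A$ is the formal limit for $\varepsilon\to0$ of $$ \begin{aligned} A^\varepsilon=&\left[\Big(\frac{m_3m_4}{m_1m_2}\Big)^{3/2}\frac{n_1^\varepsilon n_2^\varepsilon}{q_1(T)q_2(T)}\exp\Big(-\frac{E}{k_BT}\Big)-\frac{n_3^\varepsilon n_4^\varepsilon}{q_3(T)q_4(T)}\right]\frac{4}{\sqrt\pi\,(m_3m_4)^2}\Big(\frac{2k_BT}{\mu_{34}}\Big)^{(\gamma-1)/2}\Gamma\Big(\frac{\gamma+2}{2}\Big)\\ &\times\int_0^{+\infty}\!\!\int_0^{+\infty}\!\!\int_0^1\!\!\int_0^1\!\!\int_{\mathbb S^2}\exp\Big(-\frac{I+I_4}{k_BT}\Big)\Phi^{react}(I,I_4,R,r)\,b^{react}(\cos\theta)\cos\theta\,(1-R)\,d\sigma\,dr\,dR\,dI_4\,dI+O(\varepsilon).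 \end{aligned} $$
   Context: **Mixture.** Four polyatomic species $A_1,\dots,A_4$ undergo the reversible reaction $A_1+A_2\rightleftharpoons A_3+A_4$. They have masses $m_i>0$ with $m_1+m_2=m_3+m_4=M$, binding energies $E_i$, reaction heat $E=E_3+E_4-E_1-E_2$, reduced masses $\mu_{ij}=m_im_j/(m_i+m_j)$, and nonnegative weights $\varphi_i(I)$ on $[0,\infty)$; $k_B$ is the Boltzmann constant, and $$q_i(T)=\int_0^{+\infty}\varphi_i(I)e^{-I/(k_BT)}dI,\qquad q_i^*(T)=\int_0^{+\infty}I\,\varphi_i(I)e^{-I/(k_BT)}dI.$$ The distribution functions $f_i(t,\boldsymbol x,\boldsymbol v,I)$ depend on $t>0$, $\boldsymbol x\in\Omega\subset\mathbb R^3$ (open bounded, regular boundary), $\boldsymbol v\in\mathbb R^3$, $I\ge0$. Primed quantities are post-collisional. **Elastic operators.** For a pair $(\boldsymbol v,I)$ (species $i$) and $(\boldsymbol v_j,I_j)$ (species $j$), parameters $R,r\in[0,1]$, $\sigma\in\mathbb S^2$, let $\mathcal E=\frac12\mu_{ij}|\boldsymbol v-\boldsymbol v_j|^2+I+I_j$ and $$\boldsymbol v_i'=\tfrac{m_i\boldsymbol v+m_j\boldsymbol v_j}{m_i+m_j}+\tfrac{m_j}{m_i+m_j}\sqrt{\tfrac{2R\mathcal E}{\mu_{ij}}}\,\sigma,\quad \boldsymbol v_j'=\tfrac{m_i\boldsymbol v+m_j\boldsymbol v_j}{m_i+m_j}-\tfrac{m_i}{m_i+m_j}\sqrt{\tfrac{2R\mathcal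 E}{\mu_{ij}}}\,\sigma,\quad I_i'=r(1-R)\mathcal E,\quad I_j'=(1-r)(1-R)\mathcal E.$$ Then $$Q^e_{ij}(f_i,f_j)=\int_{\mathbb R^3}\!\int_0^\infty\!\!\int_0^1\!\!\int_0^1\!\!\int_{\mathbb S^2}[f_i(\boldsymbol v_i',I_i')f_j(\boldsymbol v_j',I_j')-f_i(\boldsymbol v,I)f_j(\boldsymbol v_j,I_j)]\,B_{ij}\,\frac{2\cos\theta\,(1-R)}{|\boldsymbol v-\boldsymbol v_j|\,\varphi_i(I)}\,d\sigma\,dr\,dR\,dI_j\,d\boldsymbol v_j,$$ and for $i=j$ the same formula is used with the second particle labelled $i_*$ (species $i$). Here $\sigma=\boldsymbol y-2(\omega\cdot\boldsymbol y)\omega$ with $\boldsymbol y=(\boldsymbol v-\boldsymbol v_j)/|\boldsymbol v-\boldsymbol v_j|$, $\omega\in\mathbb S^2$, and $\cos\theta=|\omega\cdot\boldsymbol y|$. **Reactive operators.** For $(i,j,k,l)\in\{(1,2,3,4),(2,1,4,3)\}$ (forward, put $s=-1$) or $\{(3,4,1,2),(4,3,2,1)\}$ (backward, put $s=+1$), let $\mathcal E^*=\frac12\mu_{ij}|\boldsymbol v-\boldsymbol v_j|^2+I+I_j+s\frac E2$, $$\boldsymbol v_k'=\tfrac{m_i\boldsymbol v+m_j\boldsymbol v_j}{M}+\tfrac{m_l}{M}\sqrt{\tfrac2{\mu_{kl}}}\big(R\mathcal E^*+s\tfrac E6\big)^{1/2}\sigma,\qquad \boldsymbol v_l'=\tfrac{m_i\boldsymbol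 v+m_j\boldsymbol v_j}{M}-\tfrac{m_k}{M}\sqrt{\tfrac2{\mu_{kl}}}\big(R\mathcal E^*+s\tfrac E6\big)^{1/2}\sigma,$$ $I_k'=r(1-R)\mathcal E^*+s\frac E6$, $I_l'=(1-r)(1-R)\mathcal E^*+s\frac E6$ (with $r$ and $1-r$ interchanged if $i\in\{2,4\}$). Then $$Q_i^{react}=\int_{\mathbb R^3}\!\int_0^\infty\!\!\int_0^1\!\!\int_0^1\!\!\int_{\mathbb S^2}\Big[\Big(\tfrac{m_im_j}{m_km_l}\Big)^3f_k(\boldsymbol v_k',I_k')f_l(\boldsymbol v_l',I_l')-f_i(\boldsymbol v,I)f_j(\boldsymbol v_j,I_j)\Big]H_iB^{react}\frac{2\cos\theta(1-R)}{(m_im_j)^2|\boldsymbol v-\boldsymbol v_j|\varphi_i(I)}\,d\sigma\,dr\,dR\,dI_j\,d\boldsymbol v_j,$$ where $H_3=H_4=1$, and for $i=1,2$, $H_i$ is the indicator function of the set where $I\ge\frac E6$, $I_j\ge\frac E6$, $R\mathcal E^*\ge\frac E6$, $\frac{\mu_{12}}2|\boldsymbol v-\boldsymbol v_j|^2\ge\frac E6$, $(1-R)r\mathcal E^*\ge\frac E6$, $(1-R)(1-r)\mathcal E^*\ge\frac E6$. **Kernels.** $B_{ij}=|\boldsymbol v-\boldsymbol v_j|^\gamma\Phi_{ij}(I,I_j,R,r)\,b_{ij}(\cos\theta)$ and $B^{react}=|\boldsymbol v-\boldsymbol v_j|^\gamma\Phi^{react}(I,I_j,R,r)\,b^{react}(\cos\theta)$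 with $\gamma\ge1$. The kernels are assumed to have the reversibility symmetries of the model, so that the following known properties hold (all integrals in $dI\,d\boldsymbol v$ over $[0,\infty)\times\mathbb R^3$): $\int\!\!\int(\frac{m_i|\boldsymbol v|^2}2+I)Q^e_{ii}\varphi_i=0$; for $i\ne j$, $\int\!\!\int(\frac{m_i|\boldsymbol v|^2}2+I)Q^e_{ij}\varphi_i+\int\!\!\int(\frac{m_j|\boldsymbol v|^2}2+I)Q^e_{ji}\varphi_j=0$; $\sum_{i=1}^4\int\!\!\int(\frac{m_i|\boldsymbol v|^2}2+I+E_i)Q_i^{react}\varphi_i=0$; and $\int\!\!\int Q_1^{react}\varphi_1=\int\!\!\int Q_2^{react}\varphi_2=-\int\!\!\int Q_3^{react}\varphi_3=-\int\!\!\int Q_4^{react}\varphi_4$. **Scaled system and assumptions.** For $0<\varepsilon\ll1$, $$\varepsilon\,\partial_tf_i^\varepsilon+\boldsymbol v\cdot\nabla_{\boldsymbol x}f_i^\varepsilon=\frac1\varepsilon\sum_{j=1}^4Q^e_{ij}(f_i^\varepsilon,f_j^\varepsilon)+\varepsilon Q_i^{react},\qquad i=1,\dots,4,$$ where $Q_i^{react}$ is evaluated at $(f_1^\varepsilon,\dots,f_4^\varepsilon)$. It is assumed that for all $t\geq 0$ $$f_i^\varepsilon=\frac{n_i^\varepsilon}{q_i(T+\varepsilon T_i^\varepsilon)}\Big(\frac{m_i}{2\pi k_B(T+\varepsilon T_i^\varepsilon)}\Big)^{3/2}\exp\Big[-\frac{m_i|\boldsymbol v-\varepsilon\boldsymbol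 u_i^\varepsilon|^2+2I}{2k_B(T+\varepsilon T_i^\varepsilon)}\Big]$$ for some positive functions $n_i^\varepsilon,T_i^\varepsilon,T$ and $\mathbb R^3$-valued functions $\boldsymbol u_i^\varepsilon$ of $(t,\boldsymbol x)$ ($T$ independent of $\varepsilon$ and $i$), with $\boldsymbol u_i^\varepsilon=O(1)$, $T_i^\varepsilon=O(1)$ and $n_i^\varepsilon\to n_i$, $\boldsymbol u_i^\varepsilon\to\boldsymbol u_i$ as $\varepsilon\to0$. **"Formal".** All functions are taken smooth enough, all integrals convergent, Taylor expansions in $\varepsilon$ may be integrated term by term, and the limit $\varepsilon\to0$ may be exchanged with derivatives and integrals. *)

theory Defs
  imports "HOL-Analysis.Analysis" "HOL-Library.Landau_Symbols"
begin

section \<open>Measures and differential operators\<close>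

abbreviation half_line :: "real measure" where
  "half_line \<equiv> restrict_space lborel {0..}"

abbreviation unit_interval :: "real measure" where
  "unit_interval \<equiv> restrict_space lborel {0..1}"

text \<open>Surface measure \<open>d\<sigma>\<close> of the unit sphere in three dimensions, as a measure on the ambient space that
  is concentrated on the sphere: the measure of \<open>A\<close> is three times the volume of the cone
  \<open>{r a | 0 < r < 1, a \<in> A}\<close>, which is the normalisation of polar coordinates \<open>dx = \<rho>\<^sup>2 d\<rho> d\<sigma>\<close>.\<close>

definition sphere_measure :: "(real^3) measure" where
  "sphere_measure = distr (density lborel (\<lambda>x. ennreal (3 * indicator (ball 0 1) x))) borel sgn"

lemma sgn_measurable_vec: "(sgn :: real^3 \<Rightarrow> real^3) \<in> borel_measurable borel"
proof -
  have "(sgn :: real^3 \<Rightarrow> real^3) = (\<lambda>x. inverse (norm x) *\<^sub>R x)"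
    by (auto simp: sgn_div_norm fun_eq_iff)
  then show ?thesis by simp
qed

lemma cone_density_measurable:
  "(\<lambda>x::real^3. ennreal (3 * indicator (ball 0 1) x)) \<in> borel_measurable lborel"
  by (intro measurable_compose[OF _ measurable_ennreal] borel_measurable_times borel_measurable_indicator) auto

lemma emeasure_sphere_measure_UNIV: "emeasure sphere_measure UNIV = ennreal (4 * pi)"
proof -
  have "emeasure sphere_measure UNIV
      = (\<integral>\<^sup>+(x::real^3). ennreal (3 * indicator (ball 0 1) x) \<partial>lborel)"
    unfolding sphere_measure_def using sgn_measurable_vec cone_density_measurable
    by (subst emeasure_distr) (simp_all add: emeasure_density)
  also have "\<dots> = (\<integral>\<^sup>+(x::real^3). 3 * indicator (ball 0 1) x \<partial>lborel)"
    by (intro nn_integral_cong) (auto simp: indicator_def)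
  also have "\<dots> = 3 * emeasure lborel (ball (0::real^3) 1)"
    by (subst nn_integral_cmult_indicator) auto
  also have "emeasure lborel (ball (0::real^3) 1) = ennreal (4 / 3 * pi)"
    by (subst emeasure_ball) (auto simp: eval_unit_ball_vol field_simps)
  also have "3 * ennreal (4 / 3 * pi) = ennreal (4 * pi)"
    by (subst ennreal_numeral[symmetric], subst ennreal_mult[symmetric]) auto
  finally show ?thesis .
qed

lemma AE_sphere_measure: "AE \<sigma> in sphere_measure. norm \<sigma> = 1"
proof -
  have "{x \<in> space borel. norm (x :: real^3) = 1} \<in> sets borel" by measurable
  moreover have "AE x in lborel. 0 < ennreal (3 * indicator (ball 0 1) (x :: real^3)) \<longrightarrow> norm (sgn x) = 1"
    using AE_lborel_singleton[of "0 :: real^3"] by eventually_elim (simp add: norm_sgn)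
  ultimately show ?thesis
    unfolding sphere_measure_def using sgn_measurable_vec cone_density_measurable
    by (subst AE_distr_iff) (simp_all add: AE_density del: ennreal_mult'')
qed

definition grad :: "(real^3 \<Rightarrow> real) \<Rightarrow> real^3 \<Rightarrow> real^3" where
  "grad g x = (\<chi> k. frechet_derivative g (at x) (axis k 1))"

definition divergence :: "(real^3 \<Rightarrow> real^3) \<Rightarrow> real^3 \<Rightarrow> real" where
  "divergence F x = (\<Sum>k\<in>UNIV. frechet_derivative F (at x) (axis k 1) $ k)"


section \<open>The mixture\<close>

text \<open>Species are indexed by \<open>1, \<dots>, 4\<close>. The kernel factors are \<open>PhiEl i j\<close>, \<open>bEl i j\<close> (elastic) and
  \<open>PhiRe\<close>, \<open>bRe\<close> (reactive); \<open>expo\<close> is the common exponent \<open>\<gamma>\<close>.\<close>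

record mixture =
  mass :: "nat \<Rightarrow> real"
  bindE :: "nat \<Rightarrow> real"
  weight :: "nat \<Rightarrow> real \<Rightarrow> real"
  kB :: real
  expo :: real
  PhiEl :: "nat \<Rightarrow> nat \<Rightarrow> real \<Rightarrow> real \<Rightarrow> real \<Rightarrow> real \<Rightarrow> real"
  bEl :: "nat \<Rightarrow> nat \<Rightarrow> real \<Rightarrow> real"
  PhiRe :: "real \<Rightarrow> real \<Rightarrow> real \<Rightarrow> real \<Rightarrow> real"
  bRe :: "real \<Rightarrow> real"

definition total_mass :: "mixture \<Rightarrow> real" where
  "total_mass X = mass X 1 + mass X 2"

definition reaction_heat :: "mixture \<Rightarrow> real" where
  "reaction_heat X = bindE X 3 + bindE X 4 - bindE X 1 - bindE X 2"

definition red_mass :: "mixture \<Rightarrow> nat \<Rightarrow> nat \<Rightarrow> real" where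
  "red_mass X i j = mass X i * mass X j / (mass X i + mass X j)"

definition qint :: "mixture \<Rightarrow> nat \<Rightarrow> real \<Rightarrow> real" where
  "qint X i T = (LINT I|half_line. weight X i I * exp (- I / (kB X * T)))"

definition qstar :: "mixture \<Rightarrow> nat \<Rightarrow> real \<Rightarrow> real" where
  "qstar X i T = (LINT I|half_line. I * weight X i I * exp (- I / (kB X * T)))"

definition maxwellian ::
    "mixture \<Rightarrow> nat \<Rightarrow> real \<Rightarrow> real^3 \<Rightarrow> real \<Rightarrow> real^3 \<Rightarrow> real \<Rightarrow> real" where
  "maxwellian X i n u T v I =
     n / qint X i T * (mass X i / (2 * pi * kB X * T)) powr (3/2)
       * exp (- (mass X i * (norm (v - u))\<^sup>2 + 2 * I) / (2 * kB X * T))"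


section \<open>Collision operators\<close>

text \<open>\<open>cos_theta y \<sigma>\<close> is \<open>\<bar>\<omega> \<bullet> y\<bar>\<close> for a unit vector \<open>\<omega>\<close> with \<open>\<sigma> = y - 2(\<omega> \<bullet> y)\<omega>\<close>; the lemma below
  shows that it is well defined for all unit vectors \<open>y\<close>, \<open>\<sigma>\<close>.\<close>

definition cos_theta :: "real^3 \<Rightarrow> real^3 \<Rightarrow> real" where
  "cos_theta y \<sigma> =
     (THE c. \<exists>\<omega>. norm \<omega> = 1 \<and> \<sigma> = y - (2 * (\<omega> \<bullet> y)) *\<^sub>R \<omega> \<and> c = \<bar>\<omega> \<bullet> y\<bar>)"

lemma cos_theta_eq:
  assumes y: "norm y = 1" and s: "norm \<sigma> = 1"
  shows "cos_theta y \<sigma> = sqrt ((1 - \<sigma> \<bullet> y) / 2)"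
  unfolding cos_theta_def
proof (rule the_equality)
  have yy: "y \<bullet> y = 1" and ss: "\<sigma> \<bullet> \<sigma> = 1"
    using y s by (simp_all add: dot_square_norm)
  have uniq: "\<bar>\<omega> \<bullet> y\<bar> = sqrt ((1 - \<sigma> \<bullet> y) / 2)"
    if "\<sigma> = y - (2 * (\<omega> \<bullet> y)) *\<^sub>R \<omega>" for \<omega>
  proof -
    have "\<sigma> \<bullet> y = 1 - 2 * (\<omega> \<bullet> y)\<^sup>2"
      unfolding that by (simp add: inner_diff_left yy power2_eq_square)
    then show ?thesis by (simp add: real_sqrt_abs)
  qed
  have "\<exists>\<omega>. norm \<omega> = 1 \<and> \<sigma> = y - (2 * (\<omega> \<bullet> y)) *\<^sub>R \<omega>"
  proof (cases "\<sigma> = y")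
    case True
    obtain z where z: "z \<noteq> 0" "orthogonal y z"
      by (rule orthogonal_to_vector_exists[of y]) auto
    show ?thesis
      by (rule exI[of _ "sgn z"]) (use z True in \<open>auto simp: norm_sgn sgn_div_norm orthogonal_def inner_commute\<close>)
  next
    case False
    define w where "w = y - \<sigma>"
    have w0: "w \<noteq> 0" using False by (simp add: w_def)
    have ww: "w \<bullet> w = 2 * (w \<bullet> y)"
      unfolding w_def by (simp add: inner_diff_left inner_diff_right yy ss inner_commute)
    have "(2 * (sgn w \<bullet> y)) *\<^sub>R sgn w = ((2 * (w \<bullet> y)) / (norm w)\<^sup>2) *\<^sub>R w"
      by (simp add: sgn_div_norm power2_eq_square divide_inverse mult_ac)
    also have "2 * (w \<bullet> y) = (norm w)\<^sup>2" by (simp add: ww power2_norm_eq_inner)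
  also have "((norm w)\<^sup>2 / (norm w)\<^sup>2) *\<^sub>R w = w" using w0 by simp
    finally have "\<sigma> = y - (2 * (sgn w \<bullet> y)) *\<^sub>R sgn w" by (simp add: w_def)
    then show ?thesis using w0 by (intro exI[of _ "sgn w"]) (simp add: norm_sgn)
  qed
  then show "\<exists>\<omega>. norm \<omega> = 1 \<and> \<sigma> = y - (2 * (\<omega> \<bullet> y)) *\<^sub>R \<omega> \<and>
      sqrt ((1 - \<sigma> \<bullet> y) / 2) = \<bar>\<omega> \<bullet> y\<bar>"
    using uniq by metis
  show "c = sqrt ((1 - \<sigma> \<bullet> y) / 2)"
    if "\<exists>\<omega>. norm \<omega> = 1 \<and> \<sigma> = y - (2 * (\<omega> \<bullet> y)) *\<^sub>R \<omega> \<and> c = \<bar>\<omega> \<bullet> y\<bar>" for c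
    using that uniq by auto
qed

text \<open>Integration variables \<open>(v\<^sub>j, I\<^sub>j, R, r, \<sigma>)\<close> of the collision integrals.\<close>

definition collision_measure :: "((real^3) \<times> real \<times> real \<times> real \<times> (real^3)) measure" where
  "collision_measure =
     lborel \<Otimes>\<^sub>M half_line \<Otimes>\<^sub>M unit_interval \<Otimes>\<^sub>M unit_interval \<Otimes>\<^sub>M sphere_measure"

definition Qel ::
    "mixture \<Rightarrow> nat \<Rightarrow> nat \<Rightarrow> (real^3 \<Rightarrow> real \<Rightarrow> real) \<Rightarrow> (real^3 \<Rightarrow> real \<Rightarrow> real)
       \<Rightarrow> real^3 \<Rightarrow> real \<Rightarrow> real" where
  "Qel X i j fi fj v I =
     (LINT (vj, Ij, R, r, \<sigma>)|collision_measure.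
        (let mi = mass X i; mj = mass X j; \<mu> = red_mass X i j;
             En = \<mu> * (norm (v - vj))\<^sup>2 / 2 + I + Ij;
             G = (1 / (mi + mj)) *\<^sub>R (mi *\<^sub>R v + mj *\<^sub>R vj);
             w = sqrt (2 * R * En / \<mu>);
             vi' = G + (mj / (mi + mj) * w) *\<^sub>R \<sigma>;
             vj' = G - (mi / (mi + mj) * w) *\<^sub>R \<sigma>;
             Ii' = r * (1 - R) * En;
             Ij' = (1 - r) * (1 - R) * En;
             c = cos_theta (sgn (v - vj)) \<sigma>;
             B = norm (v - vj) powr expo X * PhiEl X i j I Ij R r * bEl X i j c
         in (fi vi' Ii' * fj vj' Ij' - fi v I * fj vj Ij)
              * B * (2 * c * (1 - R) / (norm (v - vj) * weight X i I))))"

text \<open>Reactive operator for the quadruple \<open>(i, j, k, l)\<close>, with \<open>s = -1\<close> (forward) or \<open>s = 1\<close> (backward).\<close>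

definition Qreact_quad ::
    "mixture \<Rightarrow> nat \<Rightarrow> nat \<Rightarrow> nat \<Rightarrow> nat \<Rightarrow> real \<Rightarrow> (nat \<Rightarrow> real^3 \<Rightarrow> real \<Rightarrow> real)
       \<Rightarrow> real^3 \<Rightarrow> real \<Rightarrow> real" where
  "Qreact_quad X i j k l s f v I =
     (LINT (vj, Ij, R, r, \<sigma>)|collision_measure.
        (let mi = mass X i; mj = mass X j; mk = mass X k; ml = mass X l; M = total_mass X;
             E = reaction_heat X;
             En = red_mass X i j * (norm (v - vj))\<^sup>2 / 2 + I + Ij + s * E / 2;
             G = (1 / M) *\<^sub>R (mi *\<^sub>R v + mj *\<^sub>R vj);
             w = sqrt (2 / red_mass X k l) * sqrt (R * En + s * E / 6);
             vk' = G + (ml / M * w) *\<^sub>R \<sigma>;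
             vl' = G - (mk / M * w) *\<^sub>R \<sigma>;
             r' = (if i \<in> {2, 4} then 1 - r else r);
             Ik' = r' * (1 - R) * En + s * E / 6;
             Il' = (1 - r') * (1 - R) * En + s * E / 6;
             H = (if i \<in> {1, 2} then
                    of_bool (I \<ge> E / 6 \<and> Ij \<ge> E / 6 \<and> R * En \<ge> E / 6
                      \<and> red_mass X 1 2 / 2 * (norm (v - vj))\<^sup>2 \<ge> E / 6
                      \<and> (1 - R) * r * En \<ge> E / 6 \<and> (1 - R) * (1 - r) * En \<ge> E / 6)
                  else 1);
             c = cos_theta (sgn (v - vj)) \<sigma>;
             B = norm (v - vj) powr expo X * PhiRe X I Ij R r * bRe X c
         in ((mi * mj / (mk * ml)) ^ 3 * f k vk' Ik' * f l vl' Il' - f i v I * f j vj Ij)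
              * H * B * (2 * c * (1 - R) / ((mi * mj)\<^sup>2 * norm (v - vj) * weight X i I))))"

definition Qreact ::
    "mixture \<Rightarrow> nat \<Rightarrow> (nat \<Rightarrow> real^3 \<Rightarrow> real \<Rightarrow> real) \<Rightarrow> real^3 \<Rightarrow> real \<Rightarrow> real" where
  "Qreact X i =
     (if i = 1 then Qreact_quad X 1 2 3 4 (-1)
      else if i = 2 then Qreact_quad X 2 1 4 3 (-1)
      else if i = 3 then Qreact_quad X 3 4 1 2 1
      else Qreact_quad X 4 3 2 1 1)"


section \<open>Moments, conservation laws, convergence\<close>

definition phase_measure :: "((real^3) \<times> real) measure" where
  "phase_measure = lborel \<Otimes>\<^sub>M half_line"

definition moment :: "(real^3 \<Rightarrow> real \<Rightarrow> real) \<Rightarrow> real" where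
  "moment g = (LINT (v, I)|phase_measure. g v I)"

definition moment_converges :: "(real^3 \<Rightarrow> real \<Rightarrow> real) \<Rightarrow> bool" where
  "moment_converges g \<longleftrightarrow> integrable phase_measure (\<lambda>(v, I). g v I)"

definition kin_energy :: "mixture \<Rightarrow> nat \<Rightarrow> real^3 \<Rightarrow> real \<Rightarrow> real" where
  "kin_energy X i v I = mass X i * (norm v)\<^sup>2 / 2 + I"

definition conservation_laws :: "mixture \<Rightarrow> (nat \<Rightarrow> real^3 \<Rightarrow> real \<Rightarrow> real) \<Rightarrow> bool" where
  "conservation_laws X f \<longleftrightarrow>
     (\<forall>i\<in>{1..4}. moment (\<lambda>v I. kin_energy X i v I * Qel X i i (f i) (f i) v I * weight X i I) = 0) \<and>
     (\<forall>i\<in>{1..4}. \<forall>j\<in>{1..4}. i \<noteq> j \<longrightarrow>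
        moment (\<lambda>v I. kin_energy X i v I * Qel X i j (f i) (f j) v I * weight X i I)
        + moment (\<lambda>v I. kin_energy X j v I * Qel X j i (f j) (f i) v I * weight X j I) = 0) \<and>
     (\<Sum>i=1..4. moment (\<lambda>v I. (kin_energy X i v I + bindE X i) * Qreact X i f v I * weight X i I)) = 0 \<and>
     moment (\<lambda>v I. Qreact X 1 f v I * weight X 1 I) = moment (\<lambda>v I. Qreact X 2 f v I * weight X 2 I) \<and>
     moment (\<lambda>v I. Qreact X 2 f v I * weight X 2 I) = - moment (\<lambda>v I. Qreact X 3 f v I * weight X 3 I) \<and>
     - moment (\<lambda>v I. Qreact X 3 f v I * weight X 3 I) = - moment (\<lambda>v I. Qreact X 4 f v I * weight X 4 I)"

definition collision_moments_converge :: "mixture \<Rightarrow> (nat \<Rightarrow> real^3 \<Rightarrow> real \<Rightarrow> real) \<Rightarrow> bool" where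
  "collision_moments_converge X f \<longleftrightarrow>
     (\<forall>i\<in>{1..4}. \<forall>j\<in>{1..4}.
        moment_converges (\<lambda>v I. kin_energy X i v I * Qel X i j (f i) (f j) v I * weight X i I)) \<and>
     (\<forall>i\<in>{1..4}.
        moment_converges (\<lambda>v I. kin_energy X i v I * Qreact X i f v I * weight X i I) \<and>
        moment_converges (\<lambda>v I. Qreact X i f v I * weight X i I))"

text \<open>The integral in the reaction rate, over \<open>(I, I\<^sub>4, R, r, \<sigma>)\<close>. By rotation invariance of the surface
  measure it does not depend on the unit vector \<open>y\<close> from which \<open>\<theta>\<close> is measured.\<close>

definition rate_measure :: "(real \<times> real \<times> real \<times> real \<times> (real^3)) measure" where
  "rate_measure =
     half_line \<Otimes>\<^sub>M half_line \<Otimes>\<^sub>M unit_interval \<Otimes>\<^sub>M unit_interval \<Otimes>\<^sub>M sphere_measure"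

definition rate_integrand ::
    "mixture \<Rightarrow> real^3 \<Rightarrow> real \<Rightarrow> real \<times> real \<times> real \<times> real \<times> (real^3) \<Rightarrow> real" where
  "rate_integrand X y T = (\<lambda>(I, I4, R, r, \<sigma>).
     exp (- (I + I4) / (kB X * T)) * PhiRe X I I4 R r * bRe X (cos_theta y \<sigma>)
       * cos_theta y \<sigma> * (1 - R))"

definition rate_leading ::
    "mixture \<Rightarrow> real^3 \<Rightarrow> real \<Rightarrow> (nat \<Rightarrow> real) \<Rightarrow> real" where
  "rate_leading X y T n =
     ((mass X 3 * mass X 4 / (mass X 1 * mass X 2)) powr (3/2)
          * (n 1 * n 2 / (qint X 1 T * qint X 2 T)) * exp (- reaction_heat X / (kB X * T))
        - n 3 * n 4 / (qint X 3 T * qint X 4 T))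
     * (4 / (sqrt pi * (mass X 3 * mass X 4)\<^sup>2))
     * (2 * kB X * T / red_mass X 3 4) powr ((expo X - 1) / 2)
     * Gamma ((expo X + 2) / 2)
     * (LINT p|rate_measure. rate_integrand X y T p)"

definition integrals_converge :: "mixture \<Rightarrow> bool" where
  "integrals_converge X \<longleftrightarrow>
     (\<forall>i\<in>{1..4}. \<forall>T>0.
        integrable half_line (\<lambda>I. weight X i I * exp (- I / (kB X * T))) \<and>
        integrable half_line (\<lambda>I. I * weight X i I * exp (- I / (kB X * T)))) \<and>
     (\<forall>y T. norm y = 1 \<longrightarrow> T > 0 \<longrightarrow> integrable rate_measure (rate_integrand X y T))"


section \<open>Formal limits\<close>

text \<open>A family \<open>g \<epsilon>\<close> of fields on \<open>(0,\<infinity>) \<times> \<Omega>\<close> converges pointwise to \<open>g0\<close> as \<open>\<epsilon> \<rightarrow> 0+\<close>, all fields are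
  differentiable in \<open>t\<close> and in \<open>x\<close>, and the limit may be exchanged with the derivatives.\<close>

definition formal_limit ::
    "real \<Rightarrow> (real^3) set \<Rightarrow> (real \<Rightarrow> real \<Rightarrow> real^3 \<Rightarrow> 'b::real_normed_vector)
       \<Rightarrow> (real \<Rightarrow> real^3 \<Rightarrow> 'b) \<Rightarrow> bool" where
  "formal_limit \<epsilon>0 \<Omega> g g0 \<longleftrightarrow>
     (\<forall>t>0. \<forall>x\<in>\<Omega>.
        (\<lambda>s. g0 s x) differentiable at t \<and> g0 t differentiable at x \<and>
        (\<forall>\<epsilon>. 0 < \<epsilon> \<and> \<epsilon> < \<epsilon>0 \<longrightarrow> (\<lambda>s. g \<epsilon> s x) differentiable at t \<and> g \<epsilon> t differentiable at x) \<and>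
        ((\<lambda>\<epsilon>. g \<epsilon> t x) \<longlongrightarrow> g0 t x) (at_right 0) \<and>
        ((\<lambda>\<epsilon>. vector_derivative (\<lambda>s. g \<epsilon> s x) (at t))
           \<longlongrightarrow> vector_derivative (\<lambda>s. g0 s x) (at t)) (at_right 0) \<and>
        (\<forall>h. ((\<lambda>\<epsilon>. frechet_derivative (g \<epsilon> t) (at x) h)
           \<longlongrightarrow> frechet_derivative (g0 t) (at x) h) (at_right 0)))"


section \<open>Macroscopic energy\<close>

definition energy_density :: "mixture \<Rightarrow> (nat \<Rightarrow> real) \<Rightarrow> real \<Rightarrow> real" where
  "energy_density X n T =
     (\<Sum>i=1..4. 3/2 * n i * kB X * T + n i * (qstar X i T / qint X i T))"

definition energy_flux :: "mixture \<Rightarrow> (nat \<Rightarrow> real) \<Rightarrow> (nat \<Rightarrow> real^3) \<Rightarrow> real \<Rightarrow> real^3" where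
  "energy_flux X n u T =
     (\<Sum>i=1..4. (5/2 * n i * kB X * T) *\<^sub>R u i + (n i * (qstar X i T / qint X i T)) *\<^sub>R u i)"

end

theory Submission
  imports Defs
begin

text \<open>Integrating the kinetic equation against the kinetic and internal energy removes the elastic terms, and
  conservation of the total energy turns the reactive terms into \<open>-E\<close> times the moment of \<open>Q\<^sub>3\<close>. The
  derivatives of a Maxwellian are the Maxwellian times a polynomial, so the moments of the left-hand side are
  explicit in the macroscopic fields and their derivatives; the factor \<open>1/\<epsilon>\<close> in front of the transport term is
  absorbed by the velocity \<open>\<epsilon> u\<close>, whose odd moments vanish at order zero. For the moment of \<open>Q\<^sub>3\<close>, energy
  conservation in the backward reaction bounds gain and loss by the same Gaussian in the pre-collisional
  variables, so the limit may be taken under the integral. At equal temperatures and vanishing velocities the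
  integrand factorises: by rotation invariance of \<open>d\<sigma>\<close> the integral over \<open>(I, I\<^sub>4, R, r, \<sigma>)\<close> does not depend on the
  relative velocity, and the remaining Gaussian velocity integral gives the Gamma function.\<close>

section \<open>Rotation invariance and Gaussian integrals\<close>

text \<open>Species 3 is followed because its factor \<open>H\<close> is 1: the backward reaction
  has no threshold, so no indicator has to be carried through the limit, and \<open>heat\<close>
  keeps all product energies nonnegative. The hypotheses exchange limits with derivatives for the
  macroscopic fields only. The transport moments are closed formulas in these fields, so the single
  exchange of limit and integral that is left concerns the reactive moment. Its obstacle is that
  temperature and drift of the Maxwellians vary with \<epsilon>; a Gaussian at the raised
  temperature 4T dominates them all for small \<epsilon>, and it is integrable against the kernel
  because \<open>integrals_converge\<close> asks for convergence at every positive temperature. As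
  \<open>PhiRe\<close> and \<open>bRe\<close> come without a sign, the rotation argument is run for
  absolute values as well as for the integrand itself.\<close>

lemma distr_lborel_orthogonal:
  fixes Q :: "real^3 \<Rightarrow> real^3"
  assumes Q: "orthogonal_transformation Q"
  shows "distr lborel borel Q = lborel"
proof (rule lborel_eqI[symmetric])
  have lin: "linear Q" using Q by (rule orthogonal_transformation_linear)
  have Qm[measurable]: "Q \<in> borel_measurable borel"
    by (intro borel_measurable_continuous_onI linear_continuous_on linear_conv_bounded_linear[THEN iffD1] lin)
  obtain P where P: "orthogonal_transformation P" "\<And>x. P (Q x) = x" "\<And>x. Q (P x) = x"
  proof
    show "orthogonal_transformation (inv Q)" by (rule orthogonal_transformation_inv[OF Q])
    show "inv Q (Q x) = x" for x using orthogonal_transformation_inj[OF Q] by (rule inv_f_f)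
    show "Q (inv Q x) = x" for x using orthogonal_transformation_surj[OF Q] by (rule surj_f_inv_f)
  qed
  fix l u :: "real^3"
  assume lu: "\<And>b. b \<in> Basis \<Longrightarrow> l \<bullet> b \<le> u \<bullet> b"
  \<comment> \<open>The inverse rotation turns the preimage of a box into an image, and images under
    orthogonal maps keep their Lebesgue measure. The passage through \<open>lebesgue\<close> is
    harmless, since \<open>Pb\<close> shows the image to be Borel.\<close>
  have img: "Q -` box l u = P ` box l u"
  proof (intro set_eqI iffI)
    fix x assume "x \<in> Q -` box l u"
    then show "x \<in> P ` box l u" using P(2)[of x] by (intro image_eqI[of _ P "Q x"]) auto
  qed (auto simp: P(3))
  have Pb: "P ` box l u \<in> sets borel"
    unfolding img[symmetric] by (rule measurable_sets_borel[OF Qm]) simp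
  have "emeasure (distr lborel borel Q) (box l u) = emeasure lborel (Q -` box l u)"
    by (subst emeasure_distr) auto
  also have "\<dots> = emeasure lebesgue (P ` box l u)"
    unfolding img using Pb by (simp add: emeasure_completion)
  also have "\<dots> = ennreal (measure lebesgue (P ` box l u))"
    by (rule emeasure_eq_measure2) (metis P(1) lmeasurable_box measurable_orthogonal_image)
  also have "\<dots> = ennreal (measure lebesgue (box l u))"
    by (subst measure_orthogonal_image[OF P(1)]) auto
  also have "\<dots> = emeasure lebesgue (box l u)"
    by (rule emeasure_eq_measure2[symmetric]) (rule lmeasurable_box)
  also have "\<dots> = (\<Prod>b\<in>Basis. (u - l) \<bullet> b)"
    using lu by (simp add: emeasure_completion)
  finally show "emeasure (distr lborel borel Q) (box l u) = (\<Prod>b\<in>Basis. (u - l) \<bullet> b)" .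
qed simp

lemma orthogonal_transformation_measurable [measurable_dest]:
  fixes Q :: "real^3 \<Rightarrow> real^3"
  assumes "orthogonal_transformation Q"
  shows "Q \<in> borel_measurable borel"
  using orthogonal_transformation_linear[OF assms]
  by (intro borel_measurable_continuous_onI linear_continuous_on linear_conv_bounded_linear[THEN iffD1])

lemma sets_sphere_measure [simp, measurable_cong]: "sets sphere_measure = sets borel"
  by (simp add: sphere_measure_def)

lemma space_sphere_measure [simp]: "space sphere_measure = UNIV"
  by (simp add: sphere_measure_def)

text \<open>The surface measure is the image under \<open>sgn\<close> of a constant density on the
  unit ball. A rotation commutes with \<open>sgn\<close> and preserves the ball and the volume, so
  invariance is inherited from \<open>lborel\<close> without parametrising the sphere.\<close>

lemma distr_sphere_orthogonal:
  assumes Q: "orthogonal_transformation Q"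
  shows "distr sphere_measure borel Q = sphere_measure"
proof (rule measure_eqI)
  note [measurable] = orthogonal_transformation_measurable[OF Q] sgn_measurable_vec
  fix A assume "A \<in> sets (distr sphere_measure borel Q)"
  then have A[measurable]: "A \<in> sets borel" by simp
  have [measurable]: "(\<lambda>x::real^3. ennreal (3 * indicator (ball 0 1) x)) \<in> borel_measurable borel"
    using cone_density_measurable by simp
  have eq: "emeasure sphere_measure B
      = (\<integral>\<^sup>+x. ennreal (3 * indicator (ball 0 1) x) * indicator B (sgn x) \<partial>lborel)"
    if [measurable]: "B \<in> sets borel" for B
    unfolding sphere_measure_def using sgn_measurable_vec cone_density_measurable
    by (subst emeasure_distr)
       (auto simp: emeasure_density indicator_def measurable_sets_borel[OF sgn_measurable_vec that, simplified] intro!: nn_integral_cong)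
  have nQ: "norm (Q x) = norm x" for x using Q by (rule orthogonal_transformation_norm)
  have sQ: "sgn (Q x) = Q (sgn x)" for x
    using nQ orthogonal_transformation_linear[OF Q] by (simp add: sgn_div_norm linear_scale)
  have [measurable]: "Q -` A \<in> sets borel" by (rule measurable_sets_borel[OF _ A]) measurable
  have "emeasure (distr sphere_measure borel Q) A = emeasure sphere_measure (Q -` A)"
    by (subst emeasure_distr) auto
  also have "\<dots> = (\<integral>\<^sup>+x. ennreal (3 * indicator (ball 0 1) (Q x)) * indicator A (sgn (Q x)) \<partial>lborel)"
    by (subst eq) (auto simp: sQ nQ indicator_def intro!: nn_integral_cong)
  also have "\<dots> = (\<integral>\<^sup>+x. ennreal (3 * indicator (ball 0 1) x) * indicator A (sgn x) \<partial>distr lborel borel Q)"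
    by (subst nn_integral_distr) auto
  also have "\<dots> = emeasure sphere_measure A" by (simp add: distr_lborel_orthogonal[OF Q] eq)
  finally show "emeasure (distr sphere_measure borel Q) A = emeasure sphere_measure A" .
qed simp

text \<open>Integration in spherical shells, stated as the law of a|x|^2: the ball where a|x|^2 is
  at most s has volume (4/3) pi (s/a)^(3/2), whose derivative in s is the density. Equality on
  half-lines determines the measure.\<close>

lemma distr_lborel_scaled_norm_square:
  fixes a :: real
  assumes a: "a > 0"
  shows "distr (lborel :: (real^3) measure) borel (\<lambda>x. a * (norm x)\<^sup>2)
    = density lborel (\<lambda>t. ennreal (2 * pi * a powr (- (3/2)) * t powr (1/2)) * indicator {0..} t)"
    (is "?D = ?R")
proof (rule measure_eqI_generator_eq[where E = "range atMost" and \<Omega> = UNIV and A = "\<lambda>n::nat. {..real n}"])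
  show eq: "emeasure ?D S = emeasure ?R S" if "S \<in> range atMost" for S
  proof -
    from that obtain s where S: "S = {..s}" by auto
    have D: "emeasure ?D S = emeasure lborel {x::real^3. a * (norm x)\<^sup>2 \<le> s}"
      unfolding S by (subst emeasure_distr) (auto simp: vimage_def)
    have R: "emeasure ?R S = (\<integral>\<^sup>+t. ennreal (2 * pi * a powr (- (3/2)) * t powr (1/2)) * indicator {0..s} t \<partial>lborel)"
      unfolding S by (subst emeasure_density) (auto simp: indicator_def intro!: nn_integral_cong)
    show ?thesis
    proof (cases "s \<ge> 0")
      case False
      then have "\<not> a * (norm x)\<^sup>2 \<le> s" for x :: "real^3"
        using a by (smt (verit) mult_nonneg_nonneg zero_le_power2)
      then show ?thesis using False unfolding D R by (simp add: atLeastatMost_empty)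
    next
      case True
      have "a * (norm x)\<^sup>2 \<le> s \<longleftrightarrow> norm x \<le> sqrt (s / a)" for x :: "real^3"
        using real_sqrt_le_iff[of "(norm x)\<^sup>2" "s / a"] a by (simp add: pos_le_divide_eq mult.commute)
      then have "{x::real^3. a * (norm x)\<^sup>2 \<le> s} = cball 0 (sqrt (s / a))"
        by (simp only: set_eq_iff mem_cball_0 mem_Collect_eq simp_thms)
      then have "emeasure ?D S = ennreal (unit_ball_vol 3 * sqrt (s / a) ^ 3)"
        unfolding D using True a by (simp add: emeasure_cball)
      also have "unit_ball_vol 3 * sqrt (s / a) ^ 3 = 2 * pi * a powr (- (3/2)) * (s powr (3/2) / (3/2))"
      proof (cases "s = 0")
        case False
        have c: "s / a > 0" using True a False by simp
        have "sqrt (s / a) ^ 3 = ((s / a) powr (1/2)) ^ 3"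
          using c by (subst powr_half_sqrt) simp_all
        also have "\<dots> = (s / a) powr (3/2)" using c True a False by (subst powr_power) simp_all
        also have "\<dots> = s powr (3/2) * a powr (- (3/2))"
          using True a by (simp add: powr_divide powr_minus_divide)
        finally show ?thesis by (simp add: eval_unit_ball_vol)
      qed simp
      also have "ennreal \<dots> = emeasure ?R S"
        unfolding R
      proof (rule nn_integral_has_integral_lebesgue'[symmetric])
        show "((\<lambda>t. 2 * pi * a powr - (3 / 2) * t powr (1 / 2)) has_integral
            2 * pi * a powr - (3 / 2) * (s powr (3 / 2) / (3 / 2))) {0..s}"
          using has_integral_powr_from_0[of "1/2" s] True by (intro has_integral_mult_right) simp
      qed auto
      finally show ?thesis .
    qed
  qed
  show "emeasure ?D {..real n} \<noteq> \<infinity>" for n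
  proof -
    have "{x::real^3. a * (norm x)\<^sup>2 \<le> n} \<subseteq> cball 0 (sqrt (n / a))"
      using a by (auto intro!: real_le_rsqrt simp: field_simps)
    then have "emeasure lborel {x::real^3. a * (norm x)\<^sup>2 \<le> n} \<le> emeasure lborel (cball (0::real^3) (sqrt (n / a)))"
      by (intro emeasure_mono) auto
    moreover have "emeasure lborel (cball (0::real^3) (sqrt (n / a))) < \<infinity>" by (rule emeasure_lborel_cball_finite)
    ultimately show ?thesis by (subst emeasure_distr) (auto simp: vimage_def)
  qed
  show "(\<Union>i. {..real i}) = UNIV" by (auto intro: real_arch_simple)
  show "Int_stable (range (atMost :: real \<Rightarrow> _))" by (auto simp: Int_stable_def)
qed (auto simp: borel_eq_atMost)


text \<open>With t = a|x|^2 the integrand becomes a multiple of t^(p/2) exp(-t) against a density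
  proportional to t^(1/2), which is Euler's integral at (p+3)/2; p > -3 is convergence at the
  origin. The exponent is real because the collision kernel needs p = \<gamma> - 1.\<close>

lemma has_bochner_integral_powr_gaussian:
  fixes a p :: real
  assumes a: "a > 0" and p: "p > -3"
  shows "has_bochner_integral lborel (\<lambda>x::real^3. norm x powr p * exp (- (a * (norm x)\<^sup>2)))
    (2 * pi * a powr (- ((p + 3) / 2)) * Gamma ((p + 3) / 2))"
proof (rule has_bochner_integral_nn_integral)
  define h where "h t = (t / a) powr (p / 2) * exp (- t)" for t
  have hm[measurable]: "h \<in> borel_measurable borel" unfolding h_def by measurable
  have h: "norm x powr p * exp (- (a * (norm x)\<^sup>2)) = h (a * (norm x)\<^sup>2)" for x :: "real^3"
  proof -
    have "((norm x)\<^sup>2) powr (p / 2) = norm x powr p"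
    proof (cases "x = 0")
      case False
      then have "(norm x)\<^sup>2 = norm x powr 2" by simp
      then show ?thesis by (simp only: powr_powr) simp
    qed simp
    then show ?thesis using a by (simp add: h_def)
  qed
  have "(\<integral>\<^sup>+x. ennreal (norm x powr p * exp (- (a * (norm x)\<^sup>2))) \<partial>(lborel :: (real^3) measure))
      = (\<integral>\<^sup>+t. ennreal (h t) \<partial>distr (lborel :: (real^3) measure) borel (\<lambda>x. a * (norm x)\<^sup>2))"
    by (subst nn_integral_distr) (simp_all add: h)
  also have "\<dots> = (\<integral>\<^sup>+t. ennreal (2 * pi * a powr (- (3/2)) * t powr (1/2)) * indicator {0..} t * ennreal (h t) \<partial>lborel)"
    by (subst distr_lborel_scaled_norm_square[OF a], subst nn_integral_density) simp_all
  also have "\<dots> = (\<integral>\<^sup>+t. ennreal (2 * pi * a powr (- ((p + 3) / 2)) * (t powr ((p + 3) / 2 - 1) / exp t)) * indicator {0..} t \<partial>lborel)"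
  proof (intro nn_integral_cong)
    fix t :: real
    show "ennreal (2 * pi * a powr (- (3/2)) * t powr (1/2)) * indicator {0..} t * ennreal (h t)
        = ennreal (2 * pi * a powr (- ((p + 3) / 2)) * (t powr ((p + 3) / 2 - 1) / exp t)) * indicator {0..} t"
    proof (cases "t > 0")
      case True
      have "2 * pi * a powr (- (3/2)) * t powr (1/2) * h t
          = 2 * pi * (a powr (- (3/2)) * a powr (- (p/2))) * (t powr (1/2) * t powr (p / 2)) / exp t"
        using True a by (simp add: h_def powr_divide powr_minus_divide exp_minus field_simps)
      also have "\<dots> = 2 * pi * a powr (- ((p + 3) / 2)) * (t powr ((p + 3) / 2 - 1) / exp t)"
        by (simp add: powr_add[symmetric] add_divide_distrib algebra_simps)
      finally show ?thesis using True by (simp add: ennreal_mult' [symmetric])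
    qed (auto simp: indicator_def)
  qed
  also have "\<dots> = ennreal (2 * pi * a powr (- ((p + 3) / 2)) * Gamma ((p + 3) / 2))"
    using p Gamma_integral_real[of "(p + 3) / 2"]
    by (intro nn_integral_has_integral_lebesgue' has_integral_mult_right) auto
  finally show "(\<integral>\<^sup>+x. ennreal (norm x powr p * exp (- (a * (norm x)\<^sup>2))) \<partial>(lborel :: (real^3) measure))
      = ennreal (2 * pi * a powr (- ((p + 3) / 2)) * Gamma ((p + 3) / 2))" .
  show "0 \<le> 2 * pi * a powr (- ((p + 3) / 2)) * Gamma ((p + 3) / 2)"
    using p Gamma_real_pos[of "(p + 3) / 2"] by simp
qed auto


section \<open>Polynomial moments of the Gaussian in three dimensions\<close>

lemma Gamma_half_integers:
  "Gamma (3/2 :: real) = sqrt pi / 2" "Gamma (5/2 :: real) = 3 / 4 * sqrt pi" "Gamma (7/2 :: real) = 15 / 8 * sqrt pi"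
proof -
  have 1: "Gamma (1/2 + 1 :: real) = 1/2 * Gamma (1/2)" by (intro Gamma_plus1) auto
  then show g3: "Gamma (3/2 :: real) = sqrt pi / 2" by (simp add: Gamma_one_half_real)
  have 2: "Gamma (3/2 + 1 :: real) = 3/2 * Gamma (3/2)" by (intro Gamma_plus1) auto
  then show g5: "Gamma (5/2 :: real) = 3 / 4 * sqrt pi" by (simp add: g3)
  have 3: "Gamma (5/2 + 1 :: real) = 5/2 * Gamma (5/2)" by (intro Gamma_plus1) auto
  then show "Gamma (7/2 :: real) = 15 / 8 * sqrt pi" by (simp add: g5)
qed

lemma has_bochner_integral_gaussian:
  fixes a :: real
  assumes a: "a > 0"
  shows "has_bochner_integral lborel (\<lambda>x::real^3. exp (- (a * (norm x)\<^sup>2))) ((pi / a) powr (3/2))"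
    and "has_bochner_integral lborel (\<lambda>x::real^3. (norm x)\<^sup>2 * exp (- (a * (norm x)\<^sup>2)))
           (3 / (2 * a) * (pi / a) powr (3/2))"
    and "has_bochner_integral lborel (\<lambda>x::real^3. (norm x)^4 * exp (- (a * (norm x)\<^sup>2)))
           (15 / (4 * a\<^sup>2) * (pi / a) powr (3/2))"
proof -
  have pi32: "pi powr (3/2) = pi * sqrt pi"
    using powr_add[of pi 1 "1/2"] by (simp add: powr_half_sqrt)
  have G: "(pi / a) powr (3/2) = pi * sqrt pi * a powr (- (3/2))"
    using a by (simp add: powr_divide powr_minus_divide pi32)
  have "a powr (- (5/2)) = a powr (- (3/2)) * a powr (- 1)" "a powr (- (7/2)) = a powr (- (3/2)) * a powr (- 2)"
    by (simp_all only: powr_add[symmetric]) simp_all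
  moreover have "a powr (- 1) = 1 / a" using a by (simp only: powr_minus_divide powr_one)
  moreover have "a powr (- 2) = 1 / a\<^sup>2" using a by (simp add: powr_minus_divide)
  ultimately have p: "a powr (- (5/2)) = a powr (- (3/2)) / a" "a powr (- (7/2)) = a powr (- (3/2)) / a\<^sup>2"
    by (simp_all only: times_divide_eq_right mult_1_right)
  \<comment> \<open>\<open>0 powr 0\<close> is 0, so \<open>norm x powr 0\<close> differs from 1 at
    the origin. The case of exponent 0 is corrected on this null set.\<close>
  have AE: "AE x::real^3 in lborel. x \<noteq> 0" by (rule AE_lborel_singleton)
  have 0: "has_bochner_integral lborel (\<lambda>x::real^3. norm x powr 0 * exp (- (a * (norm x)\<^sup>2))) ((pi / a) powr (3/2))"
    using has_bochner_integral_powr_gaussian[OF a, of 0] by (simp add: G Gamma_half_integers mult_ac)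
  show "has_bochner_integral lborel (\<lambda>x::real^3. exp (- (a * (norm x)\<^sup>2))) ((pi / a) powr (3/2))"
    by (rule has_bochner_integral_cong_AE[THEN iffD1, OF _ _ _ 0]) (use AE in auto)
  have 2: "has_bochner_integral lborel (\<lambda>x::real^3. norm x powr 2 * exp (- (a * (norm x)\<^sup>2))) (3 / (2 * a) * (pi / a) powr (3/2))"
    using has_bochner_integral_powr_gaussian[OF a, of 2] by (simp add: G Gamma_half_integers p field_simps)
  show "has_bochner_integral lborel (\<lambda>x::real^3. (norm x)\<^sup>2 * exp (- (a * (norm x)\<^sup>2))) (3 / (2 * a) * (pi / a) powr (3/2))"
    using 2 by simp
  have 4: "has_bochner_integral lborel (\<lambda>x::real^3. norm x powr 4 * exp (- (a * (norm x)\<^sup>2))) (15 / (4 * a\<^sup>2) * (pi / a) powr (3/2))"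
    using has_bochner_integral_powr_gaussian[OF a, of 4] by (simp add: G Gamma_half_integers p field_simps)
  show "has_bochner_integral lborel (\<lambda>x::real^3. (norm x)^4 * exp (- (a * (norm x)\<^sup>2))) (15 / (4 * a\<^sup>2) * (pi / a) powr (3/2))"
    using 4 by simp
qed

lemma integrable_power_gaussian:
  fixes a :: real
  assumes a: "a > 0"
  shows "integrable lborel (\<lambda>x::real^3. norm x ^ k * exp (- (a * (norm x)\<^sup>2)))"
proof (cases "k = 0")
  case True
  then show ?thesis using has_bochner_integral_gaussian(1)[OF a] by (simp add: has_bochner_integral_iff)
next
  case False
  have eq: "norm x powr real k = norm x ^ k" for x :: "real^3"
    using False by (cases "x = 0") (simp_all add: powr_realpow)
  have "integrable lborel (\<lambda>x::real^3. norm x powr (real k) * exp (- (a * (norm x)\<^sup>2)))"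
    using has_bochner_integral_powr_gaussian[OF a, of "real k"] by (simp add: has_bochner_integral_iff)
  then show ?thesis unfolding eq .
qed

lemma has_bochner_integral_odd:
  fixes g :: "real^3 \<Rightarrow> real"
  assumes g: "integrable lborel g" and odd: "\<And>x. g (- x) = - g x"
  shows "has_bochner_integral lborel g 0"
proof -
  have Q: "orthogonal_transformation (uminus :: real^3 \<Rightarrow> _)" 
    by (simp add: orthogonal_transformation_def linear_uminus)
  have "integral\<^sup>L lborel g = integral\<^sup>L (distr lborel borel uminus) g"
    by (simp only: distr_lborel_orthogonal[OF Q])
  also have "\<dots> = (LINT x|lborel. g (- x))" using g by (intro integral_distr) auto
  also have "\<dots> = - integral\<^sup>L lborel g" by (simp add: odd)
  finally show ?thesis using g by (simp add: has_bochner_integral_iff)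
qed

text \<open>As a function of (p, q) the integral is a bilinear form invariant under rotations, hence
  a multiple of the inner product. Rotating unit vectors into each other leaves one constant
  \<open>\<beta>\<close>, the trace over \<open>Basis\<close> gives 3 \<open>\<beta>\<close> =
  \<open>I\<close>, and polarisation passes from the diagonal to all pairs.\<close>

lemma has_bochner_integral_second_moment:
  fixes \<rho> :: "real^3 \<Rightarrow> real" and p q :: "real^3"
  assumes [measurable]: "\<rho> \<in> borel_measurable borel"
    and rad: "\<And>x y. norm x = norm y \<Longrightarrow> \<rho> x = \<rho> y"
    and I: "has_bochner_integral lborel (\<lambda>x. (norm x)\<^sup>2 * \<rho> x) I"
  shows "has_bochner_integral lborel (\<lambda>x. (x \<bullet> p) * (x \<bullet> q) * \<rho> x) (p \<bullet> q / 3 * I)"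
proof -
  define B where "B p q = (LINT x|lborel. (x \<bullet> p) * (x \<bullet> q) * \<rho> x)" for p q
  have int: "integrable lborel (\<lambda>x. (x \<bullet> p) * (x \<bullet> q) * \<rho> x)" for p q
  proof (rule Bochner_Integration.integrable_bound)
    show "integrable lborel (\<lambda>x. norm p * norm q * ((norm x)\<^sup>2 * \<rho> x))"
      using I by (auto simp: has_bochner_integral_iff)
    show "AE x in lborel. norm ((x \<bullet> p) * (x \<bullet> q) * \<rho> x) \<le> norm (norm p * norm q * ((norm x)\<^sup>2 * \<rho> x))"
    proof (rule AE_I2)
      fix x
      have "\<bar>x \<bullet> p\<bar> * \<bar>x \<bullet> q\<bar> \<le> (norm x * norm p) * (norm x * norm q)"
        by (intro mult_mono Cauchy_Schwarz_ineq2) auto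
      then have "\<bar>x \<bullet> p\<bar> * \<bar>x \<bullet> q\<bar> * \<bar>\<rho> x\<bar> \<le> ((norm x * norm p) * (norm x * norm q)) * \<bar>\<rho> x\<bar>"
        by (rule mult_right_mono) simp
      then show "norm ((x \<bullet> p) * (x \<bullet> q) * \<rho> x) \<le> norm (norm p * norm q * ((norm x)\<^sup>2 * \<rho> x))"
        by (simp add: abs_mult power2_eq_square mult_ac)
    qed
  qed simp
  define \<beta> where "\<beta> = B (axis 1 1) (axis 1 1)"
  have unit: "B p p = \<beta>" if p: "norm p = 1" for p
  proof -
    obtain Q :: "real^3 \<Rightarrow> real^3" where Q: "orthogonal_transformation Q" "Q (axis 1 1) = p"
      by (rule orthogonal_transformation_exists_1[of "axis 1 1" p]) (use p in auto)
    note [measurable] = orthogonal_transformation_measurable[OF Q(1)]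
    have "B p p = (LINT x|distr lborel borel Q. (x \<bullet> p) * (x \<bullet> p) * \<rho> x)"
      by (simp only: distr_lborel_orthogonal[OF Q(1)] B_def)
    also have "\<dots> = (LINT x|lborel. (Q x \<bullet> p) * (Q x \<bullet> p) * \<rho> (Q x))"
      by (subst integral_distr) auto
    also have "\<dots> = \<beta>" unfolding \<beta>_def B_def
      using Q(1) rad[of "Q _"] orthogonal_transformation_norm[OF Q(1)]
      by (intro Bochner_Integration.integral_cong refl)
         (simp add: Q(2)[symmetric] orthogonal_transformation_def)
    finally show ?thesis .
  qed
  have diag: "B p p = \<beta> * (p \<bullet> p)" for p
  proof (cases "p = 0")
    case False
    have "B p p = (norm p)\<^sup>2 * B (sgn p) (sgn p)"
      unfolding B_def using False
      by (subst Bochner_Integration.integral_mult_right_zero[symmetric])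
         (auto simp: sgn_div_norm power2_eq_square field_simps intro!: Bochner_Integration.integral_cong)
    then show ?thesis using unit[of "sgn p"] False by (simp add: norm_sgn power2_norm_eq_inner mult.commute)
  qed (simp add: B_def)
  have "I = (LINT x|lborel. (\<Sum>b\<in>Basis. (x \<bullet> b) * (x \<bullet> b) * \<rho> x))"
    using I by (subst has_bochner_integral_integral_eq[OF I, symmetric])
      (auto intro!: Bochner_Integration.integral_cong simp: power2_norm_eq_inner euclidean_inner[of x x for x :: "real^3"] sum_distrib_right)
  also have "\<dots> = (\<Sum>b\<in>(Basis :: (real^3) set). B b b)"
    unfolding B_def by (rule Bochner_Integration.integral_sum) (rule int)
  also have "\<dots> = 3 * \<beta>" by (simp add: diag)
  finally have \<beta>: "\<beta> = I / 3" by simp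
  have "4 * B p q = (LINT x|lborel. (x \<bullet> (p + q)) * (x \<bullet> (p + q)) * \<rho> x - (x \<bullet> (p - q)) * (x \<bullet> (p - q)) * \<rho> x)"
    unfolding B_def
    by (subst Bochner_Integration.integral_mult_right_zero[symmetric])
       (auto intro!: Bochner_Integration.integral_cong simp: algebra_simps inner_add_right inner_diff_right)
  also have "\<dots> = B (p + q) (p + q) - B (p - q) (p - q)"
    unfolding B_def by (rule Bochner_Integration.integral_diff) (rule int)+
  also have "\<dots> = \<beta> * (4 * (p \<bullet> q))"
    by (simp add: diag inner_add_left inner_add_right inner_diff_left inner_diff_right inner_commute algebra_simps)
  finally have "B p q = p \<bullet> q / 3 * I" by (simp add: \<beta> mult.commute)
  then show ?thesis using int[of p q] by (simp add: has_bochner_integral_iff B_def)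
qed

section \<open>Moments of the weights\<close>

text \<open>By first countability it suffices to test sequences tending to \<open>a\<close>.
  Measurability and the bound hold only eventually, so each sequence is shifted by the
  \<open>N\<close> from which on they hold.\<close>

lemma dominated_convergence_at_within:
  fixes s :: "'a::first_countable_topology \<Rightarrow> 'b \<Rightarrow> real"
  assumes f: "f \<in> borel_measurable M" and s: "\<forall>\<^sub>F t in at a within S. s t \<in> borel_measurable M"
    and w: "integrable M w"
    and lim: "AE x in M. ((\<lambda>t. s t x) \<longlongrightarrow> f x) (at a within S)"
    and bound: "\<forall>\<^sub>F t in at a within S. AE x in M. norm (s t x) \<le> w x"
  shows "((\<lambda>t. integral\<^sup>L M (s t)) \<longlongrightarrow> integral\<^sup>L M f) (at a within S)"
  unfolding tendsto_at_iff_sequentially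
proof (intro allI impI)
  fix X assume X: "\<forall>i::nat. X i \<in> S - {a}" "X \<longlonglongrightarrow> a"
  then have fl: "filterlim X (at a within S) sequentially"
    by (auto simp: filterlim_at)
  have "\<forall>\<^sub>F i in sequentially. s (X i) \<in> borel_measurable M \<and> (AE x in M. norm (s (X i) x) \<le> w x)"
    using eventually_compose_filterlim[OF eventually_conj[OF s bound] fl] .
  then obtain N where N: "\<And>i. i \<ge> N \<Longrightarrow> s (X i) \<in> borel_measurable M \<and> (AE x in M. norm (s (X i) x) \<le> w x)"
    by (auto simp: eventually_sequentially)
  have "(\<lambda>i. integral\<^sup>L M (s (X (i + N)))) \<longlonglongrightarrow> integral\<^sup>L M f"
  proof (rule integral_dominated_convergence[OF f _ w])
    show "AE x in M. (\<lambda>i. s (X (i + N)) x) \<longlonglongrightarrow> f x"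
      using lim
    proof eventually_elim
      fix x assume "((\<lambda>t. s t x) \<longlongrightarrow> f x) (at a within S)"
      then have "(\<lambda>i. s (X i) x) \<longlonglongrightarrow> f x" by (rule filterlim_compose[OF _ fl])
      then show "(\<lambda>i. s (X (i + N)) x) \<longlonglongrightarrow> f x" by (rule LIMSEQ_ignore_initial_segment)
    qed
  qed (use N in auto)
  then have "(\<lambda>i. integral\<^sup>L M (s (X i))) \<longlonglongrightarrow> integral\<^sup>L M f" by (rule LIMSEQ_offset)
  then show "((\<lambda>t. integral\<^sup>L M (s t)) \<circ> X) \<longlonglongrightarrow> integral\<^sup>L M f" by (simp add: o_def)
qed

lemma space_half_line [simp]: "space half_line = {0..}"
  by (simp add: space_restrict_space)

lemma space_unit_interval [simp]: "space unit_interval = {0..1}"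
  by (simp add: space_restrict_space)

lemma measurable_ident_half_line: "(\<lambda>x. x) \<in> borel_measurable half_line"
  by (rule measurable_restrict_space1) simp

lemma measurable_ident_unit_interval: "(\<lambda>x. x) \<in> borel_measurable unit_interval"
  by (rule measurable_restrict_space1) simp

text \<open>The hypotheses of the theorem that concern the mixture alone. Solutions, scaling and
  domain are kept out, so the lemmas of the locale apply to the scaled fields and to their limits
  alike.\<close>

locale reacting_mixture =
  fixes X :: mixture
  assumes masses: "\<And>i. i \<in> {1..4} \<Longrightarrow> mass X i > 0"
    and mass_balance: "mass X 1 + mass X 2 = mass X 3 + mass X 4"
    and heat: "reaction_heat X \<ge> 0"
    and boltzmann: "kB X > 0"
    and exponent: "expo X \<ge> 1"
    and weight_nonneg: "\<And>i I. i \<in> {1..4} \<Longrightarrow> I \<ge> 0 \<Longrightarrow> weight X i I \<ge> 0"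
    and weight_nonzero: "\<And>i. i \<in> {1..4} \<Longrightarrow> AE I in half_line. weight X i I \<noteq> 0"
    and Phi_meas: "(\<lambda>(I, J, R, r). PhiRe X I J R r)
         \<in> borel_measurable (half_line \<Otimes>\<^sub>M half_line \<Otimes>\<^sub>M unit_interval \<Otimes>\<^sub>M unit_interval)"
    and b_meas: "bRe X \<in> borel_measurable unit_interval"
    and convergent: "integrals_converge X"
begin

text \<open>Orders 0 and 1 are q and q*. Order 2 enters when q* is differentiated in the
  temperature, which is why all powers are treated together.\<close>

definition qmom :: "nat \<Rightarrow> nat \<Rightarrow> real \<Rightarrow> real" where
  "qmom j i T = (LINT I|half_line. I ^ j * weight X i I * exp (- I / (kB X * T)))"

lemma qint_eq_qmom: "qint X i T = qmom 0 i T"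
  by (simp add: qint_def qmom_def)

lemma qstar_eq_qmom: "qstar X i T = qmom 1 i T"
  by (simp add: qstar_def qmom_def)

text \<open>Read off from the integrability of the weighted exponential at temperature 1, by
  multiplying the exponential away.\<close>

lemma weight_measurable:
  assumes "i \<in> {1..4}"
  shows "weight X i \<in> borel_measurable half_line"
proof -
  note [measurable] = measurable_ident_half_line
  have "(\<lambda>I. weight X i I * exp (- I / (kB X * 1))) \<in> borel_measurable half_line"
    using convergent assms unfolding integrals_converge_def
    by (intro borel_measurable_integrable) (metis zero_less_one)
  then have "(\<lambda>I. weight X i I * exp (- I / (kB X * 1)) * exp (I / (kB X * 1))) \<in> borel_measurable half_line"
    by (rule borel_measurable_times) measurable
  also have "(\<lambda>I. weight X i I * exp (- I / (kB X * 1)) * exp (I / (kB X * 1))) = weight X i"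
    by (simp add: fun_eq_iff exp_minus)
  finally show ?thesis .
qed

text \<open>One more power of I is paid for by doubling the temperature: I is at most c exp(I/c)
  with c = 2 kB T, and exp(I/c) halves the decay rate of exp(-I/(kB T)). The induction therefore
  varies T and starts from convergence at every positive temperature.\<close>

lemma integrable_qmom:
  assumes i: "i \<in> {1..4}" and T: "T > 0"
  shows "integrable half_line (\<lambda>I. I ^ j * weight X i I * exp (- I / (kB X * T)))"
  using T
proof (induction j arbitrary: T)
  case 0
  then show ?case using convergent i unfolding integrals_converge_def by auto
next
  case (Suc j)
  note [measurable] = measurable_ident_half_line weight_measurable[OF i]
  show ?case
  proof (rule Bochner_Integration.integrable_bound)
    let ?g = "\<lambda>I. (2 * kB X * T) * (I ^ j * weight X i I * exp (- I / (kB X * (2 * T))))"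
    show "integrable half_line ?g" using Suc by auto
    show "AE I in half_line. norm (I ^ Suc j * weight X i I * exp (- I / (kB X * T))) \<le> norm (?g I)"
    proof (rule AE_I2)
      fix I assume "I \<in> space half_line"
      then have I: "I \<ge> 0" by simp
      define c where "c = 2 * kB X * T"
      have c: "c > 0" using boltzmann Suc.prems by (simp add: c_def)
      have "I / c \<le> exp (I / c)" using exp_ge_add_one_self[of "I / c"] by linarith
      then have "I \<le> c * exp (I / c)" using c by (simp add: field_simps)
      then have "I * exp (- I / (kB X * T)) \<le> c * exp (I / c) * exp (- I / (kB X * T))"
        by (rule mult_right_mono) simp
      also have "\<dots> = c * exp (- I / (kB X * (2 * T)))"
        using boltzmann Suc.prems by (simp add: c_def mult.assoc exp_add[symmetric] field_simps)
      finally have "I * exp (- I / (kB X * T)) * \<bar>I ^ j * weight X i I\<bar>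
          \<le> c * exp (- I / (kB X * (2 * T))) * \<bar>I ^ j * weight X i I\<bar>"
        by (rule mult_right_mono) simp
      then show "norm (I ^ Suc j * weight X i I * exp (- I / (kB X * T))) \<le> norm (?g I)"
        using I c by (simp only: c_def[symmetric]) (simp add: abs_mult mult_ac)
    qed
  qed measurable
qed

text \<open>In the inverse temperature b = 1/(kB T) the integrand is an exponential exp(-b I), and
  differentiation brings down -I. The derivative of b is -1/(kB T^2), so the two signs cancel in the
  chain rule.\<close>

lemma qmom_has_derivative:
  assumes i: "i \<in> {1..4}" and T: "T > 0"
  shows "(qmom j i has_real_derivative qmom (Suc j) i T / (kB X * T\<^sup>2)) (at T)"
proof -
  note [measurable] = measurable_ident_half_line weight_measurable[OF i]
  define L where "L j b = (LINT I|half_line. I ^ j * weight X i I * exp (- (b * I)))" for j and b :: real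
  have int: "integrable half_line (\<lambda>I. I ^ j * weight X i I * exp (- (b * I)))" if "b > 0" for j b
    using integrable_qmom[OF i, of "1 / (kB X * b)" j] that boltzmann by (simp add: mult.commute)
  have qL: "qmom j i S = L j (1 / (kB X * S))" for S j
    unfolding qmom_def L_def by simp
  have L: "(L j has_real_derivative - L (Suc j) b) (at b)" if b: "b > 0" for b
    unfolding has_field_derivative_iff
  proof -
    let ?s = "\<lambda>c I. I ^ j * weight X i I * ((exp (- (c * I)) - exp (- (b * I))) / (c - b))"
    \<comment> \<open>For c above b/2 the mean value inequality bounds the difference quotient by I
      exp(-b I/2), uniformly in c. This majorant is integrable, being a moment at twice the
      temperature.\<close>
    have ev: "\<forall>\<^sub>F c in at b. c > b / 2 \<and> c \<noteq> b"
      using b eventually_at_in_open'[of "{b/2<..}" b]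
      by (auto simp: eventually_conj_iff eventually_neq_at_within)
    have "((\<lambda>c. integral\<^sup>L half_line (?s c)) \<longlongrightarrow> (LINT I|half_line. - (I ^ Suc j * weight X i I * exp (- (b * I))))) (at b)"
    proof (rule dominated_convergence_at_within)
      show "integrable half_line (\<lambda>I. norm (I ^ Suc j * weight X i I * exp (- (b/2 * I))))"
        using int[of "b/2" "Suc j"] b by auto
      show "AE I in half_line. ((\<lambda>c. ?s c I) \<longlongrightarrow> - (I ^ Suc j * weight X i I * exp (- (b * I)))) (at b)"
      proof (rule AE_I2)
        fix I :: real
        have "((\<lambda>c. exp (- (c * I))) has_real_derivative (- I * exp (- (b * I)))) (at b)"
          by (auto intro!: derivative_eq_intros)
        then have "((\<lambda>c. (exp (- (c * I)) - exp (- (b * I))) / (c - b)) \<longlongrightarrow> - I * exp (- (b * I))) (at b)"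
          by (simp add: has_field_derivative_iff)
        then have "((\<lambda>c. ?s c I) \<longlongrightarrow> I ^ j * weight X i I * (- I * exp (- (b * I)))) (at b)"
          by (intro tendsto_intros)
        then show "((\<lambda>c. ?s c I) \<longlongrightarrow> - (I ^ Suc j * weight X i I * exp (- (b * I)))) (at b)"
          by (simp add: mult_ac)
      qed
      show "\<forall>\<^sub>F c in at b. AE I in half_line. norm (?s c I) \<le> norm (I ^ Suc j * weight X i I * exp (- (b/2 * I)))"
        using ev
      proof eventually_elim
        case (elim c)
        show ?case
        proof (rule AE_I2)
          fix I assume "I \<in> space half_line"
          then have I: "I \<ge> 0" by simp
          have "norm (exp (- (c * I)) - exp (- (b * I))) \<le> (I * exp (- (b/2 * I))) * norm (c - b)"
          proof (rule field_differentiable_bound[where S = "{b/2<..}" and f' = "\<lambda>z. - I * exp (- (z * I))"])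
            fix z assume z: "z \<in> {b/2<..}"
            show "((\<lambda>c. exp (- (c * I))) has_field_derivative - I * exp (- (z * I))) (at z within {b / 2<..})"
              by (auto intro!: derivative_eq_intros)
            show "norm (- I * exp (- (z * I))) \<le> I * exp (- (b / 2 * I))"
            proof -
              have "b / 2 * I \<le> z * I" using z I by (intro mult_right_mono) auto
              then show ?thesis using I by (simp add: abs_mult mult_left_mono)
            qed
          qed (use elim b in auto)
          then have "\<bar>(exp (- (c * I)) - exp (- (b * I))) / (c - b)\<bar> \<le> I * exp (- (b/2 * I))"
            using elim by (simp add: field_simps abs_divide)
          then have "\<bar>I ^ j * weight X i I\<bar> * \<bar>(exp (- (c * I)) - exp (- (b * I))) / (c - b)\<bar>
              \<le> \<bar>I ^ j * weight X i I\<bar> * (I * exp (- (b/2 * I)))"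
            by (rule mult_left_mono) simp
          then show "norm (?s c I) \<le> norm (I ^ Suc j * weight X i I * exp (- (b/2 * I)))"
            using I by (simp add: abs_mult mult_ac)
        qed
      qed
    qed simp_all
    moreover have "\<forall>\<^sub>F c in at b. integral\<^sup>L half_line (?s c) = (L j c - L j b) / (c - b)"
      using ev
    proof eventually_elim
      case (elim c)
      then have c: "c > 0" using b by linarith
      have "integral\<^sup>L half_line (?s c)
          = (LINT I|half_line. (I ^ j * weight X i I * exp (- (c * I)) - I ^ j * weight X i I * exp (- (b * I))) / (c - b))"
        by (intro Bochner_Integration.integral_cong refl) (simp add: right_diff_distrib)
      also have "\<dots> = (L j c - L j b) / (c - b)"
        unfolding L_def using int[OF b, of j] int[OF c, of j] by simp
      finally show ?case .
    qed
    ultimately have "((\<lambda>c. (L j c - L j b) / (c - b)) \<longlongrightarrow>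
        (LINT I|half_line. - (I ^ Suc j * weight X i I * exp (- (b * I))))) (at b)"
      by (rule Lim_transform_eventually)
    then show "((\<lambda>y. (L j y - L j b) / (y - b)) \<longlongrightarrow> - L (Suc j) b) (at b)"
      unfolding L_def by simp
  qed
  have "((\<lambda>S. L j (1 / (kB X * S))) has_real_derivative
      - L (Suc j) (1 / (kB X * T)) * (- (kB X / (kB X * T)\<^sup>2))) (at T)"
    by (rule DERIV_chain2[of "L j"], rule L)
       (use T boltzmann in \<open>auto intro!: derivative_eq_intros simp: power2_eq_square\<close>)
  moreover have "- L (Suc j) (1 / (kB X * T)) * (- (kB X / (kB X * T)\<^sup>2)) = qmom (Suc j) i T / (kB X * T\<^sup>2)"
    using boltzmann T by (simp add: qL power2_eq_square)
  moreover have "(\<lambda>S. L j (1 / (kB X * S))) = qmom j i" by (simp add: fun_eq_iff qL)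
  ultimately show ?thesis by simp
qed

text \<open>A nonnegative integrand with zero integral vanishes almost everywhere; as the weight
  does not, the half-line would be a null set.\<close>

lemma qmom_0_pos:
  assumes i: "i \<in> {1..4}" and T: "T > 0"
  shows "qmom 0 i T > 0"
proof -
  have nn: "AE I in half_line. 0 \<le> I ^ 0 * weight X i I * exp (- I / (kB X * T))"
    using weight_nonneg[OF i] by (intro AE_I2) simp
  have "qmom 0 i T \<noteq> 0"
  proof
    assume "qmom 0 i T = 0"
    then have "AE I in half_line. I ^ 0 * weight X i I * exp (- I / (kB X * T)) = 0"
      unfolding qmom_def using integral_nonneg_eq_0_iff_AE[OF integrable_qmom[OF assms, of 0] nn] by simp
    with weight_nonzero[OF i] have "AE I in half_line. False"
      by eventually_elim simp
    then have "AE I::real in lborel. I \<in> {0..} \<longrightarrow> False" by (subst (asm) AE_restrict_space_iff) auto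
    then have "emeasure lborel {0::real..} = 0" 
    by (subst (asm) AE_iff_measurable[OF _ refl]) (auto simp: atLeast_def)
    moreover have "emeasure lborel {0::real..1} \<le> emeasure lborel {0::real..}" by (rule emeasure_mono) auto
    ultimately show False by simp
  qed
  moreover have "qmom 0 i T \<ge> 0" unfolding qmom_def using nn by (rule integral_nonneg_AE)
  ultimately show ?thesis by simp
qed

lemma qmom_tendsto:
  assumes "i \<in> {1..4}" "(g \<longlongrightarrow> T) F" "T > 0"
  shows "((\<lambda>e. qmom j i (g e)) \<longlongrightarrow> qmom j i T) F"
  using DERIV_isCont[OF qmom_has_derivative[OF assms(1,3)]] assms(2) by (rule isCont_tendsto_compose)

end

section \<open>Moments of Maxwellians\<close>

lemma sigma_finite_half_line: "sigma_finite_measure half_line"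
  by (rule sigma_finite_measure_restrict_space) (auto intro: sigma_finite_lborel)

lemma sigma_finite_unit_interval: "sigma_finite_measure unit_interval"
  by (rule sigma_finite_measure_restrict_space) (auto intro: sigma_finite_lborel)

interpretation half_line: sigma_finite_measure half_line by (rule sigma_finite_half_line)
interpretation unit_interval: sigma_finite_measure unit_interval by (rule sigma_finite_unit_interval)
interpretation phase: pair_sigma_finite "lborel :: (real^3) measure" half_line ..

lemma has_bochner_integral_transform:
  assumes "has_bochner_integral M f x" "\<And>z. z \<in> space M \<Longrightarrow> f z = g z"
  shows "has_bochner_integral M g x"
  using assms has_bochner_integral_cong[of M M f g x x] by simp

lemma (in pair_sigma_finite) has_bochner_integral_product:
  fixes g :: "'a \<Rightarrow> real" and h :: "'b \<Rightarrow> real"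
  assumes "has_bochner_integral M1 g x" "has_bochner_integral M2 h y"
  shows "has_bochner_integral (M1 \<Otimes>\<^sub>M M2) (\<lambda>(v, w). g v * h w) (x * y)"
proof -
  have g: "integrable M1 g" "integral\<^sup>L M1 g = x" and h: "integrable M2 h" "integral\<^sup>L M2 h = y"
    using assms by (auto simp: has_bochner_integral_iff)
  have [measurable]: "g \<in> borel_measurable M1" "h \<in> borel_measurable M2" using g h by auto
  have int: "integrable (M1 \<Otimes>\<^sub>M M2) (\<lambda>(v, w). g v * h w)"
  proof (rule Fubini_integrable)
    show "integrable M1 (\<lambda>x. LINT y|M2. norm (case (x, y) of (v, w) \<Rightarrow> g v * h w))"
      using g(1) by (simp add: abs_mult)
  qed (use h in auto)
  have "(LINT p|(M1 \<Otimes>\<^sub>M M2). (case p of (v, w) \<Rightarrow> g v * h w)) = (LINT v|M1. LINT w|M2. g v * h w)"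
    using integral_fst'[OF int] by simp
  also have "\<dots> = x * y" using g h by simp
  finally show ?thesis using int by (simp add: has_bochner_integral_iff)
qed

lemma has_bochner_integral_lborel_shift:
  fixes g :: "real^3 \<Rightarrow> real"
  assumes "has_bochner_integral lborel g x"
  shows "has_bochner_integral lborel (\<lambda>v. g (v - u)) x"
proof -
  have g: "integrable (distr lborel borel ((+) (- u))) g" "integral\<^sup>L (distr lborel borel ((+) (- u))) g = x"
    using assms by (simp_all add: lborel_distr_plus has_bochner_integral_iff)
  have [measurable]: "g \<in> borel_measurable borel" using assms by auto
  have "integrable lborel (\<lambda>v. g (- u + v))" using g(1) by (rule integrable_distr[rotated]) simp
  moreover have "(LINT v|lborel. g (- u + v)) = x" using g(2) by (subst (asm) integral_distr) auto
  ultimately show ?thesis by (simp add: has_bochner_integral_iff)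
qed

text \<open>Even tensors come from the second moment of a radial weight, odd ones vanish under x to
  -x. Contraction with fixed vectors replaces tensor notation. Together with the radial moments
  these cover all velocity monomials that arise when energy and energy flux are paired with a
  differentiated Maxwellian.\<close>

lemma has_bochner_integral_gaussian_tensors:
  fixes a :: real and p q r :: "real^3"
  assumes a: "a > 0"
  defines "e \<equiv> \<lambda>x::real^3. exp (- (a * (norm x)\<^sup>2))"
  shows "has_bochner_integral lborel (\<lambda>x. (x \<bullet> p) * (x \<bullet> q) * e x) (p \<bullet> q / (2 * a) * (pi / a) powr (3/2))"
    and "has_bochner_integral lborel (\<lambda>x. (x \<bullet> p) * (x \<bullet> q) * (norm x)\<^sup>2 * e x)
           (5 * (p \<bullet> q) / (4 * a\<^sup>2) * (pi / a) powr (3/2))"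
    and "has_bochner_integral lborel (\<lambda>x. (x \<bullet> p) * norm x ^ (2 * k) * e x) 0"
    and "has_bochner_integral lborel (\<lambda>x. (x \<bullet> p) * (x \<bullet> q) * (x \<bullet> r) * e x) 0"
proof -
  show "has_bochner_integral lborel (\<lambda>x. (x \<bullet> p) * (x \<bullet> q) * e x) (p \<bullet> q / (2 * a) * (pi / a) powr (3/2))"
    using has_bochner_integral_second_moment[of e "3 / (2 * a) * (pi / a) powr (3/2)" p q]
      has_bochner_integral_gaussian(2)[OF a] by (simp add: e_def)
  \<comment> \<open>The quartic tensor is a second moment for the radial weight |x|^2 e(x). The
    trace is then the fourth moment, and a third of 15/(4 a^2) is 5/(4 a^2).\<close>
  have "has_bochner_integral lborel (\<lambda>x. (x \<bullet> p) * (x \<bullet> q) * ((norm x)\<^sup>2 * e x))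
      (p \<bullet> q / 3 * (15 / (4 * a\<^sup>2) * (pi / a) powr (3/2)))"
  proof (rule has_bochner_integral_second_moment)
    have "(norm x)\<^sup>2 * ((norm x)\<^sup>2 * e x) = norm x ^ 4 * e x" for x
      by (simp add: mult.assoc[symmetric] power_add[symmetric])
    then show "has_bochner_integral lborel (\<lambda>x. (norm x)\<^sup>2 * ((norm x)\<^sup>2 * e x)) (15 / (4 * a\<^sup>2) * (pi / a) powr (3/2))"
      using has_bochner_integral_gaussian(3)[OF a] by (simp add: e_def)
  qed (auto simp: e_def)
  then show "has_bochner_integral lborel (\<lambda>x. (x \<bullet> p) * (x \<bullet> q) * (norm x)\<^sup>2 * e x)
      (5 * (p \<bullet> q) / (4 * a\<^sup>2) * (pi / a) powr (3/2))"
    by (simp add: mult.assoc)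
  show "has_bochner_integral lborel (\<lambda>x. (x \<bullet> p) * norm x ^ (2 * k) * e x) 0"
  proof (rule has_bochner_integral_odd)
    show "integrable lborel (\<lambda>x. (x \<bullet> p) * norm x ^ (2 * k) * e x)"
    proof (rule Bochner_Integration.integrable_bound)
      show "integrable lborel (\<lambda>x. norm p * (norm x ^ (2 * k + 1) * e x))"
        using integrable_power_gaussian[OF a, of "2 * k + 1"] by (simp add: e_def)
      have "\<bar>x \<bullet> p\<bar> * (norm x ^ (2 * k) * e x) \<le> (norm x * norm p) * (norm x ^ (2 * k) * e x)" for x
        by (intro mult_right_mono Cauchy_Schwarz_ineq2) (simp add: e_def)
      then show "AE x in lborel. norm ((x \<bullet> p) * norm x ^ (2 * k) * e x) \<le> norm (norm p * (norm x ^ (2 * k + 1) * e x))"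
        by (simp add: abs_mult e_def mult_ac)
    qed (simp add: e_def)
  qed (simp add: e_def)
  show "has_bochner_integral lborel (\<lambda>x. (x \<bullet> p) * (x \<bullet> q) * (x \<bullet> r) * e x) 0"
  proof (rule has_bochner_integral_odd)
    show "integrable lborel (\<lambda>x. (x \<bullet> p) * (x \<bullet> q) * (x \<bullet> r) * e x)"
    proof (rule Bochner_Integration.integrable_bound)
      show "integrable lborel (\<lambda>x. norm p * norm q * norm r * (norm x ^ 3 * e x))"
        using integrable_power_gaussian[OF a, of 3] by (simp add: e_def)
      have "\<bar>x \<bullet> p\<bar> * \<bar>x \<bullet> q\<bar> * \<bar>x \<bullet> r\<bar> * e x
          \<le> (norm x * norm p) * (norm x * norm q) * (norm x * norm r) * e x" for x
        by (intro mult_mono mult_nonneg_nonneg Cauchy_Schwarz_ineq2) (simp_all add: e_def)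
      then show "AE x in lborel. norm ((x \<bullet> p) * (x \<bullet> q) * (x \<bullet> r) * e x) \<le> norm (norm p * norm q * norm r * (norm x ^ 3 * e x))"
        by (simp add: abs_mult e_def power3_eq_cube mult_ac)
    qed (simp add: e_def)
  qed (simp add: e_def)
qed

context reacting_mixture
begin

text \<open>The differential of the Maxwellian, with the Maxwellian of density 1 factored out so
  that nothing is divided by \<open>n\<close>. The increments \<open>dn\<close>, \<open>du\<close>,
  \<open>dT\<close> are arguments and enter linearly; time and space derivatives thus share one
  formula.\<close>

definition dmaxwellian ::
    "nat \<Rightarrow> real \<Rightarrow> real^3 \<Rightarrow> real \<Rightarrow> real^3 \<Rightarrow> real \<Rightarrow> real \<Rightarrow> real^3 \<Rightarrow> real \<Rightarrow> real" where
  "dmaxwellian i n u T v I dn du dT = maxwellian X i 1 u T v I *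
     (dn - n * dT * (qmom 1 i T / qmom 0 i T / (kB X * T\<^sup>2) + 3 / (2 * T))
      + n * dT / (kB X * T\<^sup>2) * (mass X i / 2 * (norm (v - u))\<^sup>2 + I)
      + n * mass X i / (kB X * T) * ((v - u) \<bullet> du))"

text \<open>The prefactor \<open>s\<close> depends on the temperature through 1/q and T^(-3/2).
  Their logarithmic derivatives are the two subtracted terms of \<open>dmaxwellian\<close>, by q' =
  q*/(kB T^2); the other terms come from the exponent \<open>E\<close>.\<close>

lemma maxwellian_has_derivative:
  assumes i: "i \<in> {1..4}" and T: "T z > 0"
    and n': "(n has_derivative n') (at z)" and u': "(u has_derivative u') (at z)"
    and T': "(T has_derivative T') (at z)"
  shows "((\<lambda>z. maxwellian X i (n z) (u z) (T z) v I) has_derivative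
    (\<lambda>h. dmaxwellian i (n z) (u z) (T z) v I (n' h) (u' h) (T' h))) (at z)"
proof -
  define s where "s T = 1 / qmom 0 i T * (mass X i / (2 * pi * kB X * T)) powr (3/2)" for T
  define E where "E z = - (mass X i * ((v - u z) \<bullet> (v - u z)) + 2 * I) / (2 * kB X * T z)" for z
  have q0: "qmom 0 i (T z) \<noteq> 0" using qmom_0_pos[OF i T] by simp
  have mk: "mass X i > 0" "kB X > 0" using masses[OF i] boltzmann by auto
  have P: "((\<lambda>T. (mass X i / (2 * pi * kB X * T)) powr (3/2)) has_real_derivative
      (mass X i / (2 * pi * kB X * T z)) powr (3/2) * (- (3 / (2 * T z)))) (at (T z))"
  proof -
    define c where "c = mass X i / (2 * pi * kB X)"
    have c: "c / T z > 0" using T mk by (simp add: c_def)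
    have "((\<lambda>T. c / T) has_real_derivative - (c / (T z)\<^sup>2)) (at (T z))"
      using T by (auto intro!: derivative_eq_intros simp: power2_eq_square)
    then have "((\<lambda>T. (c / T) powr (3/2)) has_real_derivative 3/2 * (c / T z) powr (3/2 - 1) * (- (c / (T z)\<^sup>2))) (at (T z))"
      by (rule DERIV_chain2[where g = "\<lambda>T. c / T" and x = "T z", OF has_real_derivative_powr[OF c]])
    moreover have "3/2 * (c / T z) powr (3/2 - 1) * (- (c / (T z)\<^sup>2)) = (c / T z) powr (3/2) * (- (3 / (2 * T z)))"
    proof -
      have "(c / T z) powr (3/2) = (c / T z) * (c / T z) powr (1/2)"
        using powr_mult_base[of "c / T z" "1/2"] c by simp
      then show ?thesis by (simp add: power2_eq_square mult_ac)
    qed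
    ultimately show ?thesis by (simp add: c_def)
  qed
  have s: "(s has_real_derivative s (T z) * (- (qmom 1 i (T z) / qmom 0 i (T z) / (kB X * (T z)\<^sup>2) + 3 / (2 * T z)))) (at (T z))"
  proof -
    have "((\<lambda>T. 1 / qmom 0 i T) has_real_derivative - (qmom 1 i (T z) / (kB X * (T z)\<^sup>2)) / (qmom 0 i (T z))\<^sup>2) (at (T z))"
      using q0 by (auto intro!: derivative_eq_intros qmom_has_derivative i T simp: power2_eq_square)
    from DERIV_mult[OF this P] show ?thesis
      unfolding s_def by (rule DERIV_cong) (use q0 in \<open>simp add: field_simps power2_eq_square\<close>)
  qed
  have sT: "((\<lambda>z. s (T z)) has_derivative
      (\<lambda>h. T' h * (s (T z) * (- (qmom 1 i (T z) / qmom 0 i (T z) / (kB X * (T z)\<^sup>2) + 3 / (2 * T z)))))) (at z)"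
    by (rule DERIV_compose_FDERIV[OF s T'])
  have E: "(E has_derivative (\<lambda>h. T' h / (kB X * (T z)\<^sup>2) * (mass X i / 2 * ((v - u z) \<bullet> (v - u z)) + I)
      + mass X i / (kB X * T z) * ((v - u z) \<bullet> u' h))) (at z)"
    unfolding E_def using T mk
    by (auto intro!: derivative_eq_intros u' T' simp: inner_commute field_simps power2_eq_square)
  have eq: "maxwellian X i (n z) (u z) (T z) v I = n z * s (T z) * exp (E z)" for z
    by (simp add: maxwellian_def s_def E_def qint_eq_qmom power2_norm_eq_inner)
  have eq1: "maxwellian X i 1 (u z) (T z) v I = s (T z) * exp (E z)" for z
    by (simp add: maxwellian_def s_def E_def qint_eq_qmom power2_norm_eq_inner)
  show ?thesis
    unfolding eq dmaxwellian_def eq1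
    by (rule has_derivative_eq_rhs[OF has_derivative_mult[OF has_derivative_mult[OF n' sT] has_derivative_exp[OF E]]])
       (use T mk q0 in \<open>auto simp: fun_eq_iff field_simps power2_norm_eq_inner\<close>)
qed

text \<open>Times the weight, the Maxwellian of density 1 is a product of two probability densities:
  a Gaussian in v - u, and the normalised weighted exponential in I. The hypothesis writes the
  Gaussian integral as \<open>x\<close> times the total mass, so \<open>x\<close> is the mean of
  \<open>g\<close>.\<close>

lemma maxwellian_monomial:
  assumes i: "i \<in> {1..4}" and T: "T > 0"
    and g: "has_bochner_integral lborel
      (\<lambda>c. g c * exp (- (mass X i / (2 * kB X * T) * (norm c)\<^sup>2))) (x * (pi / (mass X i / (2 * kB X * T))) powr (3/2))"
  shows "has_bochner_integral phase_measure
    (\<lambda>(v, I). g (v - u) * I ^ j * (maxwellian X i 1 u T v I * weight X i I)) (x * (qmom j i T / qmom 0 i T))"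
proof -
  define a where "a = mass X i / (2 * kB X * T)"
  have a: "a > 0" unfolding a_def using masses[OF i] boltzmann T by simp
  have api: "mass X i / (2 * pi * kB X * T) = a / pi" by (simp add: a_def)
  have one: "(a / pi) powr (3/2) * (pi / a) powr (3/2) = 1"
    using a by (simp add: powr_mult[symmetric])
  have A: "has_bochner_integral lborel (\<lambda>v. (a / pi) powr (3/2) * (g (v - u) * exp (- (a * (norm (v - u))\<^sup>2))))
      ((a / pi) powr (3/2) * (x * (pi / a) powr (3/2)))"
    by (intro has_bochner_integral_mult_right has_bochner_integral_lborel_shift[OF g[folded a_def]])
  have B: "has_bochner_integral half_line (\<lambda>I. I ^ j * weight X i I * exp (- I / (kB X * T)) / qmom 0 i T)
      (qmom j i T / qmom 0 i T)"
    using integrable_qmom[OF i T, of j] by (simp add: has_bochner_integral_iff qmom_def)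
  have C: "has_bochner_integral phase_measure (\<lambda>(v, I). ((a / pi) powr (3/2) * (g (v - u) * exp (- (a * (norm (v - u))\<^sup>2))))
      * (I ^ j * weight X i I * exp (- I / (kB X * T)) / qmom 0 i T))
      ((a / pi) powr (3/2) * (x * (pi / a) powr (3/2)) * (qmom j i T / qmom 0 i T))"
    unfolding phase_measure_def by (rule phase.has_bochner_integral_product[OF A B])
  have e: "exp (- (mass X i * (norm (v - u))\<^sup>2 + 2 * I) / (2 * kB X * T))
      = exp (- (a * (norm (v - u))\<^sup>2)) * exp (- I / (kB X * T))" for v I
    using boltzmann T by (simp add: a_def exp_add[symmetric] add_divide_distrib diff_divide_distrib)
  have eq: "((a / pi) powr (3/2) * (g (v - u) * exp (- (a * (norm (v - u))\<^sup>2))))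
      * (I ^ j * weight X i I * exp (- I / (kB X * T)) / qmom 0 i T)
     = g (v - u) * I ^ j * (maxwellian X i 1 u T v I * weight X i I)" for v I
    unfolding maxwellian_def api e qint_eq_qmom by simp
  have val: "(a / pi) powr (3/2) * (x * (pi / a) powr (3/2)) = x"
    using one by (metis mult.assoc mult.commute mult_1)
  show ?thesis using C unfolding eq val .
qed

text \<open>In c = v - u all factors are polynomials in c and I, so each integral is a finite sum of
  Gaussian moments times values of \<open>Q\<close>. Q 2 - (Q 1)^2 is the variance of I; over kB T^2
  it is the internal part of the heat capacity. The 5/2 in the flux against 3/2 in the density is
  the pressure term: m (c . p)(c . u) has mean kB T (u . p).\<close>

lemma dmaxwellian_energy_moments:
  fixes u :: "real^3"
  assumes i: "i \<in> {1..4}" and T: "T > 0"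
  defines "Q \<equiv> \<lambda>j. qmom j i T / qmom 0 i T"
  shows "has_bochner_integral phase_measure
    (\<lambda>(v, I). kin_energy X i v I * dmaxwellian i n u T v I dn du dT * weight X i I)
    (dn * (3/2 * kB X * T + Q 1 + mass X i * (norm u)\<^sup>2 / 2)
      + n * dT * (3/2 * kB X + (Q 2 - (Q 1)\<^sup>2) / (kB X * T\<^sup>2)) + n * mass X i * (u \<bullet> du))"
    (is "?E")
  and "has_bochner_integral phase_measure
    (\<lambda>(v, I). (v \<bullet> p) * (kin_energy X i v I * dmaxwellian i n u T v I dn du dT * weight X i I))
    (dn * (u \<bullet> p) * (5/2 * kB X * T + Q 1 + mass X i * (norm u)\<^sup>2 / 2)
      + n * dT * (u \<bullet> p) * (5/2 * kB X + (Q 2 - (Q 1)\<^sup>2) / (kB X * T\<^sup>2))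
      + n * (du \<bullet> p) * (5/2 * kB X * T + Q 1 + mass X i * (norm u)\<^sup>2 / 2)
      + n * mass X i * (u \<bullet> p) * (u \<bullet> du))"
    (is "?F")
proof -
  define m where "m = mass X i"
  define k where "k = kB X"
  define a where "a = m / (2 * k * T)"
  have mk: "m > 0" "k > 0" using masses[OF i] boltzmann by (auto simp: m_def k_def)
  have a: "a > 0" unfolding a_def using mk T by simp
  have Q0: "Q 0 = 1" using qmom_0_pos[OF i T] by (simp add: Q_def)
  have Qj: "qmom j i T / qmom 0 i T = Q j" for j by (simp add: Q_def)
  define A where "A = dn - n * dT * (Q 1 / (k * T\<^sup>2) + 3 / (2 * T))"
  define B where "B = n * dT / (k * T\<^sup>2)"
  define C where "C = n * m / (k * T)"
  define w where "w = m / 2"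
  define U where "U = m * (norm u)\<^sup>2 / 2"
  \<comment> \<open>The variance of one component of the centred velocity. In this unit the Gaussian
    moments no longer contain \<open>a\<close>.\<close>
  define \<theta> where "\<theta> = k * T / m"
  have th: "3 / (2 * a) = 3 * \<theta>" "15 / (4 * a\<^sup>2) = 15 * \<theta>\<^sup>2"
    "y / (2 * a) = \<theta> * y" "5 * y / (4 * a\<^sup>2) = 5 * \<theta>\<^sup>2 * y" for y
    using mk T by (simp_all add: a_def \<theta>_def field_simps power2_eq_square)
  let ?W = "\<lambda>v I. maxwellian X i 1 u T v I * weight X i I"
  note M = maxwellian_monomial[OF i T, folded m_def k_def, folded a_def, unfolded Qj]
  note G = has_bochner_integral_gaussian[OF a, unfolded th(1,2)]
  note GT = has_bochner_integral_gaussian_tensors[OF a, unfolded th(3,4)]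
  have m0: "has_bochner_integral phase_measure (\<lambda>(v, I). 1 * I ^ j * ?W v I) (1 * Q j)" for j
    by (rule M[of "\<lambda>c. 1"]) (use G(1) in simp)
  have m2: "has_bochner_integral phase_measure (\<lambda>(v, I). (norm (v - u))\<^sup>2 * I ^ j * ?W v I) (3 * \<theta> * Q j)" for j
    by (rule M[OF G(2)])
  have m4: "has_bochner_integral phase_measure (\<lambda>(v, I). norm (v - u) ^ 4 * I ^ j * ?W v I) (15 * \<theta>\<^sup>2 * Q j)" for j
    by (rule M[OF G(3)])
  have t0: "has_bochner_integral phase_measure (\<lambda>(v, I). ((v - u) \<bullet> p) * ((v - u) \<bullet> q) * I ^ j * ?W v I) (\<theta> * (p \<bullet> q) * Q j)" for p q j
    by (rule M[OF GT(1)])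
  have t2: "has_bochner_integral phase_measure (\<lambda>(v, I). ((v - u) \<bullet> p) * ((v - u) \<bullet> q) * (norm (v - u))\<^sup>2 * I ^ j * ?W v I) (5 * \<theta>\<^sup>2 * (p \<bullet> q) * Q j)" for p q j
    by (rule M[OF GT(2)])
  have o1: "has_bochner_integral phase_measure (\<lambda>(v, I). ((v - u) \<bullet> p) * norm (v - u) ^ (2 * l) * I ^ j * ?W v I) 0" for p l j
    using M[of "\<lambda>c. (c \<bullet> p) * norm c ^ (2 * l)" 0 u j] GT(3)[of p l] by simp
  have o3: "has_bochner_integral phase_measure (\<lambda>(v, I). ((v - u) \<bullet> p) * ((v - u) \<bullet> q) * ((v - u) \<bullet> r) * I ^ j * ?W v I) 0" for p q r j
    using M[of "\<lambda>c. (c \<bullet> p) * (c \<bullet> q) * (c \<bullet> r)" 0 u j] GT(4)[of p q r] by simp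
  have dm: "dmaxwellian i n u T v I dn du dT = maxwellian X i 1 u T v I *
      (A + B * (w * (norm (v - u))\<^sup>2 + I) + C * ((v - u) \<bullet> du))" for v I
    by (simp add: dmaxwellian_def A_def B_def C_def w_def m_def k_def Q_def)
  have kin: "kin_energy X i v I = w * (norm (v - u))\<^sup>2 + m * ((v - u) \<bullet> u) + U + I" for v I
    by (simp add: kin_energy_def w_def U_def m_def power2_norm_eq_inner inner_diff_left inner_diff_right
        inner_commute algebra_simps add_divide_distrib diff_divide_distrib)
  let ?L = "\<lambda>f x. has_bochner_integral phase_measure f x"
  note lin = has_bochner_integral_add has_bochner_integral_mult_right
  have E0: "?L (\<lambda>(v, I). kin_energy X i v I * dmaxwellian i n u T v I dn du dT * weight X i I)
     (U * A * (1 * Q 0) + (A + U * B) * w * (3 * \<theta> * Q 0) + (A + U * B) * (1 * Q 1) + B * w\<^sup>2 * (15 * \<theta>\<^sup>2 * Q 0)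
       + 2 * B * w * (3 * \<theta> * Q 1) + B * (1 * Q 2) + m * C * (\<theta> * (u \<bullet> du) * Q 0)
       + m * A * 0 + m * B * w * 0 + m * B * 0 + C * w * 0 + C * 0 + C * U * 0)"
    (is "has_bochner_integral _ ?f ?x")
  proof -
    \<comment> \<open>The summands are the monomials of the expanded product: seven even in c, then
      six odd ones, which account for the zeros in \<open>?x\<close>. Writing them out leaves only a
      pointwise polynomial identity to check.\<close>
    have "?L (\<lambda>z.
        U * A * (case z of (v, I) \<Rightarrow> 1 * I ^ 0 * ?W v I)
        + (A + U * B) * w * (case z of (v, I) \<Rightarrow> (norm (v - u))\<^sup>2 * I ^ 0 * ?W v I)
        + (A + U * B) * (case z of (v, I) \<Rightarrow> 1 * I ^ 1 * ?W v I)
        + B * w\<^sup>2 * (case z of (v, I) \<Rightarrow> norm (v - u) ^ 4 * I ^ 0 * ?W v I)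
        + 2 * B * w * (case z of (v, I) \<Rightarrow> (norm (v - u))\<^sup>2 * I ^ 1 * ?W v I)
        + B * (case z of (v, I) \<Rightarrow> 1 * I ^ 2 * ?W v I)
        + m * C * (case z of (v, I) \<Rightarrow> ((v - u) \<bullet> u) * ((v - u) \<bullet> du) * I ^ 0 * ?W v I)
        + m * A * (case z of (v, I) \<Rightarrow> ((v - u) \<bullet> u) * norm (v - u) ^ (2 * 0) * I ^ 0 * ?W v I)
        + m * B * w * (case z of (v, I) \<Rightarrow> ((v - u) \<bullet> u) * norm (v - u) ^ (2 * 1) * I ^ 0 * ?W v I)
        + m * B * (case z of (v, I) \<Rightarrow> ((v - u) \<bullet> u) * norm (v - u) ^ (2 * 0) * I ^ 1 * ?W v I)
        + C * w * (case z of (v, I) \<Rightarrow> ((v - u) \<bullet> du) * norm (v - u) ^ (2 * 1) * I ^ 0 * ?W v I)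
        + C * (case z of (v, I) \<Rightarrow> ((v - u) \<bullet> du) * norm (v - u) ^ (2 * 0) * I ^ 1 * ?W v I)
        + C * U * (case z of (v, I) \<Rightarrow> ((v - u) \<bullet> du) * norm (v - u) ^ (2 * 0) * I ^ 0 * ?W v I)) ?x"
      by (intro lin m0 m2 m4 t0 t2 o1 o3)
    then show ?thesis
      by (rule has_bochner_integral_transform)
         (auto simp: dm kin split_beta power2_eq_square power4_eq_xxxx algebra_simps)
  qed
  have E1: "?x = dn * (3/2 * k * T + Q 1 + m * (norm u)\<^sup>2 / 2)
      + n * dT * (3/2 * k + (Q 2 - (Q 1)\<^sup>2) / (k * T\<^sup>2)) + n * m * (u \<bullet> du)"
    using mk T unfolding Q0 A_def B_def C_def w_def U_def \<theta>_def
    by (simp add: field_simps power2_eq_square)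
  show E: ?E using E0 unfolding E1 by (simp only: m_def k_def)
  have F0: "?L (\<lambda>(v, I). ((v - u) \<bullet> p) * (kin_energy X i v I * dmaxwellian i n u T v I dn du dT * weight X i I))
     (m * A * (\<theta> * (p \<bullet> u) * Q 0) + m * B * w * (5 * \<theta>\<^sup>2 * (p \<bullet> u) * Q 0) + m * B * (\<theta> * (p \<bullet> u) * Q 1)
       + C * w * (5 * \<theta>\<^sup>2 * (p \<bullet> du) * Q 0) + C * (\<theta> * (p \<bullet> du) * Q 1) + C * U * (\<theta> * (p \<bullet> du) * Q 0)
       + U * A * 0 + (A + U * B) * w * 0 + (A + U * B) * 0 + B * w\<^sup>2 * 0 + 2 * B * w * 0 + B * 0 + m * C * 0)"
    (is "has_bochner_integral _ ?g ?y")
  proof -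
    \<comment> \<open>The additional factor c . p reverses parity: the six monomials that integrated
      to zero before now contribute, and the seven others vanish.\<close>
    have "?L (\<lambda>z.
        m * A * (case z of (v, I) \<Rightarrow> ((v - u) \<bullet> p) * ((v - u) \<bullet> u) * I ^ 0 * ?W v I)
        + m * B * w * (case z of (v, I) \<Rightarrow> ((v - u) \<bullet> p) * ((v - u) \<bullet> u) * (norm (v - u))\<^sup>2 * I ^ 0 * ?W v I)
        + m * B * (case z of (v, I) \<Rightarrow> ((v - u) \<bullet> p) * ((v - u) \<bullet> u) * I ^ 1 * ?W v I)
        + C * w * (case z of (v, I) \<Rightarrow> ((v - u) \<bullet> p) * ((v - u) \<bullet> du) * (norm (v - u))\<^sup>2 * I ^ 0 * ?W v I)
        + C * (case z of (v, I) \<Rightarrow> ((v - u) \<bullet> p) * ((v - u) \<bullet> du) * I ^ 1 * ?W v I)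
        + C * U * (case z of (v, I) \<Rightarrow> ((v - u) \<bullet> p) * ((v - u) \<bullet> du) * I ^ 0 * ?W v I)
        + U * A * (case z of (v, I) \<Rightarrow> ((v - u) \<bullet> p) * norm (v - u) ^ (2 * 0) * I ^ 0 * ?W v I)
        + (A + U * B) * w * (case z of (v, I) \<Rightarrow> ((v - u) \<bullet> p) * norm (v - u) ^ (2 * 1) * I ^ 0 * ?W v I)
        + (A + U * B) * (case z of (v, I) \<Rightarrow> ((v - u) \<bullet> p) * norm (v - u) ^ (2 * 0) * I ^ 1 * ?W v I)
        + B * w\<^sup>2 * (case z of (v, I) \<Rightarrow> ((v - u) \<bullet> p) * norm (v - u) ^ (2 * 2) * I ^ 0 * ?W v I)
        + 2 * B * w * (case z of (v, I) \<Rightarrow> ((v - u) \<bullet> p) * norm (v - u) ^ (2 * 1) * I ^ 1 * ?W v I)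
        + B * (case z of (v, I) \<Rightarrow> ((v - u) \<bullet> p) * norm (v - u) ^ (2 * 0) * I ^ 2 * ?W v I)
        + m * C * (case z of (v, I) \<Rightarrow> ((v - u) \<bullet> p) * ((v - u) \<bullet> u) * ((v - u) \<bullet> du) * I ^ 0 * ?W v I)) ?y"
      by (intro lin m0 m2 m4 t0 t2 o1 o3)
    then show ?thesis
      by (rule has_bochner_integral_transform)
         (auto simp: dm kin split_beta power2_eq_square power4_eq_xxxx algebra_simps)
  qed
  \<comment> \<open>Splitting v . p into u . p and (v - u) . p separates the convected energy from
    the centred flux just computed.\<close>
  have "?L (\<lambda>z. (u \<bullet> p) * (case z of (v, I) \<Rightarrow> kin_energy X i v I * dmaxwellian i n u T v I dn du dT * weight X i I) + ?g z)
      ((u \<bullet> p) * ?x + ?y)"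
    by (intro lin E0 F0)
  then have F1: "?L (\<lambda>(v, I). (v \<bullet> p) * (kin_energy X i v I * dmaxwellian i n u T v I dn du dT * weight X i I))
      ((u \<bullet> p) * ?x + ?y)"
    by (rule has_bochner_integral_transform)
       (auto simp: inner_diff_left algebra_simps)
  have F2: "(u \<bullet> p) * ?x + ?y = dn * (u \<bullet> p) * (5/2 * k * T + Q 1 + m * (norm u)\<^sup>2 / 2)
      + n * dT * (u \<bullet> p) * (5/2 * k + (Q 2 - (Q 1)\<^sup>2) / (k * T\<^sup>2))
      + n * (du \<bullet> p) * (5/2 * k * T + Q 1 + m * (norm u)\<^sup>2 / 2)
      + n * m * (u \<bullet> p) * (u \<bullet> du)"
    using mk T unfolding E1 unfolding Q0 A_def B_def C_def w_def U_def \<theta>_def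
    by (simp add: field_simps power2_eq_square inner_commute)
  show ?F using F1 unfolding F2 by (simp only: m_def k_def)
qed

end

section \<open>Rotation invariance of the rate integral\<close>

text \<open>The equilibrium integrand factorises into velocities against the remaining variables,
  whereas \<open>phase_measure\<close> and \<open>collision_measure\<close> group the variables by
  particle. This mediates between the groupings; it is Tonelli for the indicator of a measurable
  set, with the integrals over \<open>B\<close> and \<open>C\<close> exchanged.\<close>

lemma distr_pair_measure_swap_middle:
  assumes "sigma_finite_measure A" "sigma_finite_measure B" "sigma_finite_measure C" "sigma_finite_measure D"
  shows "distr ((A \<Otimes>\<^sub>M C) \<Otimes>\<^sub>M (B \<Otimes>\<^sub>M D)) ((A \<Otimes>\<^sub>M B) \<Otimes>\<^sub>M (C \<Otimes>\<^sub>M D))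
      (\<lambda>x. ((fst (fst x), fst (snd x)), (snd (fst x), snd (snd x)))) = (A \<Otimes>\<^sub>M B) \<Otimes>\<^sub>M (C \<Otimes>\<^sub>M D)"
    (is "distr ?M ?N ?s = ?N")
proof (rule measure_eqI)
  interpret A: sigma_finite_measure A by fact
  interpret B: sigma_finite_measure B by fact
  interpret C: sigma_finite_measure C by fact
  interpret D: sigma_finite_measure D by fact
  interpret AB: pair_sigma_finite A B ..
  interpret CD: pair_sigma_finite C D ..
  interpret AC: pair_sigma_finite A C ..
  interpret BD: pair_sigma_finite B D ..
  interpret BC: pair_sigma_finite B C ..
  interpret N: pair_sigma_finite "A \<Otimes>\<^sub>M B" "C \<Otimes>\<^sub>M D" ..
  interpret M: pair_sigma_finite "A \<Otimes>\<^sub>M C" "B \<Otimes>\<^sub>M D" ..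
  have s[measurable]: "?s \<in> measurable ?M ?N" by measurable
  fix S assume "S \<in> sets (distr ?M ?N ?s)"
  then have S[measurable]: "S \<in> sets ?N" by simp
  define F where "F = (indicator S :: _ \<Rightarrow> ennreal)"
  have [measurable]: "F \<in> borel_measurable ?N" unfolding F_def by simp
  have "emeasure (distr ?M ?N ?s) S = (\<integral>\<^sup>+x. F x \<partial>distr ?M ?N ?s)"
    unfolding F_def by simp
  also have "\<dots> = (\<integral>\<^sup>+x. F (?s x) \<partial>?M)" by (rule nn_integral_distr) simp_all
  also have "\<dots> = (\<integral>\<^sup>+p. \<integral>\<^sup>+q. F (?s (p, q)) \<partial>(B \<Otimes>\<^sub>M D) \<partial>(A \<Otimes>\<^sub>M C))"
    by (rule BD.nn_integral_fst[symmetric]) measurable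
  also have "\<dots> = (\<integral>\<^sup>+p. \<integral>\<^sup>+b. \<integral>\<^sup>+d. F (?s (p, (b, d))) \<partial>D \<partial>B \<partial>(A \<Otimes>\<^sub>M C))"
    by (intro nn_integral_cong D.nn_integral_fst[symmetric]) measurable
  also have "\<dots> = (\<integral>\<^sup>+a. \<integral>\<^sup>+c. \<integral>\<^sup>+b. \<integral>\<^sup>+d. F ((a, b), (c, d)) \<partial>D \<partial>B \<partial>C \<partial>A)"
    by (subst C.nn_integral_fst[symmetric]) (simp_all add: split_beta)
  also have "\<dots> = (\<integral>\<^sup>+a. \<integral>\<^sup>+b. \<integral>\<^sup>+c. \<integral>\<^sup>+d. F ((a, b), (c, d)) \<partial>D \<partial>C \<partial>B \<partial>A)"
    by (intro nn_integral_cong BC.Fubini') measurable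
  also have "\<dots> = (\<integral>\<^sup>+a. \<integral>\<^sup>+b. \<integral>\<^sup>+q. F ((a, b), q) \<partial>(C \<Otimes>\<^sub>M D) \<partial>B \<partial>A)"
    by (intro nn_integral_cong D.nn_integral_fst) measurable
  also have "\<dots> = (\<integral>\<^sup>+p. \<integral>\<^sup>+q. F (p, q) \<partial>(C \<Otimes>\<^sub>M D) \<partial>(A \<Otimes>\<^sub>M B))"
    by (rule B.nn_integral_fst[where f = "\<lambda>p. \<integral>\<^sup>+q. F (p, q) \<partial>(C \<Otimes>\<^sub>M D)"]) measurable
  also have "\<dots> = (\<integral>\<^sup>+x. F x \<partial>?N)" by (rule CD.nn_integral_fst) simp
  also have "\<dots> = emeasure ?N S" unfolding F_def by simp
  finally show "emeasure (distr ?M ?N ?s) S = emeasure ?N S" .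
qed simp

lemma distr_pair_measure_snd:
  assumes "sigma_finite_measure N" and g: "g \<in> measurable N N" "distr N N g = N"
  shows "distr (M \<Otimes>\<^sub>M N) (M \<Otimes>\<^sub>M N) (\<lambda>(x, y). (x, g y)) = M \<Otimes>\<^sub>M N"
  using pair_measure_distr[of "\<lambda>x. x" M M g N N] assms by simp

lemma AE_pair_measure_snd:
  assumes "sigma_finite_measure M" "sigma_finite_measure N" "{y \<in> space N. P y} \<in> sets N" "AE y in N. P y"
  shows "AE x in M \<Otimes>\<^sub>M N. P (snd x)"
proof -
  interpret N: pair_sigma_finite M N by (intro pair_sigma_finite.intro assms)
  have "{x \<in> space (M \<Otimes>\<^sub>M N). P (snd x)} = space M \<times> {y \<in> space N. P y}"
    by (auto simp: space_pair_measure)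
  also have "\<dots> \<in> sets (M \<Otimes>\<^sub>M N)" using assms by auto
  finally show ?thesis using assms(4) by (intro N.AE_pair_measure) auto
qed

section \<open>Sigma-finiteness of the integration spaces\<close>

lemma finite_measure_sphere: "finite_measure sphere_measure"
  by (rule finite_measureI) (simp add: emeasure_sphere_measure_UNIV)

interpretation sphere: finite_measure sphere_measure by (rule finite_measure_sphere)
interpretation unit_sphere: pair_sigma_finite unit_interval sphere_measure ..
interpretation unit_unit_sphere: pair_sigma_finite unit_interval "unit_interval \<Otimes>\<^sub>M sphere_measure" ..
interpretation half_unit_unit_sphere:
  pair_sigma_finite half_line "unit_interval \<Otimes>\<^sub>M unit_interval \<Otimes>\<^sub>M sphere_measure" ..
interpretation rate: pair_sigma_finite half_line
  "half_line \<Otimes>\<^sub>M unit_interval \<Otimes>\<^sub>M unit_interval \<Otimes>\<^sub>M sphere_measure" ..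
interpretation collision: pair_sigma_finite "lborel :: (real^3) measure"
  "half_line \<Otimes>\<^sub>M unit_interval \<Otimes>\<^sub>M unit_interval \<Otimes>\<^sub>M sphere_measure" ..

lemma sigma_finite_phase_measure: "sigma_finite_measure phase_measure"
  unfolding phase_measure_def by (rule phase.P.sigma_finite_measure_axioms)

lemma sigma_finite_collision_measure: "sigma_finite_measure collision_measure"
  unfolding collision_measure_def by (rule collision.P.sigma_finite_measure_axioms)

lemma sigma_finite_rate_measure: "sigma_finite_measure rate_measure"
  unfolding rate_measure_def by (rule rate.P.sigma_finite_measure_axioms)

interpretation phase_collision: pair_sigma_finite phase_measure collision_measure
  by (intro pair_sigma_finite.intro sigma_finite_phase_measure sigma_finite_collision_measure)

interpretation lborel_rate: pair_sigma_finite
  "(lborel :: (real^3) measure) \<Otimes>\<^sub>M (lborel :: (real^3) measure)" rate_measure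
  by (intro pair_sigma_finite.intro sigma_finite_rate_measure lborel_pair.P.sigma_finite_measure_axioms)

text \<open>The reflection vectors of the rotated pair are the rotated reflection vectors. The
  defining predicates are therefore equal, which settles the description for arbitrary vectors,
  without unique existence.\<close>

lemma cos_theta_orthogonal:
  assumes Q: "orthogonal_transformation Q"
  shows "cos_theta (Q y) (Q \<sigma>) = cos_theta y \<sigma>"
proof -
  have lin: "linear Q" and nQ: "\<And>x. norm (Q x) = norm x" and iQ: "\<And>x y. Q x \<bullet> Q y = x \<bullet> y"
    using Q by (auto simp: orthogonal_transformation_norm orthogonal_transformation_linear)
      (simp add: orthogonal_transformation_def)
  have eq: "Q \<sigma> = Q y - (2 * (Q \<omega> \<bullet> Q y)) *\<^sub>R Q \<omega> \<longleftrightarrow> \<sigma> = y - (2 * (\<omega> \<bullet> y)) *\<^sub>R \<omega>" for \<omega>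
    using orthogonal_transformation_inj[OF Q]
    by (simp add: iQ linear_diff[OF lin, symmetric] linear_scale[OF lin, symmetric] inj_eq)
  have "(\<exists>\<omega>. norm \<omega> = 1 \<and> Q \<sigma> = Q y - (2 * (\<omega> \<bullet> Q y)) *\<^sub>R \<omega> \<and> c = \<bar>\<omega> \<bullet> Q y\<bar>)
      \<longleftrightarrow> (\<exists>\<omega>. norm \<omega> = 1 \<and> \<sigma> = y - (2 * (\<omega> \<bullet> y)) *\<^sub>R \<omega> \<and> c = \<bar>\<omega> \<bullet> y\<bar>)" for c
  proof
    assume "\<exists>\<omega>. norm \<omega> = 1 \<and> Q \<sigma> = Q y - (2 * (\<omega> \<bullet> Q y)) *\<^sub>R \<omega> \<and> c = \<bar>\<omega> \<bullet> Q y\<bar>"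
    then obtain \<omega> where "norm (Q \<omega>) = 1 \<and> Q \<sigma> = Q y - (2 * (Q \<omega> \<bullet> Q y)) *\<^sub>R Q \<omega> \<and> c = \<bar>Q \<omega> \<bullet> Q y\<bar>"
      using orthogonal_transformation_surj[OF Q] by (metis surjD)
    then show "\<exists>\<omega>. norm \<omega> = 1 \<and> \<sigma> = y - (2 * (\<omega> \<bullet> y)) *\<^sub>R \<omega> \<and> c = \<bar>\<omega> \<bullet> y\<bar>"
      unfolding eq unfolding nQ iQ by blast
  next
    assume "\<exists>\<omega>. norm \<omega> = 1 \<and> \<sigma> = y - (2 * (\<omega> \<bullet> y)) *\<^sub>R \<omega> \<and> c = \<bar>\<omega> \<bullet> y\<bar>"
    then obtain \<omega> where "norm \<omega> = 1 \<and> \<sigma> = y - (2 * (\<omega> \<bullet> y)) *\<^sub>R \<omega> \<and> c = \<bar>\<omega> \<bullet> y\<bar>" ..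
    then show "\<exists>\<omega>. norm \<omega> = 1 \<and> Q \<sigma> = Q y - (2 * (\<omega> \<bullet> Q y)) *\<^sub>R \<omega> \<and> c = \<bar>\<omega> \<bullet> Q y\<bar>"
      using eq[of \<omega>] by (intro exI[of _ "Q \<omega>"]) (simp add: nQ iQ)
  qed
  then show ?thesis unfolding cos_theta_def by simp
qed

text \<open>The rotation acts on the innermost factor of a nested product, and invariance is carried
  outwards one factor at a time through \<open>g1\<close>, \<open>g2\<close>,
  \<open>g3\<close>.\<close>

lemma distr_rate_measure_rotation:
  assumes Q: "orthogonal_transformation Q"
  defines "\<psi> \<equiv> \<lambda>(I, J, R, r, \<sigma>). (I, J, R, r, Q \<sigma>)"
  shows "\<psi> \<in> measurable rate_measure rate_measure" "distr rate_measure rate_measure \<psi> = rate_measure"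
proof -
  note [measurable] = orthogonal_transformation_measurable[OF Q]
  have Qs: "Q \<in> measurable sphere_measure sphere_measure"
    using orthogonal_transformation_measurable[OF Q] by (simp add: measurable_def)
  have d1: "distr sphere_measure sphere_measure Q = sphere_measure"
    using distr_sphere_orthogonal[OF Q] by (simp cong: distr_cong)
  define g1 where "g1 = (\<lambda>(r::real, \<sigma>). (r, Q \<sigma>))"
  define g2 where "g2 = (\<lambda>(R::real, z). (R, g1 z))"
  define g3 where "g3 = (\<lambda>(J::real, z). (J, g2 z))"
  have m1: "g1 \<in> measurable (unit_interval \<Otimes>\<^sub>M sphere_measure) (unit_interval \<Otimes>\<^sub>M sphere_measure)"
    unfolding g1_def using Qs by measurable
  have e1: "distr (unit_interval \<Otimes>\<^sub>M sphere_measure) (unit_interval \<Otimes>\<^sub>M sphere_measure) g1 = unit_interval \<Otimes>\<^sub>M sphere_measure"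
    unfolding g1_def by (intro distr_pair_measure_snd sphere.sigma_finite_measure_axioms Qs d1)
  have m2: "g2 \<in> measurable (unit_interval \<Otimes>\<^sub>M unit_interval \<Otimes>\<^sub>M sphere_measure) (unit_interval \<Otimes>\<^sub>M unit_interval \<Otimes>\<^sub>M sphere_measure)"
    unfolding g2_def using m1 by measurable
  have e2: "distr (unit_interval \<Otimes>\<^sub>M unit_interval \<Otimes>\<^sub>M sphere_measure) (unit_interval \<Otimes>\<^sub>M unit_interval \<Otimes>\<^sub>M sphere_measure) g2
      = unit_interval \<Otimes>\<^sub>M unit_interval \<Otimes>\<^sub>M sphere_measure"
    unfolding g2_def by (intro distr_pair_measure_snd unit_sphere.P.sigma_finite_measure_axioms m1 e1)
  have m3: "g3 \<in> measurable (half_line \<Otimes>\<^sub>M unit_interval \<Otimes>\<^sub>M unit_interval \<Otimes>\<^sub>M sphere_measure) (half_line \<Otimes>\<^sub>M unit_interval \<Otimes>\<^sub>M unit_interval \<Otimes>\<^sub>M sphere_measure)"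
    unfolding g3_def using m2 by measurable
  have e3: "distr (half_line \<Otimes>\<^sub>M unit_interval \<Otimes>\<^sub>M unit_interval \<Otimes>\<^sub>M sphere_measure) (half_line \<Otimes>\<^sub>M unit_interval \<Otimes>\<^sub>M unit_interval \<Otimes>\<^sub>M sphere_measure) g3
      = half_line \<Otimes>\<^sub>M unit_interval \<Otimes>\<^sub>M unit_interval \<Otimes>\<^sub>M sphere_measure"
    unfolding g3_def by (intro distr_pair_measure_snd unit_unit_sphere.P.sigma_finite_measure_axioms m2 e2)
  have psi: "\<psi> = (\<lambda>(I, z). (I, g3 z))"
    unfolding \<psi>_def g3_def g2_def g1_def by (auto simp: fun_eq_iff)
  show "\<psi> \<in> measurable rate_measure rate_measure"
    unfolding psi rate_measure_def using m3 by measurable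
  show "distr rate_measure rate_measure \<psi> = rate_measure"
    unfolding psi rate_measure_def
    by (intro distr_pair_measure_snd half_unit_unit_sphere.P.sigma_finite_measure_axioms m3 e3)
qed

text \<open>A rotation taking one unit vector to the other can be moved onto \<sigma>. The outer
  function \<open>h\<close> is present because both the integrand and its absolute value are needed,
  the latter for integrability.\<close>

lemma rate_integral_rotation:
  fixes h :: "real \<Rightarrow> real"
  assumes y: "norm y = 1" "norm z = 1" and h: "h \<in> borel_measurable borel"
    and m: "rate_integrand X z T \<in> borel_measurable rate_measure"
  shows "(LINT p|rate_measure. h (rate_integrand X z T p)) = (LINT p|rate_measure. h (rate_integrand X y T p))"
proof -
  obtain Q :: "real^3 \<Rightarrow> real^3" where Q: "orthogonal_transformation Q" "Q y = z"
    by (rule orthogonal_transformation_exists_1[of y z]) (use y in auto)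
  let ?\<psi> = "\<lambda>(I::real, J::real, R::real, r::real, \<sigma>). (I, J, R, r, Q \<sigma>)"
  note p = distr_rate_measure_rotation[OF Q(1)]
  have "(LINT p|rate_measure. h (rate_integrand X z T p)) = (LINT p|distr rate_measure rate_measure ?\<psi>. h (rate_integrand X z T p))"
    by (simp only: p(2))
  also have "\<dots> = (LINT p|rate_measure. h (rate_integrand X z T (?\<psi> p)))"
    by (intro integral_distr p(1) measurable_compose[OF m h])
  also have "\<dots> = (LINT p|rate_measure. h (rate_integrand X y T p))"
    by (intro Bochner_Integration.integral_cong refl)
       (auto simp: rate_integrand_def split_beta Q(2)[symmetric] cos_theta_orthogonal[OF Q(1)])
  finally show ?thesis .
qed

text \<open>A closed form at every argument, also off the sphere, makes measurability accessible for
  a function given by a description. Where no \<omega> exists the value is the fixed unspecified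
  \<open>THE c. False\<close>; for the pair of zero vectors every unit \<omega> gives 0.\<close>

lemma cos_theta_sgn:
  "cos_theta (sgn w) \<sigma> = (if w \<noteq> 0 \<and> norm \<sigma> = 1 then sqrt ((1 - \<sigma> \<bullet> sgn w) / 2)
     else if w = 0 \<and> \<sigma> = 0 then 0 else (THE c. False))"
proof -
  have nrm: "norm (y - (2 * (\<omega> \<bullet> y)) *\<^sub>R \<omega>) = 1" if "norm \<omega> = 1" "norm y = 1" for y \<omega> :: "real^3"
  proof -
    have "\<omega> \<bullet> \<omega> = 1" "y \<bullet> y = 1" using that by (simp_all add: dot_square_norm)
    then show ?thesis
      by (simp add: norm_eq_1 inner_diff_left inner_diff_right inner_commute algebra_simps)
  qed
  consider "w \<noteq> 0" "norm \<sigma> = 1" | "w \<noteq> 0" "norm \<sigma> \<noteq> 1" | "w = 0" "\<sigma> = 0" | "w = 0" "\<sigma> \<noteq> 0" by blast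
  then show ?thesis
  proof cases
    case 1
    then show ?thesis by (simp add: cos_theta_eq norm_sgn)
  next
    case 2
    then have "(\<exists>\<omega>. norm \<omega> = 1 \<and> \<sigma> = sgn w - (2 * (\<omega> \<bullet> sgn w)) *\<^sub>R \<omega> \<and> c = \<bar>\<omega> \<bullet> sgn w\<bar>) \<longleftrightarrow> False" for c
      using nrm[of _ "sgn w"] by (auto simp: norm_sgn)
    then have "cos_theta (sgn w) \<sigma> = (THE c. False)" unfolding cos_theta_def by (simp only:)
    then show ?thesis using 2 by simp
  next
    case 3
    have "\<exists>\<omega>::real^3. norm \<omega> = 1" by (rule exI[of _ "axis 1 1"]) simp
    then show ?thesis using 3 by (auto simp: cos_theta_def)
  next
    case 4
    then show ?thesis by (simp add: cos_theta_def)
  qed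
qed

lemma cos_theta_measurable:
  "(\<lambda>x. cos_theta (sgn (fst x)) (snd x)) \<in> borel_measurable (borel \<Otimes>\<^sub>M borel)"
proof -
  note [measurable] = sgn_measurable_vec
  show ?thesis unfolding cos_theta_sgn by measurable
qed

lemma measurable_half_line_real:
  "g \<in> measurable M half_line \<Longrightarrow> g \<in> borel_measurable M"
  by (rule measurable_compose[OF _ measurable_ident_half_line])

lemma measurable_unit_interval_real:
  "g \<in> measurable M unit_interval \<Longrightarrow> g \<in> borel_measurable M"
  by (rule measurable_compose[OF _ measurable_ident_unit_interval])

lemma measurable_fst_component:
  "g \<in> measurable M (A \<Otimes>\<^sub>M B) \<Longrightarrow> (\<lambda>x. fst (g x)) \<in> measurable M A"
  by measurable

lemma measurable_snd_component:
  "g \<in> measurable M (A \<Otimes>\<^sub>M B) \<Longrightarrow> (\<lambda>x. snd (g x)) \<in> measurable M B"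
  by measurable

text \<open>Completion of the square: centre-of-mass and relative velocity diagonalise the kinetic
  energy, with ab/(a+b) as reduced mass. Both the Gaussian integral and the energy balance of the
  reaction rest on it.\<close>

lemma norm_diff_frame:
  fixes v g :: "real^3"
  assumes "a + b \<noteq> 0"
  shows "a * (norm v)\<^sup>2 + b * (norm (v - g))\<^sup>2
    = (a + b) * (norm (v - (b / (a + b)) *\<^sub>R g))\<^sup>2 + a * b / (a + b) * (norm g)\<^sup>2"
proof -
  define M s where "M = a + b" and "s = b / (a + b)"
  have M: "M \<noteq> 0" and b: "b = s * M" and a: "a = (1 - s) * M"
    using assms by (simp_all add: M_def s_def field_simps)
  have ab: "a * b / M = (1 - s) * s * M" unfolding a b using M by simp
  have "(1 - s) * M * (v \<bullet> v) + s * M * ((v - g) \<bullet> (v - g))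
      = M * ((v - s *\<^sub>R g) \<bullet> (v - s *\<^sub>R g)) + (1 - s) * s * M * (g \<bullet> g)"
    by (simp add: inner_diff_left inner_diff_right inner_commute algebra_simps)
  then show ?thesis
    unfolding s_def[symmetric] unfolding M_def[symmetric] power2_norm_eq_inner ab unfolding a b .
qed

lemma nn_integral_lborel_reflect:
  fixes f :: "real^3 \<Rightarrow> ennreal"
  assumes [measurable]: "f \<in> borel_measurable borel"
  shows "(\<integral>\<^sup>+x. f (v - x) \<partial>lborel) = (\<integral>\<^sup>+x. f x \<partial>lborel)"
proof -
  have "(lborel :: (real^3) measure) = distr lborel borel (\<lambda>x. v - x)"
    by (subst lborel_affine[of "-1" v]) (simp_all add: density_1)
  then have "(\<integral>\<^sup>+x. f x \<partial>lborel) = (\<integral>\<^sup>+x. f x \<partial>distr lborel borel (\<lambda>x. v - x))" by simp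
  also have "\<dots> = (\<integral>\<^sup>+x. f (v - x) \<partial>lborel)" by (rule nn_integral_distr) simp_all
  finally show ?thesis by simp
qed

lemma nn_integral_lborel_shift:
  fixes f :: "real^3 \<Rightarrow> ennreal"
  assumes [measurable]: "f \<in> borel_measurable borel"
  shows "(\<integral>\<^sup>+x. f (x - v) \<partial>lborel) = (\<integral>\<^sup>+x. f x \<partial>lborel)"
proof -
  have "(\<integral>\<^sup>+x. f x \<partial>lborel) = (\<integral>\<^sup>+x. f x \<partial>distr lborel borel ((+) (- v)))"
    by (simp add: lborel_distr_plus)
  also have "\<dots> = (\<integral>\<^sup>+x. f (- v + x) \<partial>lborel)" by (rule nn_integral_distr) simp_all
  finally show ?thesis by simp
qed

text \<open>In terms of g = v - w the exponent is a square centred at a multiple of g plus a term in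
  g alone. The square integrates to a constant by translation invariance, and a radial Gaussian with
  a power remains. Nonnegative integrals allow the change of order before integrability is
  known.\<close>

lemma has_bochner_integral_pair_gaussian:
  fixes a b p :: real
  assumes a: "a > 0" and b: "b > 0" and p: "p > -3"
  shows "has_bochner_integral (lborel \<Otimes>\<^sub>M lborel)
    (\<lambda>(v, w). exp (- (a * (norm v)\<^sup>2 + b * (norm w)\<^sup>2)) * norm (v - w :: real^3) powr p)
    ((pi / (a + b)) powr (3/2) * (2 * pi * (a * b / (a + b)) powr (- ((p + 3) / 2)) * Gamma ((p + 3) / 2)))"
proof (rule has_bochner_integral_nn_integral)
  define \<mu> where "\<mu> = a * b / (a + b)"
  have \<mu>: "\<mu> > 0" and ab: "a + b > 0" using a b by (simp_all add: \<mu>_def)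
  define V where "V = 2 * pi * \<mu> powr (- ((p + 3) / 2)) * Gamma ((p + 3) / 2)"
  have V: "V \<ge> 0" using p Gamma_real_pos[of "(p + 3) / 2"] by (simp add: V_def)
  let ?f = "\<lambda>v w. exp (- (a * (norm v)\<^sup>2 + b * (norm w)\<^sup>2)) * norm (v - w :: real^3) powr p"
  have "(\<integral>\<^sup>+z. ennreal (case z of (v, w) \<Rightarrow> ?f v w) \<partial>(lborel \<Otimes>\<^sub>M lborel))
      = (\<integral>\<^sup>+v. \<integral>\<^sup>+w. ennreal (?f v w) \<partial>lborel \<partial>lborel)"
    by (subst lborel.nn_integral_fst[symmetric]) (simp_all add: split_beta)
  also have "\<dots> = (\<integral>\<^sup>+v. \<integral>\<^sup>+g. ennreal (?f v (v - g)) \<partial>lborel \<partial>lborel)"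
    by (intro nn_integral_cong nn_integral_lborel_reflect[symmetric]) simp
  also have "\<dots> = (\<integral>\<^sup>+g. \<integral>\<^sup>+v. ennreal (?f v (v - g)) \<partial>lborel \<partial>lborel)"
    by (rule lborel_pair.Fubini'[symmetric]) (simp add: split_beta)
  also have "\<dots> = (\<integral>\<^sup>+g. ennreal (norm g powr p * exp (- (\<mu> * (norm g)\<^sup>2))) * ennreal ((pi / (a + b)) powr (3/2)) \<partial>(lborel :: (real^3) measure))"
  proof (intro nn_integral_cong)
    fix g :: "real^3"
    have "(\<integral>\<^sup>+v. ennreal (?f v (v - g)) \<partial>lborel)
        = (\<integral>\<^sup>+v. ennreal (norm g powr p * exp (- (\<mu> * (norm g)\<^sup>2)))
            * ennreal (exp (- ((a + b) * (norm (v - (b / (a + b)) *\<^sub>R g))\<^sup>2))) \<partial>lborel)"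
      using norm_diff_frame[of a b _ g] ab
      by (intro nn_integral_cong)
         (simp add: \<mu>_def ennreal_mult'[symmetric] exp_add[symmetric] mult_ac)
    also have "\<dots> = ennreal (norm g powr p * exp (- (\<mu> * (norm g)\<^sup>2)))
            * (\<integral>\<^sup>+v. ennreal (exp (- ((a + b) * (norm (v - (b / (a + b)) *\<^sub>R g))\<^sup>2))) \<partial>lborel)"
      by (rule nn_integral_cmult) simp
    also have "(\<integral>\<^sup>+v. ennreal (exp (- ((a + b) * (norm (v - (b / (a + b)) *\<^sub>R g))\<^sup>2))) \<partial>lborel)
        = (\<integral>\<^sup>+v. ennreal (exp (- ((a + b) * (norm (v :: real^3))\<^sup>2))) \<partial>lborel)"
      by (rule nn_integral_lborel_shift[where f = "\<lambda>v. ennreal (exp (- ((a + b) * (norm v)\<^sup>2)))"]) simp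
    also have "\<dots> = ennreal ((pi / (a + b)) powr (3/2))"
      using has_bochner_integral_gaussian(1)[OF ab]
      by (subst nn_integral_eq_integral) (auto simp: has_bochner_integral_iff)
    finally show "(\<integral>\<^sup>+v. ennreal (?f v (v - g)) \<partial>lborel)
        = ennreal (norm g powr p * exp (- (\<mu> * (norm g)\<^sup>2))) * ennreal ((pi / (a + b)) powr (3/2))" .
  qed
  also have "\<dots> = (\<integral>\<^sup>+g. ennreal (norm g powr p * exp (- (\<mu> * (norm g)\<^sup>2))) \<partial>(lborel :: (real^3) measure)) * ennreal ((pi / (a + b)) powr (3/2))"
    by (rule nn_integral_multc) simp
  also have "(\<integral>\<^sup>+g. ennreal (norm g powr p * exp (- (\<mu> * (norm g)\<^sup>2))) \<partial>(lborel :: (real^3) measure)) = ennreal V"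
    using has_bochner_integral_powr_gaussian[OF \<mu> p]
    by (subst nn_integral_eq_integral) (auto simp: has_bochner_integral_iff V_def)
  finally show "(\<integral>\<^sup>+z. ennreal (case z of (v, w) \<Rightarrow> ?f v w) \<partial>(lborel \<Otimes>\<^sub>M lborel))
      = ennreal ((pi / (a + b)) powr (3/2) * (2 * pi * (a * b / (a + b)) powr (- ((p + 3) / 2)) * Gamma ((p + 3) / 2)))"
    using V by (simp add: ennreal_mult'[symmetric] V_def \<mu>_def mult.commute)
  show "0 \<le> (pi / (a + b)) powr (3/2) * (2 * pi * (a * b / (a + b)) powr (- ((p + 3) / 2)) * Gamma ((p + 3) / 2))"
    using V by (simp add: V_def \<mu>_def)
qed (auto simp: split_beta)

section \<open>The collision integral shared by gain and loss\<close>

context reacting_mixture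
begin

lemma integrable_rate_integrand:
  "norm y = 1 \<Longrightarrow> T > 0 \<Longrightarrow> integrable rate_measure (rate_integrand X y T)"
  using convergent by (auto simp: integrals_converge_def)

text \<open>\<open>b_meas\<close> speaks of the unit interval only, so the kernel is extended by
  zero; for unit vectors the cosine lies in the interval by Cauchy-Schwarz. The remaining arguments
  contribute two constant values.\<close>

lemma bRe_cos_theta_measurable:
  "(\<lambda>x. bRe X (cos_theta (sgn (fst x)) (snd x))) \<in> borel_measurable (borel \<Otimes>\<^sub>M borel)"
proof -
  define b' where "b' c = (if c \<in> {0..1} then bRe X c else 0)" for c
  have [measurable]: "b' \<in> borel_measurable borel"
  proof -
    have "(\<lambda>x. indicator {0..1} x *\<^sub>R bRe X x) \<in> borel_measurable lborel"
      using b_meas by (subst borel_measurable_restrict_space_iff[symmetric]) auto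
    also have "(\<lambda>x. indicator {0..1} x *\<^sub>R bRe X x) = b'" by (auto simp: b'_def fun_eq_iff)
    finally show ?thesis by simp
  qed
  note [measurable] = sgn_measurable_vec
  have range: "sqrt ((1 - \<sigma> \<bullet> sgn w) / 2) \<in> {0..1}" if "norm \<sigma> = 1" "w \<noteq> 0" for \<sigma> w :: "real^3"
  proof -
    have "\<bar>\<sigma> \<bullet> sgn w\<bar> \<le> 1" using Cauchy_Schwarz_ineq2[of \<sigma> "sgn w"] that by (simp add: norm_sgn)
    then show ?thesis by (auto simp: real_sqrt_le_1_iff)
  qed
  have "(\<lambda>x. bRe X (cos_theta (sgn (fst x)) (snd x))) =
    (\<lambda>x :: (real^3) \<times> (real^3). if fst x \<noteq> 0 \<and> norm (snd x) = 1 then b' (sqrt ((1 - snd x \<bullet> sgn (fst x)) / 2))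
       else if fst x = 0 \<and> snd x = 0 then bRe X 0 else bRe X (THE c. False))"
    using range by (auto simp: fun_eq_iff cos_theta_sgn b'_def)
  then show ?thesis by simp
qed

lemma rate_integrand_measurable:
  "(\<lambda>x. rate_integrand X (sgn (fst (fst x) - snd (fst x))) T (snd x))
     \<in> borel_measurable ((lborel \<Otimes>\<^sub>M lborel) \<Otimes>\<^sub>M rate_measure)"
proof -
  let ?M = "((lborel :: (real^3) measure) \<Otimes>\<^sub>M (lborel :: (real^3) measure)) \<Otimes>\<^sub>M rate_measure"
  have z: "(\<lambda>x. snd x) \<in> measurable ?M
      (half_line \<Otimes>\<^sub>M half_line \<Otimes>\<^sub>M unit_interval \<Otimes>\<^sub>M unit_interval \<Otimes>\<^sub>M sphere_measure)"
    unfolding rate_measure_def by measurable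
  note [measurable] = z measurable_fst_component[OF z, THEN measurable_half_line_real]
    measurable_snd_component[OF z, THEN measurable_fst_component, THEN measurable_half_line_real]
    measurable_snd_component[OF z, THEN measurable_snd_component, THEN measurable_fst_component, THEN measurable_unit_interval_real]
  have "(\<lambda>x. snd (snd (snd (snd (snd x))))) \<in> measurable ?M sphere_measure"
    by (rule z[THEN measurable_snd_component, THEN measurable_snd_component, THEN measurable_snd_component, THEN measurable_snd_component])
  then have [measurable]: "(\<lambda>x. snd (snd (snd (snd (snd x))))) \<in> borel_measurable ?M"
    by (simp cong: measurable_cong_sets)
  have Phi: "(\<lambda>x. (\<lambda>(I, J, R, r). PhiRe X I J R r) (fst (snd x), fst (snd (snd x)), fst (snd (snd (snd x))), fst (snd (snd (snd (snd x))))))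
      \<in> borel_measurable ?M"
    by (rule measurable_compose[OF _ Phi_meas]) measurable
  have w: "(\<lambda>x. (fst (fst x) - snd (fst x), snd (snd (snd (snd (snd x)))))) \<in> measurable ?M (borel \<Otimes>\<^sub>M borel)"
    by measurable
  note [measurable] = Phi[simplified] measurable_compose[OF w cos_theta_measurable, simplified]
    measurable_compose[OF w bRe_cos_theta_measurable, simplified]
  show ?thesis unfolding rate_integrand_def split_beta by measurable
qed

text \<open>The exponent is the \<gamma> of the reactive kernel lowered by the factor 1/|v - w| of
  the collision integral. The Gaussians are those of species 3 and 4 at rest.\<close>

definition collision_kernel where
  "collision_kernel T = (\<lambda>(v :: real^3, w).
     exp (- (mass X 3 / (2 * kB X * T) * (norm v)\<^sup>2 + mass X 4 / (2 * kB X * T) * (norm w)\<^sup>2))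
       * norm (v - w) powr (expo X - 1))"

text \<open>The reactive kernel times the pre-collisional equilibrium exponentials. At equilibrium
  the gain and the loss are both multiples of it; at a raised temperature it provides the
  majorant.\<close>

definition weighted_rate where
  "weighted_rate T = (\<lambda>x :: ((real^3) \<times> real) \<times> ((real^3) \<times> real \<times> real \<times> real \<times> (real^3)).
     collision_kernel T (fst (fst x), fst (snd x))
       * rate_integrand X (sgn (fst (fst x) - fst (snd x))) T (snd (fst x), snd (snd x)))"

text \<open>For fixed velocities the inner integral is the rate integral with \<theta> measured from
  the direction of v - w. Rotation invariance makes it independent of that direction, so the
  integral is a product.\<close>

lemma has_bochner_integral_weighted_rate:
  assumes T: "T > 0" and y: "norm y = 1"
  shows "has_bochner_integral (phase_measure \<Otimes>\<^sub>M collision_measure) (weighted_rate T)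
    ((2 * pi * kB X * T / total_mass X) powr (3/2)
      * (2 * pi * (2 * kB X * T / red_mass X 3 4) powr ((expo X + 2) / 2) * Gamma ((expo X + 2) / 2))
      * (LINT p|rate_measure. rate_integrand X y T p))"
proof -
  let ?K = "collision_kernel T"
  let ?L = "(lborel :: (real^3) measure) \<Otimes>\<^sub>M (lborel :: (real^3) measure)"
  let ?V = "(2 * pi * kB X * T / total_mass X) powr (3/2)
      * (2 * pi * (2 * kB X * T / red_mass X 3 4) powr ((expo X + 2) / 2) * Gamma ((expo X + 2) / 2))"
  define c where "c = 1 / (2 * kB X * T)"
  have c: "c > 0" using T boltzmann by (simp add: c_def)
  have m: "mass X 3 > 0" "mass X 4 > 0" using masses by auto
  have K: "has_bochner_integral ?L ?K ?V"
  proof -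
    have "pi / (mass X 3 / (2 * kB X * T) + mass X 4 / (2 * kB X * T)) = 2 * pi * kB X * T / total_mass X"
      using T boltzmann m by (simp add: total_mass_def mass_balance[simplified] field_simps)
    moreover have "(mass X 3 / (2 * kB X * T) * (mass X 4 / (2 * kB X * T))
        / (mass X 3 / (2 * kB X * T) + mass X 4 / (2 * kB X * T))) = inverse (2 * kB X * T / red_mass X 3 4)"
      using T boltzmann m by (simp add: red_mass_def field_simps)
    moreover have "2 * kB X * T / red_mass X 3 4 > 0"
      using T boltzmann m by (simp add: red_mass_def)
    ultimately show ?thesis
      using has_bochner_integral_pair_gaussian[of "mass X 3 / (2 * kB X * T)" "mass X 4 / (2 * kB X * T)" "expo X - 1"]
        T boltzmann m exponent
      by (simp add: collision_kernel_def inverse_powr[symmetric] powr_minus add.commute[of _ "expo X"])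
  qed
  have Kint: "integrable ?L ?K" and [measurable]: "?K \<in> borel_measurable ?L"
    using K by (auto simp: has_bochner_integral_iff)
  \<comment> \<open>At v = w the vector \<open>sgn 0\<close> is no unit vector, and the rate
    integral is not under control. The kernel vanishes there, even for \<gamma> = 1, because
    \<open>0 powr 0\<close> is 0.\<close>
  have K0: "?K (v, v) = 0" for v by (simp add: collision_kernel_def)
  let ?r = "\<lambda>p. rate_integrand X (sgn (fst p - snd p)) T"
  have rint: "integrable rate_measure (?r p)" if "fst p \<noteq> snd p" for p
    using that T by (intro integrable_rate_integrand) (simp_all add: norm_sgn)
  have rot: "?K p * (LINT z|rate_measure. h (?r p z)) = ?K p * (LINT z|rate_measure. h (rate_integrand X y T z))"
    if "h \<in> borel_measurable borel" for p and h :: "real \<Rightarrow> real"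
  proof (cases "fst p = snd p")
    case True
    then show ?thesis using K0[of "fst p"] by (metis mult_zero_left prod.collapse)
  next
    case False
    then show ?thesis
      using y T that by (subst rate_integral_rotation[of y]) (auto simp: norm_sgn intro!: borel_measurable_integrable integrable_rate_integrand)
  qed
  let ?F = "\<lambda>x. ?K (fst x) * ?r (fst x) (snd x)"
  note [measurable] = rate_integrand_measurable[of T]
  have int: "integrable (?L \<Otimes>\<^sub>M rate_measure) ?F"
  proof (rule lborel_rate.Fubini_integrable)
    \<comment> \<open>Rotation invariance with \<open>abs\<close> reduces the inner integral of
      absolute values to a constant times the integrable kernel, as Fubini's criterion
      requires.\<close>
    have "(\<lambda>p. LINT z|rate_measure. norm (?F (p, z)))
        = (\<lambda>p. \<bar>?K p\<bar> * (LINT z|rate_measure. \<bar>rate_integrand X y T z\<bar>))"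
      using rot[of abs] by (auto simp: abs_mult fun_eq_iff mult_cancel_left)
    then show "integrable ?L (\<lambda>p. LINT z|rate_measure. norm (?F (p, z)))"
      using Kint by simp
    show "AE p in ?L. integrable rate_measure (\<lambda>z. ?F (p, z))"
    proof (rule AE_I2)
      fix p :: "(real^3) \<times> (real^3)"
      show "integrable rate_measure (\<lambda>z. ?F (p, z))"
      proof (cases "fst p = snd p")
        case True
        then have "?K p = 0" using K0[of "fst p"] by (metis prod.collapse)
        then show ?thesis by simp
      qed (use rint[of p] in simp)
    qed
  qed measurable
  have val: "integral\<^sup>L (?L \<Otimes>\<^sub>M rate_measure) ?F = ?V * (LINT p|rate_measure. rate_integrand X y T p)"
  proof -
    have "integral\<^sup>L (?L \<Otimes>\<^sub>M rate_measure) ?F = (LINT p|?L. LINT z|rate_measure. ?F (p, z))"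
      by (rule lborel_rate.integral_fst'[OF int, symmetric])
    also have "\<dots> = (LINT p|?L. ?K p * (LINT z|rate_measure. rate_integrand X y T z))"
      by (intro Bochner_Integration.integral_cong refl) (use rot[of "\<lambda>x. x"] in simp)
    finally show ?thesis using K by (simp add: has_bochner_integral_iff)
  qed
  let ?s = "\<lambda>x. ((fst (fst x), fst (snd x)), (snd (fst x), snd (snd x)))"
  have sw: "distr (?L \<Otimes>\<^sub>M rate_measure) (phase_measure \<Otimes>\<^sub>M collision_measure) ?s = phase_measure \<Otimes>\<^sub>M collision_measure"
    unfolding phase_measure_def collision_measure_def rate_measure_def
    by (rule distr_pair_measure_swap_middle)
       (rule lborel.sigma_finite_measure_axioms half_line.sigma_finite_measure_axioms half_unit_unit_sphere.P.sigma_finite_measure_axioms)+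
  have sm: "?s \<in> measurable (?L \<Otimes>\<^sub>M rate_measure) (phase_measure \<Otimes>\<^sub>M collision_measure)"
    unfolding phase_measure_def collision_measure_def rate_measure_def by measurable
  have sm': "?s \<in> measurable (phase_measure \<Otimes>\<^sub>M collision_measure) (?L \<Otimes>\<^sub>M rate_measure)"
    unfolding phase_measure_def collision_measure_def rate_measure_def by measurable
  have Wm: "weighted_rate T \<in> borel_measurable (phase_measure \<Otimes>\<^sub>M collision_measure)"
    using measurable_compose[OF sm', of ?F borel] by (simp add: weighted_rate_def)
  have Ws: "weighted_rate T (?s x) = ?F x" for x by (simp add: weighted_rate_def)
  have "integrable (phase_measure \<Otimes>\<^sub>M collision_measure) (weighted_rate T)"
    using integrable_distr_eq[OF sm Wm] int unfolding sw Ws by simp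
  moreover have "integral\<^sup>L (phase_measure \<Otimes>\<^sub>M collision_measure) (weighted_rate T) = ?V * (LINT p|rate_measure. rate_integrand X y T p)"
    using integral_distr[OF sm Wm] val unfolding sw Ws by simp
  ultimately show ?thesis by (simp add: has_bochner_integral_iff)
qed

end

section \<open>Limit of the reactive moment\<close>

lemma exp_minus_divide_mult: "exp (- a / b) * exp (a / b) = (1 :: real)"
  by (simp add: exp_add[symmetric])

context reacting_mixture
begin

text \<open>With the definitions up to \<open>product_I\<close> this names the collision data of the
  quadruple (3,4,1,2) with s = 1. For i = 3 the parameters r and 1 - r are not interchanged:
  \<open>product_I\<close> at r belongs to species 1, at 1 - r to species 2.\<close>

definition collision_energy :: "real^3 \<Rightarrow> real \<Rightarrow> real^3 \<Rightarrow> real \<Rightarrow> real" where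
  "collision_energy v I w J = red_mass X 3 4 * (norm (v - w))\<^sup>2 / 2 + I + J + reaction_heat X / 2"

definition mass_center :: "real^3 \<Rightarrow> real^3 \<Rightarrow> real^3" where
  "mass_center v w = (1 / total_mass X) *\<^sub>R (mass X 3 *\<^sub>R v + mass X 4 *\<^sub>R w)"

definition product_speed :: "real^3 \<Rightarrow> real \<Rightarrow> real^3 \<Rightarrow> real \<Rightarrow> real \<Rightarrow> real" where
  "product_speed v I w J R = sqrt (2 / red_mass X 1 2) * sqrt (R * collision_energy v I w J + reaction_heat X / 6)"

definition product_v1 where
  "product_v1 v I w J R \<sigma> = mass_center v w + (mass X 2 / total_mass X * product_speed v I w J R) *\<^sub>R \<sigma>"

definition product_v2 where
  "product_v2 v I w J R \<sigma> = mass_center v w - (mass X 1 / total_mass X * product_speed v I w J R) *\<^sub>R \<sigma>"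

definition product_I where
  "product_I v I w J R r = r * (1 - R) * collision_energy v I w J + reaction_heat X / 6"

definition backward_gain_loss where
  "backward_gain_loss f = (\<lambda>((v :: real^3, I :: real), (w, J, R, r, \<sigma>)).
     (mass X 3 * mass X 4 / (mass X 1 * mass X 2)) ^ 3
       * f (1 :: nat) (product_v1 v I w J R \<sigma>) (product_I v I w J R r)
       * f (2 :: nat) (product_v2 v I w J R \<sigma>) (product_I v I w J R (1 - r))
     - f (3 :: nat) v I * (f (4 :: nat) w J :: real))"

text \<open>The integrand of the third operator once its weight is cancelled and |v - w|^\<gamma>
  has absorbed the factor 1/|v - w|.\<close>

definition backward_integrand where
  "backward_integrand f = (\<lambda>((v, I), (w, J, R, r, \<sigma>)).
     backward_gain_loss f ((v, I), (w, J, R, r, \<sigma>)) * (2 / (mass X 3 * mass X 4)\<^sup>2) * norm (v - w) powr (expo X - 1)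
       * (PhiRe X I J R r * bRe X (cos_theta (sgn (v - w)) \<sigma>) * cos_theta (sgn (v - w)) \<sigma> * (1 - R)))"

lemma Qreact_3_weighted:
  assumes "weight X 3 I \<noteq> 0"
  shows "Qreact X 3 f v I * weight X 3 I = (LINT z|collision_measure. backward_integrand f ((v, I), z))"
proof -
  \<comment> \<open>At x = 0 both sides are 0, by division by zero on the left and by
    \<open>0 powr\<close> on the right.\<close>
  have p: "norm x powr expo X / norm x = norm x powr (expo X - 1)" for x :: "real^3"
    by (cases "x = 0") (simp_all add: powr_diff)
  have "Qreact X 3 f v I * weight X 3 I
      = (LINT (w, J, R, r, \<sigma>)|collision_measure.
          backward_gain_loss f ((v, I), (w, J, R, r, \<sigma>)) * (norm (v - w) powr expo X * PhiRe X I J R r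
            * bRe X (cos_theta (sgn (v - w)) \<sigma>)) * (2 * cos_theta (sgn (v - w)) \<sigma> * (1 - R)
             / ((mass X 3 * mass X 4)\<^sup>2 * norm (v - w) * weight X 3 I))) * weight X 3 I"
    by (simp add: Qreact_def Qreact_quad_def Let_def backward_gain_loss_def product_v1_def product_v2_def
        product_I_def product_speed_def mass_center_def collision_energy_def)
  also have "\<dots> = (LINT z|collision_measure. backward_integrand f ((v, I), z))"
    unfolding Bochner_Integration.integral_mult_left_zero[symmetric]
    using assms by (intro Bochner_Integration.integral_cong refl)
      (auto simp: backward_integrand_def p[symmetric] split_beta)
  finally show ?thesis .
qed

lemma collision_energy_nonneg:
  "I \<ge> 0 \<Longrightarrow> J \<ge> 0 \<Longrightarrow> collision_energy v I w J \<ge> 0"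
  using masses[of 3] masses[of 4] heat by (auto simp: collision_energy_def red_mass_def intro!: add_nonneg_nonneg mult_nonneg_nonneg divide_nonneg_nonneg)

lemma product_I_nonneg:
  "I \<ge> 0 \<Longrightarrow> J \<ge> 0 \<Longrightarrow> R \<in> {0..1} \<Longrightarrow> r \<ge> 0 \<Longrightarrow> product_I v I w J R r \<ge> 0"
  using heat collision_energy_nonneg[of I J v w] by (auto simp: product_I_def intro!: add_nonneg_nonneg mult_nonneg_nonneg)

text \<open>The surplus is exactly E: one half is contained in the collision energy, and one sixth
  each is added to the relative motion and to the two internal energies. Since mass is conserved the
  centre-of-mass term is common to both sides, and |\<sigma>| = 1 makes the relative kinetic energy
  of the products equal to \<open>R * En\<close> plus E/6.\<close>

lemma backward_energy_balance:
  assumes "I \<ge> 0" "J \<ge> 0" "R \<in> {0..1}" "norm \<sigma> = 1"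
  shows "(mass X 1 * (norm (product_v1 v I w J R \<sigma>))\<^sup>2 / 2 + product_I v I w J R r)
      + (mass X 2 * (norm (product_v2 v I w J R \<sigma>))\<^sup>2 / 2 + product_I v I w J R (1 - r))
    = (mass X 3 * (norm v)\<^sup>2 / 2 + I) + (mass X 4 * (norm w)\<^sup>2 / 2 + J) + reaction_heat X"
proof -
  have m: "mass X 1 > 0" "mass X 2 > 0" "mass X 3 > 0" "mass X 4 > 0" using masses by auto
  define M where "M = total_mass X"
  have M12: "M = mass X 1 + mass X 2" and M34: "M = mass X 3 + mass X 4"
    using mass_balance by (simp_all add: M_def total_mass_def)
  have M0: "M > 0" using M12 m by simp
  define s where "s = product_speed v I w J R"
  define G where "G = mass_center v w"
  define En where "En = collision_energy v I w J"
  \<comment> \<open>The sign conditions on I, J, R and E enter here: squaring undoes the root in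
    \<open>product_speed\<close> because the radicand is nonnegative.\<close>
  have "R * En + reaction_heat X / 6 \<ge> 0"
    using assms heat collision_energy_nonneg[of I J v w] by (simp add: En_def)
  moreover have "red_mass X 1 2 > 0" using m by (simp add: red_mass_def)
  ultimately have s2: "red_mass X 1 2 * s\<^sup>2 / 2 = R * En + reaction_heat X / 6"
    unfolding s_def product_speed_def En_def by (simp add: power_mult_distrib real_sqrt_pow2)
  have ss: "\<sigma> \<bullet> \<sigma> = 1" using assms(4) by (simp add: dot_square_norm)
  have N1: "(norm (product_v1 v I w J R \<sigma>))\<^sup>2 = (norm G)\<^sup>2 + 2 * (mass X 2 / M * s) * (G \<bullet> \<sigma>) + (mass X 2 / M * s)\<^sup>2"
    unfolding product_v1_def s_def[symmetric] G_def[symmetric] M_def[symmetric] power2_norm_eq_inner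
    by (simp only: inner_add_left inner_add_right inner_scaleR_left inner_scaleR_right ss)
       (simp add: inner_commute power2_eq_square algebra_simps add_divide_distrib diff_divide_distrib)
  have N2: "(norm (product_v2 v I w J R \<sigma>))\<^sup>2 = (norm G)\<^sup>2 - 2 * (mass X 1 / M * s) * (G \<bullet> \<sigma>) + (mass X 1 / M * s)\<^sup>2"
    unfolding product_v2_def s_def[symmetric] G_def[symmetric] M_def[symmetric] power2_norm_eq_inner
    by (simp only: inner_diff_left inner_diff_right inner_scaleR_left inner_scaleR_right ss)
       (simp add: inner_commute power2_eq_square algebra_simps add_divide_distrib diff_divide_distrib)
  have mu: "mass X 1 * (mass X 2 / M * s)\<^sup>2 + mass X 2 * (mass X 1 / M * s)\<^sup>2 = red_mass X 1 2 * s\<^sup>2"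
  proof -
    have "mass X 1 * (mass X 2 / M * s)\<^sup>2 + mass X 2 * (mass X 1 / M * s)\<^sup>2
        = mass X 1 * mass X 2 * M / (M * M) * s\<^sup>2"
      by (simp add: power2_eq_square M12 add_divide_distrib[symmetric] algebra_simps)
    then show ?thesis unfolding red_mass_def M12[symmetric] using M0 by simp
  qed
  have cross: "mass X 1 * (2 * (mass X 2 / M * s) * (G \<bullet> \<sigma>)) = mass X 2 * (2 * (mass X 1 / M * s) * (G \<bullet> \<sigma>))"
    by simp
  have A: "mass X 1 * (norm (product_v1 v I w J R \<sigma>))\<^sup>2 + mass X 2 * (norm (product_v2 v I w J R \<sigma>))\<^sup>2
      = M * (norm G)\<^sup>2 + red_mass X 1 2 * s\<^sup>2"
    unfolding N1 N2 mu[symmetric] M12 using cross by (simp add: algebra_simps M12)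
  have Gv: "G = v - (mass X 4 / (mass X 3 + mass X 4)) *\<^sub>R (v - w)"
  proof -
    have "M *\<^sub>R G = M *\<^sub>R (v - (mass X 4 / M) *\<^sub>R (v - w))"
      unfolding G_def mass_center_def M_def[symmetric] using M0
      by (simp add: scaleR_right_diff_distrib M34 scaleR_left_distrib)
    then show ?thesis using M0 by (simp add: M34)
  qed
  have B: "mass X 3 * (norm v)\<^sup>2 + mass X 4 * (norm w)\<^sup>2 = M * (norm G)\<^sup>2 + red_mass X 3 4 * (norm (v - w))\<^sup>2"
    using norm_diff_frame[of "mass X 3" "mass X 4" v "v - w"] m by (simp add: Gv[symmetric] M34 red_mass_def)
  have C: "product_I v I w J R r + product_I v I w J R (1 - r) = (1 - R) * En + reaction_heat X / 3"
    unfolding product_I_def En_def[symmetric] by (simp add: algebra_simps)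
  have En: "En = red_mass X 3 4 * (norm (v - w))\<^sup>2 / 2 + I + J + reaction_heat X / 2"
    by (simp add: En_def collision_energy_def)
  have "R * En + (1 - R) * En = En" by (simp add: algebra_simps)
  then show ?thesis using A B C En s2 by linarith
qed

lemma maxwellian_tendsto:
  assumes i: "i \<in> {1..4}" and T: "T > 0"
    and lim: "(N \<longlongrightarrow> n0) F" "(W \<longlongrightarrow> w) F" "(\<tau> \<longlongrightarrow> T) F"
  shows "((\<lambda>e. maxwellian X i (N e) (W e) (\<tau> e) v I) \<longlongrightarrow> maxwellian X i n0 w T v I) F"
proof -
  have "qmom 0 i T \<noteq> 0" using qmom_0_pos[OF i T] by simp
  then show ?thesis
    unfolding maxwellian_def qint_eq_qmom using T boltzmann masses[OF i]
    by (intro tendsto_intros qmom_tendsto i lim) auto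
qed

text \<open>The temperature of the dominating Gaussian is four times the limit temperature: a factor two absorbs
  the variation of the temperature and another factor two the drift velocity.\<close>

lemma maxwellian_eventually_bounded:
  assumes i: "i \<in> {1..4}" and T: "T > 0"
    and lim: "(N \<longlongrightarrow> n0) F" "(W \<longlongrightarrow> 0) F" "(\<tau> \<longlongrightarrow> T) F"
  obtains C where "C \<ge> 0"
    "\<forall>\<^sub>F e in F. \<forall>v I. I \<ge> 0 \<longrightarrow> \<bar>maxwellian X i (N e) (W e) (\<tau> e) v I\<bar>
       \<le> C * exp (- (mass X i * (norm v)\<^sup>2 / 2 + I) / (kB X * (4 * T)))"
proof -
  define m where "m = mass X i"
  have mk: "m > 0" "kB X > 0" using masses[OF i] boltzmann by (auto simp: m_def)
  define P where "P e = N e / qint X i (\<tau> e) * (mass X i / (2 * pi * kB X * \<tau> e)) powr (3/2)" for e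
  define P0 where "P0 = n0 / qint X i T * (mass X i / (2 * pi * kB X * T)) powr (3/2)"
  have "qmom 0 i T \<noteq> 0" using qmom_0_pos[OF i T] by simp
  then have "(P \<longlongrightarrow> P0) F"
    unfolding P_def[abs_def] P0_def qint_eq_qmom using T boltzmann masses[OF i]
    by (intro tendsto_intros qmom_tendsto i lim) auto
  then have e1: "\<forall>\<^sub>F e in F. \<bar>P e\<bar> < \<bar>P0\<bar> + 1"
    by (intro order_tendstoD(2)[OF tendsto_rabs]) auto
  have e2: "\<forall>\<^sub>F e in F. norm (W e) < 1"
    using tendsto_norm[OF lim(2)] by (intro order_tendstoD(2)) auto
  have e3: "\<forall>\<^sub>F e in F. \<tau> e > 0" "\<forall>\<^sub>F e in F. \<tau> e < 2 * T"
    using order_tendstoD[OF lim(3)] T by auto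
  show thesis
  \<comment> \<open>The exponential factor is the price of the drift: |W| < 1 gives |v|^2 at most
    2|v - W|^2 + 2, and after multiplication by m/2 the additive term becomes m in the numerator.
    The other factor bounds the converging prefactor \<open>P\<close>.\<close>
  proof (rule that[of "(\<bar>P0\<bar> + 1) * exp (m / (kB X * (4 * T)))"])
    show "\<forall>\<^sub>F e in F. \<forall>v I. I \<ge> 0 \<longrightarrow> \<bar>maxwellian X i (N e) (W e) (\<tau> e) v I\<bar>
       \<le> (\<bar>P0\<bar> + 1) * exp (m / (kB X * (4 * T))) * exp (- (mass X i * (norm v)\<^sup>2 / 2 + I) / (kB X * (4 * T)))"
      using e1 e2 e3
    proof (eventually_elim, intro allI impI)
      fix e v and I :: real
      assume e: "\<bar>P e\<bar> < \<bar>P0\<bar> + 1" "norm (W e) < 1" "\<tau> e > 0" "\<tau> e < 2 * T" and I: "I \<ge> 0"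
      have "norm v \<le> norm (v - W e) + norm (W e)" using norm_triangle_ineq[of "v - W e" "W e"] by simp
      then have "norm v \<le> norm (v - W e) + 1" using e by simp
      then have "(norm v)\<^sup>2 \<le> (norm (v - W e) + 1)\<^sup>2" by (intro power_mono) auto
      also have "\<dots> \<le> 2 * (norm (v - W e))\<^sup>2 + 2"
        using sum_squares_bound[of "norm (v - W e)" 1] by (simp add: power2_sum)
      finally have "m * (norm v)\<^sup>2 \<le> m * (2 * (norm (v - W e))\<^sup>2 + 2)"
        using mk by (intro mult_left_mono) auto
      then have "m * (norm v)\<^sup>2 / 2 + I - m \<le> m * (norm (v - W e))\<^sup>2 + 2 * I"
        using I by (simp add: algebra_simps)
      then have "(m * (norm v)\<^sup>2 / 2 + I - m) / (kB X * (4 * T)) \<le> (m * (norm (v - W e))\<^sup>2 + 2 * I) / (kB X * (4 * T))"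
        using mk T by (intro divide_right_mono) auto
      also have "\<dots> \<le> (m * (norm (v - W e))\<^sup>2 + 2 * I) / (2 * kB X * \<tau> e)"
        using mk T e I by (intro divide_left_mono) auto
      finally have "- (m * (norm (v - W e))\<^sup>2 + 2 * I) / (2 * kB X * \<tau> e)
          \<le> m / (kB X * (4 * T)) + - (m * (norm v)\<^sup>2 / 2 + I) / (kB X * (4 * T))"
        by (simp only: add_divide_distrib diff_divide_distrib minus_divide_left[symmetric])
      then have ex: "exp (- (m * (norm (v - W e))\<^sup>2 + 2 * I) / (2 * kB X * \<tau> e))
          \<le> exp (m / (kB X * (4 * T))) * exp (- (m * (norm v)\<^sup>2 / 2 + I) / (kB X * (4 * T)))"
        unfolding exp_add[symmetric] by (subst exp_le_cancel_iff)
      have "\<bar>maxwellian X i (N e) (W e) (\<tau> e) v I\<bar> = \<bar>P e\<bar> * exp (- (m * (norm (v - W e))\<^sup>2 + 2 * I) / (2 * kB X * \<tau> e))"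
        by (simp add: maxwellian_def P_def m_def abs_mult)
      also have "\<dots> \<le> (\<bar>P0\<bar> + 1) * (exp (m / (kB X * (4 * T))) * exp (- (m * (norm v)\<^sup>2 / 2 + I) / (kB X * (4 * T))))"
        using e ex by (intro mult_mono) auto
      finally show "\<bar>maxwellian X i (N e) (W e) (\<tau> e) v I\<bar>
       \<le> (\<bar>P0\<bar> + 1) * exp (m / (kB X * (4 * T))) * exp (- (mass X i * (norm v)\<^sup>2 / 2 + I) / (kB X * (4 * T)))"
        by (simp add: m_def mult.assoc)
    qed
  qed auto
qed

lemma maxwellian_measurable:
  "(\<lambda>x. maxwellian X i n u T (fst x) (snd x)) \<in> borel_measurable (borel \<Otimes>\<^sub>M borel)"
  unfolding maxwellian_def by measurable

text \<open>Inserting the pre-collisional exponential and its inverse exhibits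
  \<open>weighted_rate\<close> at any auxiliary temperature. The limit temperature serves to
  identify the limit, four times that temperature serves for the bound.\<close>

lemma backward_integrand_eq:
  assumes T: "T > 0"
  shows "backward_integrand f ((v, I), (w, J, R, r, \<sigma>))
    = backward_gain_loss f ((v, I), (w, J, R, r, \<sigma>)) * (2 / (mass X 3 * mass X 4)\<^sup>2)
      * exp (((mass X 3 * (norm v)\<^sup>2 / 2 + I) + (mass X 4 * (norm w)\<^sup>2 / 2 + J)) / (kB X * T))
      * weighted_rate T ((v, I), (w, J, R, r, \<sigma>))"
proof -
  have "exp (((mass X 3 * (norm v)\<^sup>2 / 2 + I) + (mass X 4 * (norm w)\<^sup>2 / 2 + J)) / (kB X * T))
      * (exp (- (mass X 3 / (2 * kB X * T) * (norm v)\<^sup>2 + mass X 4 / (2 * kB X * T) * (norm w)\<^sup>2))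
        * exp (- (I + J) / (kB X * T))) = 1"
    unfolding exp_add[symmetric] by (simp add: add_divide_distrib diff_divide_distrib mult_ac)
  then show ?thesis
    unfolding backward_integrand_def weighted_rate_def collision_kernel_def rate_integrand_def
    by (simp add: mult_ac)
qed

abbreviation phase_collision_measure :: "(((real^3) \<times> real) \<times> ((real^3) \<times> real \<times> real \<times> real \<times> (real^3))) measure" where
  "phase_collision_measure \<equiv> phase_measure \<Otimes>\<^sub>M collision_measure"

lemma backward_gain_loss_measurable:
  "backward_gain_loss (\<lambda>i. maxwellian X i (N i) (W i) (\<tau> i)) \<in> borel_measurable phase_collision_measure"
proof -
  have p: "(\<lambda>x. fst x) \<in> measurable phase_collision_measure (lborel \<Otimes>\<^sub>M half_line)"
    unfolding phase_measure_def by measurable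
  have z: "(\<lambda>x. snd x) \<in> measurable phase_collision_measure
      (lborel \<Otimes>\<^sub>M half_line \<Otimes>\<^sub>M unit_interval \<Otimes>\<^sub>M unit_interval \<Otimes>\<^sub>M sphere_measure)"
    unfolding collision_measure_def by measurable
  note s = measurable_snd_component and f = measurable_fst_component
  have lb: "g \<in> measurable phase_collision_measure lborel \<Longrightarrow> g \<in> borel_measurable phase_collision_measure" for g :: "_ \<Rightarrow> real^3"
    by (simp cong: measurable_cong_sets)
  have sb: "g \<in> measurable phase_collision_measure sphere_measure \<Longrightarrow> g \<in> borel_measurable phase_collision_measure" for g :: "_ \<Rightarrow> real^3"
    by (simp cong: measurable_cong_sets)
  note [measurable] = p[THEN f, THEN lb] p[THEN s, THEN measurable_half_line_real] z[THEN f, THEN lb]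
    z[THEN s, THEN f, THEN measurable_half_line_real] z[THEN s, THEN s, THEN f, THEN measurable_unit_interval_real]
    z[THEN s, THEN s, THEN s, THEN f, THEN measurable_unit_interval_real]
    z[THEN s, THEN s, THEN s, THEN s, THEN sb]
  have M: "(\<lambda>x. maxwellian X i (N i) (W i) (\<tau> i) (a x) (b x)) \<in> borel_measurable phase_collision_measure"
    if "a \<in> borel_measurable phase_collision_measure" "b \<in> borel_measurable phase_collision_measure" for i a b
    using measurable_compose[OF measurable_Pair[OF that] maxwellian_measurable] by simp
  have E: "(\<lambda>x. collision_energy (fst (fst x)) (snd (fst x)) (fst (snd x)) (fst (snd (snd x)))) \<in> borel_measurable phase_collision_measure"
    unfolding collision_energy_def by measurable
  have G: "(\<lambda>x. mass_center (fst (fst x)) (fst (snd x))) \<in> borel_measurable phase_collision_measure"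
    unfolding mass_center_def by measurable
  note [measurable] = E G
  have S: "(\<lambda>x. product_speed (fst (fst x)) (snd (fst x)) (fst (snd x)) (fst (snd (snd x))) (fst (snd (snd (snd x))))) \<in> borel_measurable phase_collision_measure"
    unfolding product_speed_def by measurable
  note [measurable] = S
  show ?thesis
    unfolding backward_gain_loss_def split_beta product_v1_def product_v2_def product_I_def
    by (intro borel_measurable_diff borel_measurable_times M) measurable
qed

text \<open>The surface measure lives on the ambient space, so |\<sigma>| = 1 holds only almost
  everywhere. The energy balance needs it on the full product.\<close>

lemma AE_sphere_component: "AE x in phase_collision_measure. norm (snd (snd (snd (snd (snd x))))) = 1"
proof -
  have m: "{\<sigma> \<in> space sphere_measure. norm \<sigma> = 1} \<in> sets sphere_measure" by simp
  have 1: "AE x in unit_interval \<Otimes>\<^sub>M sphere_measure. norm (snd x) = 1"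
    by (rule AE_pair_measure_snd[OF unit_interval.sigma_finite_measure_axioms sphere.sigma_finite_measure_axioms m AE_sphere_measure])
  have m1: "{x \<in> space (unit_interval \<Otimes>\<^sub>M sphere_measure). norm (snd x) = 1} \<in> sets (unit_interval \<Otimes>\<^sub>M sphere_measure)"
    by measurable
  have 2: "AE x in unit_interval \<Otimes>\<^sub>M unit_interval \<Otimes>\<^sub>M sphere_measure. norm (snd (snd x)) = 1"
    by (rule AE_pair_measure_snd[OF unit_interval.sigma_finite_measure_axioms unit_sphere.P.sigma_finite_measure_axioms m1 1])
  have m2: "{x \<in> space (unit_interval \<Otimes>\<^sub>M unit_interval \<Otimes>\<^sub>M sphere_measure). norm (snd (snd x)) = 1}
      \<in> sets (unit_interval \<Otimes>\<^sub>M unit_interval \<Otimes>\<^sub>M sphere_measure)"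
    by measurable
  have 3: "AE x in half_line \<Otimes>\<^sub>M unit_interval \<Otimes>\<^sub>M unit_interval \<Otimes>\<^sub>M sphere_measure. norm (snd (snd (snd x))) = 1"
    by (rule AE_pair_measure_snd[OF half_line.sigma_finite_measure_axioms unit_unit_sphere.P.sigma_finite_measure_axioms m2 2])
  have m3: "{x \<in> space (half_line \<Otimes>\<^sub>M unit_interval \<Otimes>\<^sub>M unit_interval \<Otimes>\<^sub>M sphere_measure). norm (snd (snd (snd x))) = 1}
      \<in> sets (half_line \<Otimes>\<^sub>M unit_interval \<Otimes>\<^sub>M unit_interval \<Otimes>\<^sub>M sphere_measure)"
    by measurable
  have 4: "AE x in collision_measure. norm (snd (snd (snd (snd x)))) = 1"
    unfolding collision_measure_def
    by (rule AE_pair_measure_snd[OF lborel.sigma_finite_measure_axioms half_unit_unit_sphere.P.sigma_finite_measure_axioms m3 3])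
  have m4: "{x \<in> space collision_measure. norm (snd (snd (snd (snd x)))) = 1} \<in> sets collision_measure"
    unfolding collision_measure_def by measurable
  show ?thesis
    by (rule AE_pair_measure_snd[OF sigma_finite_phase_measure sigma_finite_collision_measure m4 4])
qed

lemma space_phase_collision_measure:
  assumes "x \<in> space phase_collision_measure"
  obtains v I w J R r \<sigma> where "x = ((v, I), (w, J, R, r, \<sigma>))" "I \<ge> 0" "J \<ge> 0" "R \<in> {0..1}" "r \<in> {0..1}"
  using assms by (cases x) (auto simp: phase_measure_def collision_measure_def space_pair_measure)

lemma AE_weight_nonzero:
  assumes "i \<in> {1..4}"
  shows "AE x in phase_measure. weight X i (snd x) \<noteq> 0"
  unfolding phase_measure_def
proof (rule AE_pair_measure_snd[OF lborel.sigma_finite_measure_axioms half_line.sigma_finite_measure_axioms _ weight_nonzero[OF assms]])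
  have [measurable]: "weight X i \<in> borel_measurable half_line" by (rule weight_measurable[OF assms])
  show "{I \<in> space half_line. weight X i I \<noteq> 0} \<in> sets half_line" by measurable
qed

text \<open>What remains of gain minus loss at rest and at a common temperature when the
  pre-collisional exponential is removed.\<close>

definition local_rate :: "real \<Rightarrow> (nat \<Rightarrow> real) \<Rightarrow> real" where
  "local_rate T n0 =
     (mass X 3 * mass X 4 / (mass X 1 * mass X 2)) ^ 3
       * (n0 1 / qint X 1 T * (mass X 1 / (2 * pi * kB X * T)) powr (3/2))
       * (n0 2 / qint X 2 T * (mass X 2 / (2 * pi * kB X * T)) powr (3/2)) * exp (- reaction_heat X / (kB X * T))
     - (n0 3 / qint X 3 T * (mass X 3 / (2 * pi * kB X * T)) powr (3/2))
       * (n0 4 / qint X 4 T * (mass X 4 / (2 * pi * kB X * T)) powr (3/2))"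

lemma maxwellian_at_rest:
  "T > 0 \<Longrightarrow> maxwellian X i n 0 T v I = n / qint X i T * (mass X i / (2 * pi * kB X * T)) powr (3/2)
     * exp (- (mass X i * (norm v)\<^sup>2 / 2 + I) / (kB X * T))"
  using boltzmann by (simp add: maxwellian_def field_simps)

text \<open>Products of Maxwellians at rest depend on the energies only through their sum. The sums
  for products and reactants differ by E, which leaves a common exponential and the factor
  exp(-E/(kB T)) in the gain.\<close>

lemma backward_gain_loss_equilibrium:
  assumes T: "T > 0" and x: "I \<ge> 0" "J \<ge> 0" "R \<in> {0..1}" "norm \<sigma> = 1"
  shows "backward_gain_loss (\<lambda>i. maxwellian X i (n0 i) 0 T) ((v, I), (w, J, R, r, \<sigma>))
    = local_rate T n0 * exp (- ((mass X 3 * (norm v)\<^sup>2 / 2 + I) + (mass X 4 * (norm w)\<^sup>2 / 2 + J)) / (kB X * T))"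
proof -
  let ?S = "(mass X 3 * (norm v)\<^sup>2 / 2 + I) + (mass X 4 * (norm w)\<^sup>2 / 2 + J)"
  let ?s1 = "mass X 1 * (norm (product_v1 v I w J R \<sigma>))\<^sup>2 / 2 + product_I v I w J R r"
  let ?s2 = "mass X 2 * (norm (product_v2 v I w J R \<sigma>))\<^sup>2 / 2 + product_I v I w J R (1 - r)"
  have "exp (- ?s1 / (kB X * T)) * exp (- ?s2 / (kB X * T)) = exp (- (?s1 + ?s2) / (kB X * T))"
    by (simp add: exp_add[symmetric] add_divide_distrib diff_divide_distrib)
  also have "\<dots> = exp (- reaction_heat X / (kB X * T)) * exp (- ?S / (kB X * T))"
    unfolding backward_energy_balance[OF x(1,2,3,4)]
    by (simp add: exp_add[symmetric] add_divide_distrib diff_divide_distrib)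
  finally have e: "exp (- ?s1 / (kB X * T)) * exp (- ?s2 / (kB X * T))
    = exp (- reaction_heat X / (kB X * T)) * exp (- ?S / (kB X * T))" .
  have e': "exp (- (mass X 3 * (norm v)\<^sup>2 / 2 + I) / (kB X * T)) * exp (- (mass X 4 * (norm w)\<^sup>2 / 2 + J) / (kB X * T))
      = exp (- ?S / (kB X * T))"
    by (simp add: exp_add[symmetric] add_divide_distrib diff_divide_distrib)
  have "backward_gain_loss (\<lambda>i. maxwellian X i (n0 i) 0 T) ((v, I), (w, J, R, r, \<sigma>))
    = (mass X 3 * mass X 4 / (mass X 1 * mass X 2)) ^ 3
       * (n0 1 / qint X 1 T * (mass X 1 / (2 * pi * kB X * T)) powr (3/2))
       * (n0 2 / qint X 2 T * (mass X 2 / (2 * pi * kB X * T)) powr (3/2))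
       * (exp (- ?s1 / (kB X * T)) * exp (- ?s2 / (kB X * T)))
     - (n0 3 / qint X 3 T * (mass X 3 / (2 * pi * kB X * T)) powr (3/2))
       * (n0 4 / qint X 4 T * (mass X 4 / (2 * pi * kB X * T)) powr (3/2))
       * (exp (- (mass X 3 * (norm v)\<^sup>2 / 2 + I) / (kB X * T)) * exp (- (mass X 4 * (norm w)\<^sup>2 / 2 + J) / (kB X * T)))"
    unfolding backward_gain_loss_def by (simp only: prod.case maxwellian_at_rest[OF T] mult_ac)
  then show ?thesis
    unfolding e e' local_rate_def by (simp only: left_diff_distrib right_diff_distrib mult_ac)
qed

text \<open>Collection of constants. The cube of the mass ratio multiplies normalisations whose
  ratio is its power -3/2, which leaves the power 3/2 of the claim. The exponent of 2 kB T/\<mu>,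
  with \<mu> the reduced mass of species 3 and 4, is -3/2 + (\<gamma>+2)/2 = (\<gamma>-1)/2.\<close>

lemma local_rate_integral:
  assumes T: "T > 0" and y: "norm y = 1"
  shows "local_rate T n0 * (2 / (mass X 3 * mass X 4)\<^sup>2) * integral\<^sup>L phase_collision_measure (weighted_rate T) = rate_leading X y T n0"
proof -
  have m: "mass X 1 > 0" "mass X 2 > 0" "mass X 3 > 0" "mass X 4 > 0" using masses by auto
  define \<theta> where "\<theta> = 2 * kB X * T"
  have th: "\<theta> > 0" using T boltzmann by (simp add: \<theta>_def)
  define \<mu> where "\<mu> = red_mass X 3 4"
  have mu: "\<mu> > 0" using m by (simp add: \<mu>_def red_mass_def)
  have M: "total_mass X = mass X 3 + mass X 4" using mass_balance by (simp add: total_mass_def)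
  define A where "A = mass X 3 * mass X 4 / (mass X 1 * mass X 2)"
  have A: "A > 0" using m by (simp add: A_def)
  define P where "P i = (mass X i / (2 * pi * kB X * T)) powr (3/2)" for i
  have Pth: "P i = (mass X i / (pi * \<theta>)) powr (3/2)" for i by (simp add: P_def \<theta>_def mult_ac)
  have "A ^ 3 = A powr (3/2) * A powr (3/2)"
    using A by (simp add: powr_add[symmetric])
  moreover have "A powr (3/2) * (P 1 * P 2) = P 3 * P 4"
    unfolding Pth using A m th by (simp add: powr_mult[symmetric] A_def)
  ultimately have P12: "A ^ 3 * (P 1 * P 2) = A powr (3/2) * (P 3 * P 4)" by (metis mult.assoc)
  \<comment> \<open>The origin of 4/sqrt pi: pi^(-3) from the two normalisations, pi^(3/2) from the
    centre-of-mass Gaussian, 2 pi from the radial density and 2 from the collision operator.\<close>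
  have V: "P 3 * P 4 * ((pi * \<theta> / total_mass X) powr (3/2) * (2 * pi * (\<theta> / \<mu>) powr ((expo X + 2) / 2))) * 2
      = 4 / sqrt pi * (\<theta> / \<mu>) powr ((expo X - 1) / 2)"
  proof -
    have "P 3 * P 4 * (pi * \<theta> / total_mass X) powr (3/2)
        = ((mass X 3 / (pi * \<theta>)) * (mass X 4 / (pi * \<theta>)) * (pi * \<theta> / total_mass X)) powr (3/2)"
      unfolding Pth by (simp only: powr_mult)
    also have "(mass X 3 / (pi * \<theta>)) * (mass X 4 / (pi * \<theta>)) * (pi * \<theta> / total_mass X) = inverse pi * inverse (\<theta> / \<mu>)"
    proof -
      have "total_mass X > 0" using m M by simp
      then show ?thesis using m th by (simp add: M[symmetric] \<mu>_def red_mass_def field_simps)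
    qed
    also have "(inverse pi * inverse (\<theta> / \<mu>)) powr (3/2) = inverse (pi powr (3/2)) * (\<theta> / \<mu>) powr (- (3/2))"
      using th mu by (simp only: powr_mult powr_minus inverse_powr)
    finally have a: "P 3 * P 4 * (pi * \<theta> / total_mass X) powr (3/2) = inverse (pi powr (3/2)) * (\<theta> / \<mu>) powr (- (3/2))" .
    have b: "(\<theta> / \<mu>) powr (- (3/2)) * (\<theta> / \<mu>) powr ((expo X + 2) / 2) = (\<theta> / \<mu>) powr ((expo X - 1) / 2)"
    proof -
      have "- (3/2) + (expo X + 2) / 2 = (expo X - 1) / 2" by (simp add: add_divide_distrib diff_divide_distrib)
      then show ?thesis by (simp only: powr_add[symmetric])
    qed
    have c: "pi powr (3/2) = pi * sqrt pi" using powr_add[of pi 1 "1/2"] by (simp add: powr_half_sqrt)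
    have "P 3 * P 4 * ((pi * \<theta> / total_mass X) powr (3/2) * (2 * pi * (\<theta> / \<mu>) powr ((expo X + 2) / 2))) * 2
        = (P 3 * P 4 * (pi * \<theta> / total_mass X) powr (3/2)) * (\<theta> / \<mu>) powr ((expo X + 2) / 2) * (4 * pi)"
      by (simp only: mult_ac)
    also have "\<dots> = inverse (pi powr (3/2)) * (4 * pi) * ((\<theta> / \<mu>) powr (- (3/2)) * (\<theta> / \<mu>) powr ((expo X + 2) / 2))"
      unfolding a by (simp only: mult_ac)
    also have "\<dots> = 4 / sqrt pi * (\<theta> / \<mu>) powr ((expo X - 1) / 2)"
      unfolding b c by (simp add: field_simps)
    finally show ?thesis .
  qed
  define RI where "RI = (LINT p|rate_measure. rate_integrand X y T p)"
  define B where "B = A powr (3/2) * (n0 1 * n0 2 / (qint X 1 T * qint X 2 T)) * exp (- reaction_heat X / (kB X * T))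
        - n0 3 * n0 4 / (qint X 3 T * qint X 4 T)"
  have lr: "local_rate T n0 = B * (P 3 * P 4)"
  proof -
    have "local_rate T n0 = (A ^ 3 * (P 1 * P 2)) * (n0 1 * n0 2 / (qint X 1 T * qint X 2 T)) * exp (- reaction_heat X / (kB X * T))
        - n0 3 * n0 4 / (qint X 3 T * qint X 4 T) * (P 3 * P 4)"
      unfolding local_rate_def A_def[symmetric] P_def[symmetric] by (simp add: mult_ac)
    then show ?thesis unfolding P12 B_def by (simp only: left_diff_distrib right_diff_distrib mult_ac)
  qed
  have W: "integral\<^sup>L phase_collision_measure (weighted_rate T) = (pi * \<theta> / total_mass X) powr (3/2)
      * (2 * pi * (\<theta> / \<mu>) powr ((expo X + 2) / 2) * Gamma ((expo X + 2) / 2)) * RI"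
    using has_bochner_integral_weighted_rate[OF assms]
    by (simp add: has_bochner_integral_iff \<theta>_def \<mu>_def RI_def mult_ac)
  have "local_rate T n0 * (2 / (mass X 3 * mass X 4)\<^sup>2) * integral\<^sup>L phase_collision_measure (weighted_rate T)
      = B / (mass X 3 * mass X 4)\<^sup>2 * (P 3 * P 4 * ((pi * \<theta> / total_mass X) powr (3/2) * (2 * pi * (\<theta> / \<mu>) powr ((expo X + 2) / 2))) * 2)
        * Gamma ((expo X + 2) / 2) * RI"
    unfolding lr W by simp
  also have "\<dots> = B * (4 / (sqrt pi * (mass X 3 * mass X 4)\<^sup>2)) * (\<theta> / \<mu>) powr ((expo X - 1) / 2)
        * Gamma ((expo X + 2) / 2) * RI"
    unfolding V by (simp add: mult_ac)
  also have "\<dots> = rate_leading X y T n0"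
    unfolding rate_leading_def B_def A_def RI_def \<theta>_def \<mu>_def by (rule refl)
  finally show ?thesis .
qed

text \<open>The internal energies of the products are nonnegative, so agreement for
  \<open>I \<ge> 0\<close>, where the solutions are known to be Maxwellian, is enough.\<close>

lemma backward_gain_loss_cong:
  assumes f: "\<And>i v I. i \<in> {1..4} \<Longrightarrow> I \<ge> 0 \<Longrightarrow> f i v I = g i v I"
    and x: "I \<ge> 0" "J \<ge> 0" "R \<in> {0..1}" "r \<in> {0..1}"
  shows "backward_gain_loss f ((v, I), (w, J, R, r, \<sigma>)) = backward_gain_loss g ((v, I), (w, J, R, r, \<sigma>))"
  using x product_I_nonneg[OF x(1-3), of r v w] product_I_nonneg[OF x(1-3), of "1 - r" v w]
  by (simp add: backward_gain_loss_def f)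

text \<open>The products carry the pre-collisional energy plus E, and E \<ge> 0 can only decrease
  the exponential. Hence one function of the integration variables bounds both terms, although the
  gain is evaluated at transformed arguments.\<close>

lemma backward_gain_loss_bound:
  assumes \<theta>: "\<theta> > 0" and C: "\<And>i. i \<in> {1..4} \<Longrightarrow> C i \<ge> 0"
    and f: "\<And>i v I. i \<in> {1..4} \<Longrightarrow> I \<ge> 0 \<Longrightarrow> \<bar>f i v I\<bar> \<le> C i * exp (- (mass X i * (norm v)\<^sup>2 / 2 + I) / \<theta>)"
    and x: "I \<ge> 0" "J \<ge> 0" "R \<in> {0..1}" "r \<in> {0..1}" "norm \<sigma> = 1"
  shows "\<bar>backward_gain_loss f ((v, I), (w, J, R, r, \<sigma>))\<bar>
    \<le> ((mass X 3 * mass X 4 / (mass X 1 * mass X 2)) ^ 3 * C 1 * C 2 + C 3 * C 4)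
      * exp (- ((mass X 3 * (norm v)\<^sup>2 / 2 + I) + (mass X 4 * (norm w)\<^sup>2 / 2 + J)) / \<theta>)"
proof -
  let ?S = "(mass X 3 * (norm v)\<^sup>2 / 2 + I) + (mass X 4 * (norm w)\<^sup>2 / 2 + J)"
  let ?s1 = "mass X 1 * (norm (product_v1 v I w J R \<sigma>))\<^sup>2 / 2 + product_I v I w J R r"
  let ?s2 = "mass X 2 * (norm (product_v2 v I w J R \<sigma>))\<^sup>2 / 2 + product_I v I w J R (1 - r)"
  define A where "A = (mass X 3 * mass X 4 / (mass X 1 * mass X 2)) ^ 3"
  have A: "A \<ge> 0" using masses[of 1] masses[of 2] masses[of 3] masses[of 4] by (simp add: A_def)
  have I: "product_I v I w J R r \<ge> 0" "product_I v I w J R (1 - r) \<ge> 0" using x by (auto intro!: product_I_nonneg)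
  have "\<bar>f 1 (product_v1 v I w J R \<sigma>) (product_I v I w J R r)\<bar> * \<bar>f 2 (product_v2 v I w J R \<sigma>) (product_I v I w J R (1 - r))\<bar>
      \<le> (C 1 * exp (- ?s1 / \<theta>)) * (C 2 * exp (- ?s2 / \<theta>))"
    using I C[of 1] by (intro mult_mono f) auto
  also have "\<dots> = C 1 * C 2 * exp (- (?s1 + ?s2) / \<theta>)"
    by (simp add: exp_add[symmetric] add_divide_distrib diff_divide_distrib)
  also have "\<dots> \<le> C 1 * C 2 * exp (- ?S / \<theta>)"
  proof (rule mult_left_mono)
    show "exp (- (?s1 + ?s2) / \<theta>) \<le> exp (- ?S / \<theta>)"
      unfolding backward_energy_balance[OF x(1,2,3,5)] exp_le_cancel_iff
      using heat \<theta> by (intro divide_right_mono) auto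
  qed (use C in simp)
  finally have g: "A * (\<bar>f 1 (product_v1 v I w J R \<sigma>) (product_I v I w J R r)\<bar>
        * \<bar>f 2 (product_v2 v I w J R \<sigma>) (product_I v I w J R (1 - r))\<bar>) \<le> A * (C 1 * C 2 * exp (- ?S / \<theta>))"
    using A by (rule mult_left_mono)
  have "\<bar>f 3 v I\<bar> * \<bar>f 4 w J\<bar> \<le> (C 3 * exp (- (mass X 3 * (norm v)\<^sup>2 / 2 + I) / \<theta>)) * (C 4 * exp (- (mass X 4 * (norm w)\<^sup>2 / 2 + J) / \<theta>))"
    using x C[of 3] by (intro mult_mono f) auto
  also have "\<dots> = C 3 * C 4 * exp (- ?S / \<theta>)"
    by (simp add: exp_add[symmetric] add_divide_distrib diff_divide_distrib)
  finally have l: "\<bar>f 3 v I\<bar> * \<bar>f 4 w J\<bar> \<le> C 3 * C 4 * exp (- ?S / \<theta>)" .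
  have "\<bar>backward_gain_loss f ((v, I), (w, J, R, r, \<sigma>))\<bar>
      \<le> A * (\<bar>f 1 (product_v1 v I w J R \<sigma>) (product_I v I w J R r)\<bar>
        * \<bar>f 2 (product_v2 v I w J R \<sigma>) (product_I v I w J R (1 - r))\<bar>) + \<bar>f 3 v I\<bar> * \<bar>f 4 w J\<bar>"
    unfolding backward_gain_loss_def prod.case A_def[symmetric]
    by (rule order_trans[OF abs_triangle_ineq4]) (simp add: abs_mult A)
  also have "\<dots> \<le> A * (C 1 * C 2 * exp (- ?S / \<theta>)) + C 3 * C 4 * exp (- ?S / \<theta>)"
    using g l by (rule add_mono)
  finally show ?thesis by (simp add: A_def algebra_simps)
qed

text \<open>The limit is taken on the product of phase and collision variables, where the integrand
  is explicit; Fubini then returns to the iterated integral that defines the moment of the operator.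
  The value does not depend on the unit vector \<open>y\<close>.\<close>

lemma reactive_moment_tendsto:
  fixes f :: "real \<Rightarrow> nat \<Rightarrow> real^3 \<Rightarrow> real \<Rightarrow> real"
  assumes T: "T > 0" and y: "norm y = 1"
    and lim: "\<And>i. i \<in> {1..4} \<Longrightarrow> ((\<lambda>\<epsilon>. N i \<epsilon>) \<longlongrightarrow> n0 i) (at_right (0::real))"
      "\<And>i. i \<in> {1..4} \<Longrightarrow> ((\<lambda>\<epsilon>. W i \<epsilon>) \<longlongrightarrow> 0) (at_right 0)"
      "\<And>i. i \<in> {1..4} \<Longrightarrow> ((\<lambda>\<epsilon>. \<tau> i \<epsilon>) \<longlongrightarrow> T) (at_right 0)"
    and f: "\<forall>\<^sub>F \<epsilon> in at_right 0. \<forall>i\<in>{1..4}. \<forall>v I. I \<ge> 0 \<longrightarrow> f \<epsilon> i v I = maxwellian X i (N i \<epsilon>) (W i \<epsilon>) (\<tau> i \<epsilon>) v I"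
    and conv: "\<forall>\<^sub>F \<epsilon> in at_right 0. moment_converges (\<lambda>v I. Qreact X 3 (f \<epsilon>) v I * weight X 3 I)"
  shows "((\<lambda>\<epsilon>. moment (\<lambda>v I. Qreact X 3 (f \<epsilon>) v I * weight X 3 I)) \<longlongrightarrow> rate_leading X y T n0) (at_right 0)"
proof -
  define g where "g \<epsilon> = (\<lambda>i. maxwellian X i (N i \<epsilon>) (W i \<epsilon>) (\<tau> i \<epsilon>))" for \<epsilon>
  define F where "F \<epsilon> x = backward_integrand (g \<epsilon>) x" for \<epsilon> x
  define T4 where "T4 = 4 * T"
  define \<theta> where "\<theta> = kB X * T4"
  have T4: "T4 > 0" and \<theta>: "\<theta> > 0" using T boltzmann by (simp_all add: T4_def \<theta>_def)
  define q where "q = 2 / (mass X 3 * mass X 4)\<^sup>2"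
  have q: "q \<ge> 0" by (simp add: q_def)
  have "\<forall>i\<in>{1..4}. \<exists>C. C \<ge> 0 \<and> (\<forall>\<^sub>F \<epsilon> in at_right 0. \<forall>v I. I \<ge> 0 \<longrightarrow> \<bar>g \<epsilon> i v I\<bar>
       \<le> C * exp (- (mass X i * (norm v)\<^sup>2 / 2 + I) / \<theta>))"
  proof
    fix i :: nat assume i: "i \<in> {1..4}"
    show "\<exists>C. C \<ge> 0 \<and> (\<forall>\<^sub>F \<epsilon> in at_right 0. \<forall>v I. I \<ge> 0 \<longrightarrow> \<bar>g \<epsilon> i v I\<bar>
       \<le> C * exp (- (mass X i * (norm v)\<^sup>2 / 2 + I) / \<theta>))"
      by (rule maxwellian_eventually_bounded[OF i T lim(1,2,3)[OF i]]) (auto simp: g_def \<theta>_def T4_def)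
  qed
  from bchoice[OF this] obtain C where "\<forall>i\<in>{1..4}. C i \<ge> 0 \<and> (\<forall>\<^sub>F \<epsilon> in at_right 0. \<forall>v I. I \<ge> 0 \<longrightarrow> \<bar>g \<epsilon> i v I\<bar>
       \<le> C i * exp (- (mass X i * (norm v)\<^sup>2 / 2 + I) / \<theta>))" ..
  then have C: "\<And>i. i \<in> {1..4} \<Longrightarrow> C i \<ge> 0"
    and Cb: "\<And>i. i \<in> {1..4} \<Longrightarrow> \<forall>\<^sub>F \<epsilon> in at_right 0. \<forall>v I. I \<ge> 0 \<longrightarrow> \<bar>g \<epsilon> i v I\<bar>
       \<le> C i * exp (- (mass X i * (norm v)\<^sup>2 / 2 + I) / \<theta>)"
    by blast+
  have Call: "\<forall>\<^sub>F \<epsilon> in at_right 0. \<forall>i\<in>{1..4}. \<forall>v I. I \<ge> 0 \<longrightarrow> \<bar>g \<epsilon> i v I\<bar>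
       \<le> C i * exp (- (mass X i * (norm v)\<^sup>2 / 2 + I) / \<theta>)"
    using Cb by (intro eventually_ball_finite) auto
  define K where "K = (mass X 3 * mass X 4 / (mass X 1 * mass X 2)) ^ 3 * C 1 * C 2 + C 3 * C 4"
  have Fm: "F \<epsilon> \<in> borel_measurable phase_collision_measure" for \<epsilon>
  proof -
    have [measurable]: "backward_gain_loss (g \<epsilon>) \<in> borel_measurable phase_collision_measure"
      unfolding g_def by (rule backward_gain_loss_measurable)
    have [measurable]: "weighted_rate T \<in> borel_measurable phase_collision_measure"
      using has_bochner_integral_weighted_rate[OF T y] by (auto simp: has_bochner_integral_iff)
    have p: "(\<lambda>x. fst x) \<in> measurable phase_collision_measure (lborel \<Otimes>\<^sub>M half_line)"
      unfolding phase_measure_def by measurable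
    have z: "(\<lambda>x. snd x) \<in> measurable phase_collision_measure
        (lborel \<Otimes>\<^sub>M half_line \<Otimes>\<^sub>M unit_interval \<Otimes>\<^sub>M unit_interval \<Otimes>\<^sub>M sphere_measure)"
      unfolding collision_measure_def by measurable
    note s = measurable_snd_component and f = measurable_fst_component
    have lb: "h \<in> measurable phase_collision_measure lborel \<Longrightarrow> h \<in> borel_measurable phase_collision_measure" for h :: "_ \<Rightarrow> real^3"
      by (simp cong: measurable_cong_sets)
    note [measurable] = p[THEN f, THEN lb] p[THEN s, THEN measurable_half_line_real] z[THEN f, THEN lb]
      z[THEN s, THEN f, THEN measurable_half_line_real]
    have "F \<epsilon> = (\<lambda>x. backward_gain_loss (g \<epsilon>) x * q
        * exp (((mass X 3 * (norm (fst (fst x)))\<^sup>2 / 2 + snd (fst x))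
            + (mass X 4 * (norm (fst (snd x)))\<^sup>2 / 2 + fst (snd (snd x)))) / (kB X * T)) * weighted_rate T x)"
      by (auto simp: fun_eq_iff F_def backward_integrand_eq[OF T] q_def)
    then show ?thesis by simp
  qed
  have AEx: "AE x in phase_collision_measure. \<exists>v I w J R r \<sigma>. x = ((v, I), (w, J, R, r, \<sigma>)) \<and> I \<ge> 0 \<and> J \<ge> 0 \<and> R \<in> {0..1} \<and> r \<in> {0..1} \<and> norm \<sigma> = 1"
    using AE_sphere_component AE_space
  proof eventually_elim
    case (elim x)
    from elim(2) show ?case by (rule space_phase_collision_measure) (use elim(1) in auto)
  qed
  have bnd: "\<forall>\<^sub>F \<epsilon> in at_right 0. AE x in phase_collision_measure. norm (F \<epsilon> x) \<le> norm (K * q * weighted_rate T4 x)"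
    using Call
  proof eventually_elim
    case (elim \<epsilon>)
    note bound = elim
    show ?case
      using AEx
    proof eventually_elim
      case (elim x)
      then obtain v I w J R r \<sigma> where x: "x = ((v, I), (w, J, R, r, \<sigma>))"
        and I: "I \<ge> 0" "J \<ge> 0" "R \<in> {0..1}" "r \<in> {0..1}" "norm \<sigma> = 1" by blast
      let ?S = "(mass X 3 * (norm v)\<^sup>2 / 2 + I) + (mass X 4 * (norm w)\<^sup>2 / 2 + J)"
      have "\<bar>backward_gain_loss (g \<epsilon>) x\<bar> \<le> K * exp (- ?S / \<theta>)"
        unfolding x K_def by (rule backward_gain_loss_bound[OF \<theta> C _ I]) (use bound in auto)
      then have "\<bar>backward_gain_loss (g \<epsilon>) x\<bar> * (q * exp (?S / \<theta>) * \<bar>weighted_rate T4 x\<bar>)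
          \<le> K * exp (- ?S / \<theta>) * (q * exp (?S / \<theta>) * \<bar>weighted_rate T4 x\<bar>)"
        using q by (intro mult_right_mono) auto
      also have "\<dots> = K * q * \<bar>weighted_rate T4 x\<bar> * (exp (- ?S / \<theta>) * exp (?S / \<theta>))"
        by (simp only: mult_ac)
      also have "exp (- ?S / \<theta>) * exp (?S / \<theta>) = 1" by (rule exp_minus_divide_mult)
      finally have *: "\<bar>backward_gain_loss (g \<epsilon>) x\<bar> * (q * exp (?S / \<theta>) * \<bar>weighted_rate T4 x\<bar>) \<le> K * q * \<bar>weighted_rate T4 x\<bar>"
        by simp
      \<comment> \<open>Representing the integrand at \<open>T4\<close> introduces exactly the
        inverse of the exponential that bounds gain and loss.\<close>
      have "norm (F \<epsilon> x) = \<bar>backward_gain_loss (g \<epsilon>) x\<bar> * (q * exp (?S / \<theta>) * \<bar>weighted_rate T4 x\<bar>)"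
        unfolding F_def x backward_integrand_eq[OF T4] q_def[symmetric] \<theta>_def[symmetric] using q by (simp add: abs_mult)
      also note *
      also have "K * q * \<bar>weighted_rate T4 x\<bar> \<le> norm (K * q * weighted_rate T4 x)"
        unfolding real_norm_def abs_mult[of "K * q"] by (intro mult_right_mono) auto
      finally show ?case .
    qed
  qed
  have Wi: "integrable phase_collision_measure (\<lambda>x. norm (K * q * weighted_rate T4 x))"
    using has_bochner_integral_weighted_rate[OF T4 y] by (auto simp: has_bochner_integral_iff)
  have Wi0: "integrable phase_collision_measure (weighted_rate T)"
    using has_bochner_integral_weighted_rate[OF T y] by (auto simp: has_bochner_integral_iff)
  have "((\<lambda>\<epsilon>. integral\<^sup>L phase_collision_measure (F \<epsilon>)) \<longlongrightarrow> integral\<^sup>L phase_collision_measure (\<lambda>x. local_rate T n0 * q * weighted_rate T x)) (at_right 0)"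
  proof (rule dominated_convergence_at_within[OF _ _ Wi _ bnd])
    \<comment> \<open>For the pointwise limit the same integrand is represented at T, where the
      exponential cancels against that of the equilibrium gain and loss.\<close>
    show "AE x in phase_collision_measure. ((\<lambda>\<epsilon>. F \<epsilon> x) \<longlongrightarrow> local_rate T n0 * q * weighted_rate T x) (at_right 0)"
      using AEx
    proof eventually_elim
      case (elim x)
      then obtain v I w J R r \<sigma> where x: "x = ((v, I), (w, J, R, r, \<sigma>))"
        and I: "I \<ge> 0" "J \<ge> 0" "R \<in> {0..1}" "r \<in> {0..1}" "norm \<sigma> = 1" by blast
      let ?S = "(mass X 3 * (norm v)\<^sup>2 / 2 + I) + (mass X 4 * (norm w)\<^sup>2 / 2 + J)"
      have gl: "((\<lambda>\<epsilon>. g \<epsilon> i v' I') \<longlongrightarrow> maxwellian X i (n0 i) 0 T v' I') (at_right 0)" if "i \<in> {1..4}" for i v' I'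
        unfolding g_def using that by (intro maxwellian_tendsto T lim)
      have "((\<lambda>\<epsilon>. backward_gain_loss (g \<epsilon>) x) \<longlongrightarrow> backward_gain_loss (\<lambda>i. maxwellian X i (n0 i) 0 T) x) (at_right 0)"
        unfolding backward_gain_loss_def x prod.case by (intro tendsto_intros gl) auto
      then have "((\<lambda>\<epsilon>. backward_gain_loss (g \<epsilon>) x * q * exp (?S / (kB X * T)) * weighted_rate T x)
          \<longlongrightarrow> local_rate T n0 * exp (- ?S / (kB X * T)) * q * exp (?S / (kB X * T)) * weighted_rate T x) (at_right 0)"
        unfolding x backward_gain_loss_equilibrium[OF T I(1,2,3,5)] by (intro tendsto_intros)
      also have "local_rate T n0 * exp (- ?S / (kB X * T)) * q * exp (?S / (kB X * T)) * weighted_rate T x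
          = local_rate T n0 * q * weighted_rate T x * (exp (- ?S / (kB X * T)) * exp (?S / (kB X * T)))"
        by (simp only: mult_ac)
      also have "exp (- ?S / (kB X * T)) * exp (?S / (kB X * T)) = 1"
        by (rule exp_minus_divide_mult)
      finally show ?case
        unfolding F_def x backward_integrand_eq[OF T] q_def by simp
    qed
  qed (use Fm Wi0 in auto)
  moreover have "integral\<^sup>L phase_collision_measure (\<lambda>x. local_rate T n0 * q * weighted_rate T x) = rate_leading X y T n0"
    using local_rate_integral[OF T y, of n0] by (simp add: q_def)
  moreover have "\<forall>\<^sub>F \<epsilon> in at_right 0. integral\<^sup>L phase_collision_measure (F \<epsilon>) = moment (\<lambda>v I. Qreact X 3 (f \<epsilon>) v I * weight X 3 I)"
    using f conv bnd
  proof eventually_elim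
    case (elim \<epsilon>)
    note f_eq = elim(1)
    have Fi: "integrable phase_collision_measure (F \<epsilon>)"
      by (rule Bochner_Integration.integrable_bound[OF Wi Fm]) (use elim(3) in auto)
    have "integral\<^sup>L phase_collision_measure (F \<epsilon>) = (LINT p|phase_measure. LINT z|collision_measure. F \<epsilon> (p, z))"
      by (rule phase_collision.integral_fst'[OF Fi, symmetric])
    also have "\<dots> = (LINT p|phase_measure. (case p of (v, I) \<Rightarrow> Qreact X 3 (f \<epsilon>) v I * weight X 3 I))"
    \<comment> \<open>The operator and the iterated integral agree where the weight of species 3 is
      nonzero, hence almost everywhere. Measurability on the side of the operator is supplied by
      \<open>conv\<close>.\<close>
    proof (rule integral_cong_AE)
      show "(\<lambda>p. LINT z|collision_measure. F \<epsilon> (p, z)) \<in> borel_measurable phase_measure"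
        using phase_collision.integrable_fst'[OF Fi] by auto
      show "(\<lambda>p. case p of (v, I) \<Rightarrow> Qreact X 3 (f \<epsilon>) v I * weight X 3 I) \<in> borel_measurable phase_measure"
        using elim(2) by (auto simp: moment_converges_def)
      have "AE p in phase_measure. weight X 3 (snd p) \<noteq> 0" by (rule AE_weight_nonzero) simp
      then show "AE p in phase_measure. (LINT z|collision_measure. F \<epsilon> (p, z)) = (case p of (v, I) \<Rightarrow> Qreact X 3 (f \<epsilon>) v I * weight X 3 I)"
        using AE_space
      proof eventually_elim
        case (elim p)
        obtain v I where p: "p = (v, I)" by force
        have I: "I \<ge> 0" using elim(2) by (auto simp: p phase_measure_def space_pair_measure)
        have "(LINT z|collision_measure. F \<epsilon> (p, z)) = (LINT z|collision_measure. backward_integrand (f \<epsilon>) (p, z))"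
        proof (intro Bochner_Integration.integral_cong refl)
          fix z assume "z \<in> space collision_measure"
          then obtain w J R r \<sigma> where z: "z = (w, J, R, r, \<sigma>)" "J \<ge> 0" "R \<in> {0..1}" "r \<in> {0..1}"
            by (cases z) (auto simp: collision_measure_def space_pair_measure)
          show "F \<epsilon> (p, z) = backward_integrand (f \<epsilon>) (p, z)"
            unfolding F_def p z(1) backward_integrand_eq[OF T]
            using backward_gain_loss_cong[OF _ I z(2-4), of "g \<epsilon>" "f \<epsilon>"] f_eq
            by (auto simp: g_def)
        qed
        also have "\<dots> = Qreact X 3 (f \<epsilon>) v I * weight X 3 I"
          unfolding p using Qreact_3_weighted elim(1) by (simp add: p)
        finally show ?case by (simp add: p)
      qed
    qed
    finally show ?case by (simp add: moment_def)
  qed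
  ultimately show ?thesis using Lim_transform_eventually by fastforce
qed

end

section \<open>Energy balance\<close>

context reacting_mixture
begin

definition qratio :: "nat \<Rightarrow> nat \<Rightarrow> real \<Rightarrow> real" where
  "qratio j i T = qmom j i T / qmom 0 i T"

text \<open>The temperature derivative of q*/q, in the form of a variance of I over kB T^2.\<close>

definition heat_slope :: "nat \<Rightarrow> real \<Rightarrow> real" where
  "heat_slope i T = (qratio 2 i T - (qratio 1 i T)\<^sup>2) / (kB X * T\<^sup>2)"

text \<open>The first formula of \<open>dmaxwellian_energy_moments\<close> as a function of the
  fields and their increments, so that the scaled balance and its limit are values of one
  expression.\<close>

definition energy_rate :: "nat \<Rightarrow> real \<Rightarrow> real^3 \<Rightarrow> real \<Rightarrow> real \<Rightarrow> real^3 \<Rightarrow> real \<Rightarrow> real" where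
  "energy_rate i n u T dn du dT = dn * (3/2 * kB X * T + qratio 1 i T + mass X i * (norm u)\<^sup>2 / 2)
     + n * dT * (3/2 * kB X + heat_slope i T) + n * mass X i * (u \<bullet> du)"

text \<open>The factor \<open>\<kappa>\<close> is the weight of the macroscopic kinetic energy: it is \<open>\<epsilon>\<^sup>2\<close> for the scaled velocity
  \<open>\<epsilon> u\<close>, and \<open>0\<close> in the limit.\<close>

definition flux_rate :: "nat \<Rightarrow> real \<Rightarrow> real^3 \<Rightarrow> real \<Rightarrow> real^3 \<Rightarrow> real \<Rightarrow> real \<Rightarrow> real^3 \<Rightarrow> real \<Rightarrow> real" where
  "flux_rate i \<kappa> p n u T dn du dT =
     (dn * (u \<bullet> p) + n * (du \<bullet> p)) * (5/2 * kB X * T + qratio 1 i T + \<kappa> * (mass X i * (norm u)\<^sup>2 / 2))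
     + n * dT * (u \<bullet> p) * (5/2 * kB X + heat_slope i T) + \<kappa> * (n * mass X i * (u \<bullet> p) * (u \<bullet> du))"

lemma qratio_tendsto:
  assumes "i \<in> {1..4}" "(g \<longlongrightarrow> T) F" "T > 0"
  shows "((\<lambda>e. qratio j i (g e)) \<longlongrightarrow> qratio j i T) F"
  unfolding qratio_def using qmom_0_pos[OF assms(1,3)]
  by (intro tendsto_divide qmom_tendsto assms) simp

lemma heat_slope_tendsto:
  assumes "i \<in> {1..4}" "(g \<longlongrightarrow> T) F" "T > 0"
  shows "((\<lambda>e. heat_slope i (g e)) \<longlongrightarrow> heat_slope i T) F"
  unfolding heat_slope_def using boltzmann assms(3)
  by (intro tendsto_intros qratio_tendsto assms) simp

lemma qratio_has_derivative:
  assumes i: "i \<in> {1..4}" and T: "T > 0"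
  shows "(qratio 1 i has_real_derivative heat_slope i T) (at T)"
proof -
  have q0: "qmom 0 i T \<noteq> 0" using qmom_0_pos[OF assms] by simp
  have "(qratio 1 i has_real_derivative
     (qmom 2 i T / (kB X * T\<^sup>2) * qmom 0 i T - qmom 1 i T * (qmom 1 i T / (kB X * T\<^sup>2))) / (qmom 0 i T * qmom 0 i T)) (at T)"
    unfolding qratio_def[abs_def]
    using DERIV_divide[OF qmom_has_derivative[OF i T, of 1] qmom_has_derivative[OF i T, of 0] q0]
    by (simp add: numeral_2_eq_2)
  moreover have "(qmom 2 i T / (kB X * T\<^sup>2) * qmom 0 i T - qmom 1 i T * (qmom 1 i T / (kB X * T\<^sup>2))) / (qmom 0 i T * qmom 0 i T)
      = heat_slope i T"
    using q0 boltzmann T by (simp add: heat_slope_def qratio_def field_simps power2_eq_square)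
  ultimately show ?thesis by simp
qed

text \<open>The derivative is cast as \<open>energy_rate\<close> at zero velocity, the form in which
  the moment of the kinetic equation arrives in the limit.\<close>

lemma energy_density_has_derivative:
  assumes T: "T t > 0" and dT: "(T has_real_derivative T') (at t)"
    and dn: "\<And>i. i \<in> {1..4} \<Longrightarrow> (n i has_real_derivative n' i) (at t)"
  shows "((\<lambda>s. energy_density X (\<lambda>i. n i s) (T s)) has_real_derivative
    (\<Sum>i=1..4. energy_rate i (n i t) 0 (T t) (n' i) 0 T')) (at t)"
  unfolding energy_density_def qint_eq_qmom qstar_eq_qmom qratio_def[symmetric]
proof (rule DERIV_sum)
  fix i :: nat assume i: "i \<in> {1..4}"
  have q: "((\<lambda>s. qratio 1 i (T s)) has_real_derivative heat_slope i (T t) * T') (at t)"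
    by (rule DERIV_chain2[OF qratio_has_derivative[OF i T] dT])
  show "((\<lambda>s. 3/2 * n i s * kB X * T s + n i s * qratio 1 i (T s)) has_real_derivative
      energy_rate i (n i t) 0 (T t) (n' i) 0 T') (at t)"
    by (rule derivative_eq_intros dn[OF i] dT q refl)+ (simp add: energy_rate_def algebra_simps)
qed

text \<open>For \<kappa> = 0 the flux rate is the product rule for n u (5/2 kB T + q*/q) contracted
  with one axis; summing over the axes gives the divergence.\<close>

lemma energy_flux_has_derivative:
  fixes u :: "nat \<Rightarrow> real^3 \<Rightarrow> real^3"
  assumes T: "T x > 0" and dT: "(T has_derivative T') (at x)"
    and dn: "\<And>i. i \<in> {1..4} \<Longrightarrow> (n i has_derivative n' i) (at x)"
    and du: "\<And>i. i \<in> {1..4} \<Longrightarrow> (u i has_derivative u' i) (at x)"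
  shows "(\<lambda>z. energy_flux X (\<lambda>i. n i z) (\<lambda>i. u i z) (T z)) differentiable at x"
    and "divergence (\<lambda>z. energy_flux X (\<lambda>i. n i z) (\<lambda>i. u i z) (T z)) x
      = (\<Sum>i=1..4. \<Sum>k\<in>UNIV. flux_rate i 0 (axis k 1) (n i x) (u i x) (T x) (n' i (axis k 1)) (u' i (axis k 1)) (T' (axis k 1)))"
proof -
  let ?D = "\<lambda>h. \<Sum>i=1..4. (n i x * (5/2 * kB X * T x + qratio 1 i (T x))) *\<^sub>R u' i h
      + (n i x * ((5/2 * kB X + heat_slope i (T x)) * T' h) + n' i h * (5/2 * kB X * T x + qratio 1 i (T x))) *\<^sub>R u i x"
  have eq: "energy_flux X (\<lambda>i. n i z) (\<lambda>i. u i z) (T z)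
      = (\<Sum>i=1..4. (n i z * (5/2 * kB X * T z + qratio 1 i (T z))) *\<^sub>R u i z)" for z
    unfolding energy_flux_def qint_eq_qmom qstar_eq_qmom qratio_def[symmetric] scaleR_left_distrib[symmetric]
    by (intro sum.cong refl arg_cong2[where f = scaleR]) (simp add: distrib_left)
  have D: "((\<lambda>z. energy_flux X (\<lambda>i. n i z) (\<lambda>i. u i z) (T z)) has_derivative ?D) (at x)"
    unfolding eq
  proof (rule has_derivative_sum)
    fix i :: nat assume i: "i \<in> {1..4}"
    have q: "((\<lambda>z. qratio 1 i (T z)) has_derivative (\<lambda>h. T' h * heat_slope i (T x))) (at x)"
      by (rule DERIV_compose_FDERIV[OF qratio_has_derivative[OF i T] dT])
    have "((\<lambda>z. 5/2 * kB X * T z + qratio 1 i (T z)) has_derivative (\<lambda>h. (5/2 * kB X + heat_slope i (T x)) * T' h)) (at x)"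
      by (rule has_derivative_eq_rhs[OF has_derivative_add[OF has_derivative_mult_right[OF dT] q]])
         (simp add: fun_eq_iff algebra_simps)
    from has_derivative_scaleR[OF has_derivative_mult[OF dn[OF i] this] du[OF i]]
    show "((\<lambda>z. (n i z * (5/2 * kB X * T z + qratio 1 i (T z))) *\<^sub>R u i z) has_derivative
      (\<lambda>h. (n i x * (5/2 * kB X * T x + qratio 1 i (T x))) *\<^sub>R u' i h
      + (n i x * ((5/2 * kB X + heat_slope i (T x)) * T' h) + n' i h * (5/2 * kB X * T x + qratio 1 i (T x))) *\<^sub>R u i x)) (at x)" .
  qed
  then show "(\<lambda>z. energy_flux X (\<lambda>i. n i z) (\<lambda>i. u i z) (T z)) differentiable at x"
    by (auto simp: differentiable_def)
  have "frechet_derivative (\<lambda>z. energy_flux X (\<lambda>i. n i z) (\<lambda>i. u i z) (T z)) (at x) = ?D"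
    using frechet_derivative_at[OF D] by simp
  then have "divergence (\<lambda>z. energy_flux X (\<lambda>i. n i z) (\<lambda>i. u i z) (T z)) x = (\<Sum>k\<in>UNIV. ?D (axis k 1) $ k)"
    by (simp add: divergence_def)
  also have "\<dots> = (\<Sum>k\<in>UNIV. \<Sum>i=1..4. flux_rate i 0 (axis k 1) (n i x) (u i x) (T x) (n' i (axis k 1)) (u' i (axis k 1)) (T' (axis k 1)))"
    by (intro sum.cong refl) (simp add: flux_rate_def inner_axis algebra_simps cong: sum.cong)
  finally show "divergence (\<lambda>z. energy_flux X (\<lambda>i. n i z) (\<lambda>i. u i z) (T z)) x
      = (\<Sum>i=1..4. \<Sum>k\<in>UNIV. flux_rate i 0 (axis k 1) (n i x) (u i x) (T x) (n' i (axis k 1)) (u' i (axis k 1)) (T' (axis k 1)))"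
    by (subst sum.swap)
qed

section \<open>Moments of the kinetic equation\<close>

lemma dmaxwellian_scaleR:
  "dmaxwellian i n u T v I (h * dn) (h *\<^sub>R du) (h * dT) = h * dmaxwellian i n u T v I dn du dT"
  by (simp add: dmaxwellian_def algebra_simps add_divide_distrib diff_divide_distrib)

text \<open>Derivatives of the solution are those of the Maxwellian because the two agree near (t,
  x), for positive times and in the open set \<Omega>. The flux moment is proportional to the drift
  \<epsilon> u, so transport has the same order in \<epsilon> as the scaled time derivative.\<close>

lemma transport_moment:
  fixes f :: "real \<Rightarrow> real^3 \<Rightarrow> real^3 \<Rightarrow> real \<Rightarrow> real"
  assumes i: "i \<in> {1..4}" and t: "t > 0" and \<Omega>: "open \<Omega>" "x \<in> \<Omega>" and T: "T t x > 0"
    and maxwell: "\<And>s z v I. s \<ge> 0 \<Longrightarrow> z \<in> \<Omega> \<Longrightarrow> I \<ge> 0 \<Longrightarrow> f s z v I = maxwellian X i (n s z) (\<epsilon> *\<^sub>R u s z) (T s z) v I"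
    and nt: "((\<lambda>s. n s x) has_vector_derivative nt) (at t)" and nx: "(n t has_derivative nx) (at x)"
    and ut: "((\<lambda>s. u s x) has_vector_derivative ut) (at t)" and ux: "(u t has_derivative ux) (at x)"
    and Tt: "((\<lambda>s. T s x) has_vector_derivative Tt) (at t)" and Tx: "(T t has_derivative Tx) (at x)"
  shows "has_bochner_integral phase_measure
    (\<lambda>(v, I). kin_energy X i v I * (\<epsilon> * deriv (\<lambda>s. f s x v I) t + v \<bullet> grad (\<lambda>z. f t z v I) x) * weight X i I)
    (\<epsilon> * energy_rate i (n t x) (\<epsilon> *\<^sub>R u t x) (T t x) nt (\<epsilon> *\<^sub>R ut) Tt
      + \<epsilon> * (\<Sum>k\<in>UNIV. flux_rate i (\<epsilon>\<^sup>2) (axis k 1) (n t x) (u t x) (T t x) (nx (axis k 1)) (ux (axis k 1)) (Tx (axis k 1))))"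
proof -
  let ?dM = "dmaxwellian i (n t x) (\<epsilon> *\<^sub>R u t x) (T t x)"
  have dt: "deriv (\<lambda>s. f s x v I) t = ?dM v I nt (\<epsilon> *\<^sub>R ut) Tt" if I: "I \<ge> 0" for v I
  proof (rule DERIV_imp_deriv)
    have "((\<lambda>s. maxwellian X i (n s x) (\<epsilon> *\<^sub>R u s x) (T s x) v I) has_derivative
        (\<lambda>h. ?dM v I (h *\<^sub>R nt) (\<epsilon> *\<^sub>R (h *\<^sub>R ut)) (h *\<^sub>R Tt))) (at t)"
      using nt ut Tt unfolding has_vector_derivative_def
      by (intro maxwellian_has_derivative i T has_derivative_scaleR_right)
    \<comment> \<open>Linearity of \<open>dmaxwellian\<close> in its increments turns the
      differential along the time axis into a real derivative.\<close>
    then have "((\<lambda>s. maxwellian X i (n s x) (\<epsilon> *\<^sub>R u s x) (T s x) v I) has_real_derivative ?dM v I nt (\<epsilon> *\<^sub>R ut) Tt) (at t)"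
      unfolding has_field_derivative_def
      by (rule has_derivative_eq_rhs) (simp add: fun_eq_iff dmaxwellian_scaleR[symmetric] mult.commute)
    then show "((\<lambda>s. f s x v I) has_real_derivative ?dM v I nt (\<epsilon> *\<^sub>R ut) Tt) (at t)"
      by (rule has_field_derivative_transform_within_open[where S = "{0<..}"]) (use t maxwell \<Omega> I in auto)
  qed
  have dx: "grad (\<lambda>z. f t z v I) x $ k = ?dM v I (nx (axis k 1)) (\<epsilon> *\<^sub>R ux (axis k 1)) (Tx (axis k 1))"
    if I: "I \<ge> 0" for v I k
  proof -
    have "((\<lambda>z. maxwellian X i (n t z) (\<epsilon> *\<^sub>R u t z) (T t z) v I) has_derivative
        (\<lambda>h. ?dM v I (nx h) (\<epsilon> *\<^sub>R ux h) (Tx h))) (at x)"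
      by (intro maxwellian_has_derivative i T has_derivative_scaleR_right nx ux Tx)
    then have "((\<lambda>z. f t z v I) has_derivative (\<lambda>h. ?dM v I (nx h) (\<epsilon> *\<^sub>R ux h) (Tx h))) (at x)"
      by (rule has_derivative_transform_within_open[OF _ \<Omega>]) (use t maxwell I in auto)
    from frechet_derivative_at[OF this] show ?thesis by (simp add: grad_def fun_eq_iff)
  qed
  have K: "has_bochner_integral phase_measure
      (\<lambda>(v, I). kin_energy X i v I * ?dM v I nt (\<epsilon> *\<^sub>R ut) Tt * weight X i I)
      (energy_rate i (n t x) (\<epsilon> *\<^sub>R u t x) (T t x) nt (\<epsilon> *\<^sub>R ut) Tt)"
    using dmaxwellian_energy_moments(1)[OF i T, of "n t x" "\<epsilon> *\<^sub>R u t x" nt "\<epsilon> *\<^sub>R ut" Tt]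
    by (simp add: energy_rate_def qratio_def heat_slope_def)
  have F: "has_bochner_integral phase_measure
      (\<lambda>(v, I). (v \<bullet> axis k 1) * (kin_energy X i v I * ?dM v I (nx (axis k 1)) (\<epsilon> *\<^sub>R ux (axis k 1)) (Tx (axis k 1)) * weight X i I))
      (\<epsilon> * flux_rate i (\<epsilon>\<^sup>2) (axis k 1) (n t x) (u t x) (T t x) (nx (axis k 1)) (ux (axis k 1)) (Tx (axis k 1)))" for k
  proof -
    let ?p = "axis k (1 :: real) :: real^3"
    \<comment> \<open>Each term contains an odd number of velocities: one supplies the \<epsilon> in
      front, a remaining pair the value \<epsilon>^2 for \<kappa>.\<close>
    have "nx ?p * (\<epsilon> *\<^sub>R u t x \<bullet> ?p) * (5/2 * kB X * T t x + qratio 1 i (T t x) + mass X i * (norm (\<epsilon> *\<^sub>R u t x))\<^sup>2 / 2)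
      + n t x * Tx ?p * (\<epsilon> *\<^sub>R u t x \<bullet> ?p) * (5/2 * kB X + heat_slope i (T t x))
      + n t x * (\<epsilon> *\<^sub>R ux ?p \<bullet> ?p) * (5/2 * kB X * T t x + qratio 1 i (T t x) + mass X i * (norm (\<epsilon> *\<^sub>R u t x))\<^sup>2 / 2)
      + n t x * mass X i * (\<epsilon> *\<^sub>R u t x \<bullet> ?p) * (\<epsilon> *\<^sub>R u t x \<bullet> \<epsilon> *\<^sub>R ux ?p)
      = \<epsilon> * flux_rate i (\<epsilon>\<^sup>2) ?p (n t x) (u t x) (T t x) (nx ?p) (ux ?p) (Tx ?p)"
      by (simp add: flux_rate_def power_mult_distrib power2_eq_square algebra_simps)
    then show ?thesis
      using dmaxwellian_energy_moments(2)[OF i T, of ?p "n t x" "\<epsilon> *\<^sub>R u t x" "nx ?p" "\<epsilon> *\<^sub>R ux ?p" "Tx ?p"]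
      by (simp only: qratio_def heat_slope_def)
  qed
  have "has_bochner_integral phase_measure
    (\<lambda>z. \<epsilon> * (case z of (v, I) \<Rightarrow> kin_energy X i v I * ?dM v I nt (\<epsilon> *\<^sub>R ut) Tt * weight X i I)
      + (\<Sum>k\<in>UNIV. case z of (v, I) \<Rightarrow> (v \<bullet> axis k 1) * (kin_energy X i v I * ?dM v I (nx (axis k 1)) (\<epsilon> *\<^sub>R ux (axis k 1)) (Tx (axis k 1)) * weight X i I)))
    (\<epsilon> * energy_rate i (n t x) (\<epsilon> *\<^sub>R u t x) (T t x) nt (\<epsilon> *\<^sub>R ut) Tt
      + (\<Sum>k\<in>UNIV. \<epsilon> * flux_rate i (\<epsilon>\<^sup>2) (axis k 1) (n t x) (u t x) (T t x) (nx (axis k 1)) (ux (axis k 1)) (Tx (axis k 1))))"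
    by (intro has_bochner_integral_add has_bochner_integral_mult_right has_bochner_integral_sum K F)
  then have "has_bochner_integral phase_measure
    (\<lambda>(v, I). kin_energy X i v I * (\<epsilon> * deriv (\<lambda>s. f s x v I) t + v \<bullet> grad (\<lambda>z. f t z v I) x) * weight X i I)
    (\<epsilon> * energy_rate i (n t x) (\<epsilon> *\<^sub>R u t x) (T t x) nt (\<epsilon> *\<^sub>R ut) Tt
      + (\<Sum>k\<in>UNIV. \<epsilon> * flux_rate i (\<epsilon>\<^sup>2) (axis k 1) (n t x) (u t x) (T t x) (nx (axis k 1)) (ux (axis k 1)) (Tx (axis k 1))))"
    by (rule has_bochner_integral_transform)
       (auto simp: phase_measure_def space_pair_measure dt dx inner_vec_def[of _ "grad _ _"] inner_axis
          distrib_left distrib_right sum_distrib_left sum_distrib_right mult_ac intro!: sum.cong)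
  then show ?thesis by (simp add: sum_distrib_left)
qed

text \<open>The elastic moments are antisymmetric in the two species, so their double sum equals its
  negative. In the reactive part, total energy conservation trades the kinetic moments for minus the
  binding energies times the production rates, and these rates are -r, -r, r, r with r that of
  species 3.\<close>

lemma collision_energy_sum:
  assumes cons: "conservation_laws X f"
    and conv: "collision_moments_converge X f"
  shows "(\<Sum>i=1..4. \<Sum>j=1..4. moment (\<lambda>v I. kin_energy X i v I * Qel X i j (f i) (f j) v I * weight X i I)) = 0"
    and "(\<Sum>i=1..4. moment (\<lambda>v I. kin_energy X i v I * Qreact X i f v I * weight X i I))
      = - reaction_heat X * moment (\<lambda>v I. Qreact X 3 f v I * weight X 3 I)"
proof -
  define M where "M i j = moment (\<lambda>v I. kin_energy X i v I * Qel X i j (f i) (f j) v I * weight X i I)" for i j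
  have skew: "M i j + M j i = 0" if "i \<in> {1..4}" "j \<in> {1..4}" for i j
    using cons that unfolding conservation_laws_def M_def by (cases "i = j") auto
  have "2 * (\<Sum>i=1..4. \<Sum>j=1..4. M i j) = (\<Sum>i=1..4. \<Sum>j=1..4. M i j) + (\<Sum>i=1..4. \<Sum>j=1..4. M j i)"
    using sum.swap[of M "{1..4}" "{1..4}"] by simp
  also have "\<dots> = (\<Sum>i=1..4. \<Sum>j=1..4. M i j + M j i)" by (simp add: sum.distrib)
  also have "\<dots> = 0" by (intro sum.neutral ballI skew)
  finally show "(\<Sum>i=1..4. \<Sum>j=1..4. moment (\<lambda>v I. kin_energy X i v I * Qel X i j (f i) (f j) v I * weight X i I)) = 0"
    by (simp add: M_def)
  define r where "r i = moment (\<lambda>v I. Qreact X i f v I * weight X i I)" for i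
  define K where "K i = moment (\<lambda>v I. kin_energy X i v I * Qreact X i f v I * weight X i I)" for i
  have split: "moment (\<lambda>v I. (kin_energy X i v I + bindE X i) * Qreact X i f v I * weight X i I) = K i + bindE X i * r i"
    if "i \<in> {1..4}" for i
  proof -
    have k: "integrable phase_measure (\<lambda>(v, I). kin_energy X i v I * Qreact X i f v I * weight X i I)"
      and q: "integrable phase_measure (\<lambda>(v, I). Qreact X i f v I * weight X i I)"
      using conv that by (auto simp: collision_moments_converge_def moment_converges_def)
    have "moment (\<lambda>v I. (kin_energy X i v I + bindE X i) * Qreact X i f v I * weight X i I)
        = (LINT z|phase_measure. (case z of (v, I) \<Rightarrow> kin_energy X i v I * Qreact X i f v I * weight X i I)
            + bindE X i * (case z of (v, I) \<Rightarrow> Qreact X i f v I * weight X i I))"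
      unfolding moment_def by (intro Bochner_Integration.integral_cong refl) (auto simp: algebra_simps)
    also have "\<dots> = K i + bindE X i * r i"
      using k q by (simp add: K_def r_def moment_def)
    finally show ?thesis .
  qed
  have e: "(\<Sum>i=1..4. h i) = h 1 + h 2 + h 3 + h (4::nat)" for h :: "nat \<Rightarrow> real"
    by (simp add: numeral_eq_Suc atLeastAtMostSuc_conv)
  have "(\<Sum>i=1..4. K i + bindE X i * r i)
      = (\<Sum>i=1..4. moment (\<lambda>v I. (kin_energy X i v I + bindE X i) * Qreact X i f v I * weight X i I))"
    by (intro sum.cong refl split[symmetric])
  also have "\<dots> = 0" using cons unfolding conservation_laws_def by blast
  finally have "(\<Sum>i=1..4. K i + bindE X i * r i) = 0" .
  moreover have "r 1 = - r 3" "r 2 = - r 3" "r 4 = r 3"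
    using cons unfolding conservation_laws_def r_def by auto
  ultimately show "(\<Sum>i=1..4. moment (\<lambda>v I. kin_energy X i v I * Qreact X i f v I * weight X i I))
      = - reaction_heat X * moment (\<lambda>v I. Qreact X 3 f v I * weight X 3 I)"
    unfolding K_def[symmetric] r_def[symmetric] e reaction_heat_def by (simp add: algebra_simps)
qed

text \<open>Convergence of each energy moment allows integration term by term. The two sides of the
  equation agree almost everywhere, so the values of their integrals coincide.\<close>

lemma kinetic_moment:
  assumes i: "i \<in> {1..4}" and conv: "collision_moments_converge X f"
    and kinetic: "AE (v, I) in phase_measure. D v I = 1 / \<epsilon> * (\<Sum>j=1..4. Qel X i j (f i) (f j) v I) + \<epsilon> * Qreact X i f v I"
    and D: "has_bochner_integral phase_measure (\<lambda>(v, I). kin_energy X i v I * D v I * weight X i I) d"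
  shows "d = 1 / \<epsilon> * (\<Sum>j=1..4. moment (\<lambda>v I. kin_energy X i v I * Qel X i j (f i) (f j) v I * weight X i I))
    + \<epsilon> * moment (\<lambda>v I. kin_energy X i v I * Qreact X i f v I * weight X i I)"
proof -
  let ?e = "\<lambda>j (v, I). kin_energy X i v I * Qel X i j (f i) (f j) v I * weight X i I"
  let ?r = "\<lambda>(v, I). kin_energy X i v I * Qreact X i f v I * weight X i I"
  have e: "\<And>j. j \<in> {1..4} \<Longrightarrow> integrable phase_measure (?e j)" and r: "integrable phase_measure ?r"
    using conv i by (auto simp: collision_moments_converge_def moment_converges_def)
  have R: "has_bochner_integral phase_measure (\<lambda>z. 1 / \<epsilon> * (\<Sum>j=1..4. ?e j z) + \<epsilon> * ?r z)
     (1 / \<epsilon> * (\<Sum>j=1..4. moment (\<lambda>v I. kin_energy X i v I * Qel X i j (f i) (f j) v I * weight X i I))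
    + \<epsilon> * moment (\<lambda>v I. kin_energy X i v I * Qreact X i f v I * weight X i I))"
    unfolding moment_def using e r
    by (intro has_bochner_integral_add has_bochner_integral_mult_right has_bochner_integral_sum has_bochner_integral_integrable)
  have "AE z in phase_measure. (case z of (v, I) \<Rightarrow> kin_energy X i v I * D v I * weight X i I) = 1 / \<epsilon> * (\<Sum>j=1..4. ?e j z) + \<epsilon> * ?r z"
    using kinetic
    by eventually_elim (auto simp: algebra_simps sum_distrib_left sum_distrib_right)
  from has_bochner_integral_eq_AE[OF D R this] show ?thesis .
qed

end

theorem lemma13:
  fixes X :: mixture
    and \<Omega> :: "(real^3) set"
    and \<epsilon>0 :: real
    and f :: "real \<Rightarrow> nat \<Rightarrow> real \<Rightarrow> real^3 \<Rightarrow> real^3 \<Rightarrow> real \<Rightarrow> real"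
    and n\<epsilon> :: "nat \<Rightarrow> real \<Rightarrow> real \<Rightarrow> real^3 \<Rightarrow> real"
    and u\<epsilon> :: "nat \<Rightarrow> real \<Rightarrow> real \<Rightarrow> real^3 \<Rightarrow> real^3"
    and T\<epsilon> :: "nat \<Rightarrow> real \<Rightarrow> real \<Rightarrow> real^3 \<Rightarrow> real"
    and n :: "nat \<Rightarrow> real \<Rightarrow> real^3 \<Rightarrow> real"
    and u :: "nat \<Rightarrow> real \<Rightarrow> real^3 \<Rightarrow> real^3"
    and T :: "real \<Rightarrow> real^3 \<Rightarrow> real"
    and A\<epsilon> :: "real \<Rightarrow> real \<Rightarrow> real^3 \<Rightarrow> real"
    and y :: "real^3"
  assumes domain: "open \<Omega>" "bounded \<Omega>"
    and masses: "\<And>i. i \<in> {1..4} \<Longrightarrow> mass X i > 0"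
    and mass_balance: "mass X 1 + mass X 2 = mass X 3 + mass X 4"
    and heat: "reaction_heat X \<ge> 0"
    and boltzmann: "kB X > 0"
    and exponent: "expo X \<ge> 1"
    and weight_nonneg: "\<And>i I. i \<in> {1..4} \<Longrightarrow> I \<ge> 0 \<Longrightarrow> weight X i I \<ge> 0"
    and weight_nonzero: "\<And>i. i \<in> {1..4} \<Longrightarrow> AE I in half_line. weight X i I \<noteq> 0"
    and Phi_meas: "(\<lambda>(I, J, R, r). PhiRe X I J R r)
         \<in> borel_measurable (half_line \<Otimes>\<^sub>M half_line \<Otimes>\<^sub>M unit_interval \<Otimes>\<^sub>M unit_interval)"
    and b_meas: "bRe X \<in> borel_measurable unit_interval"
    and convergent: "integrals_converge X"
    and eps0: "\<epsilon>0 > 0"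
    and positive: "\<And>\<epsilon> i t x. 0 < \<epsilon> \<Longrightarrow> \<epsilon> < \<epsilon>0 \<Longrightarrow> i \<in> {1..4} \<Longrightarrow> t \<ge> 0 \<Longrightarrow> x \<in> \<Omega> \<Longrightarrow>
         n\<epsilon> i \<epsilon> t x > 0 \<and> T\<epsilon> i \<epsilon> t x > 0 \<and> T t x > 0"
    and maxwell: "\<And>\<epsilon> i t x v I. 0 < \<epsilon> \<Longrightarrow> \<epsilon> < \<epsilon>0 \<Longrightarrow> i \<in> {1..4} \<Longrightarrow> t \<ge> 0 \<Longrightarrow> x \<in> \<Omega> \<Longrightarrow> I \<ge> 0 \<Longrightarrow>
         f \<epsilon> i t x v I =
           maxwellian X i (n\<epsilon> i \<epsilon> t x) (\<epsilon> *\<^sub>R u\<epsilon> i \<epsilon> t x) (T t x + \<epsilon> * T\<epsilon> i \<epsilon> t x) v I"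
    and kinetic: "\<And>\<epsilon> i t x. 0 < \<epsilon> \<Longrightarrow> \<epsilon> < \<epsilon>0 \<Longrightarrow> i \<in> {1..4} \<Longrightarrow> t > 0 \<Longrightarrow> x \<in> \<Omega> \<Longrightarrow>
         AE (v, I) in phase_measure.
           \<epsilon> * deriv (\<lambda>s. f \<epsilon> i s x v I) t + v \<bullet> grad (\<lambda>z. f \<epsilon> i t z v I) x
           = 1 / \<epsilon> * (\<Sum>j=1..4. Qel X i j (f \<epsilon> i t x) (f \<epsilon> j t x) v I)
             + \<epsilon> * Qreact X i (\<lambda>k. f \<epsilon> k t x) v I"
    and conservation: "\<And>\<epsilon> t x. 0 < \<epsilon> \<Longrightarrow> \<epsilon> < \<epsilon>0 \<Longrightarrow> t > 0 \<Longrightarrow> x \<in> \<Omega> \<Longrightarrow>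
         conservation_laws X (\<lambda>k. f \<epsilon> k t x)"
    and collision_convergent: "\<And>\<epsilon> t x. 0 < \<epsilon> \<Longrightarrow> \<epsilon> < \<epsilon>0 \<Longrightarrow> t > 0 \<Longrightarrow> x \<in> \<Omega> \<Longrightarrow>
         collision_moments_converge X (\<lambda>k. f \<epsilon> k t x)"
    and bounded_u: "\<And>i t x. i \<in> {1..4} \<Longrightarrow> t > 0 \<Longrightarrow> x \<in> \<Omega> \<Longrightarrow>
         (\<lambda>\<epsilon>. norm (u\<epsilon> i \<epsilon> t x)) \<in> O[at_right 0](\<lambda>_. 1)"
    and bounded_T: "\<And>i t x. i \<in> {1..4} \<Longrightarrow> t > 0 \<Longrightarrow> x \<in> \<Omega> \<Longrightarrow>
         (\<lambda>\<epsilon>. T\<epsilon> i \<epsilon> t x) \<in> O[at_right 0](\<lambda>_. 1)"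
    and limit_n: "\<And>i. i \<in> {1..4} \<Longrightarrow> formal_limit \<epsilon>0 \<Omega> (n\<epsilon> i) (n i)"
    and limit_u: "\<And>i. i \<in> {1..4} \<Longrightarrow> formal_limit \<epsilon>0 \<Omega> (u\<epsilon> i) (u i)"
    and limit_T: "\<And>i. i \<in> {1..4} \<Longrightarrow>
         formal_limit \<epsilon>0 \<Omega> (\<lambda>\<epsilon> t x. T t x + \<epsilon> * T\<epsilon> i \<epsilon> t x) T"
    and unit_y: "norm y = 1"
    and A_expansion: "\<And>t x. t > 0 \<Longrightarrow> x \<in> \<Omega> \<Longrightarrow>
         (\<lambda>\<epsilon>. A\<epsilon> \<epsilon> t x - rate_leading X y (T t x) (\<lambda>i. n\<epsilon> i \<epsilon> t x)) \<in> O[at_right 0](\<lambda>\<epsilon>. \<epsilon>)"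
  shows "\<exists>A. \<forall>t>0. \<forall>x\<in>\<Omega>.
           ((\<lambda>\<epsilon>. A\<epsilon> \<epsilon> t x) \<longlongrightarrow> A t x) (at_right 0) \<and>
           (\<lambda>s. energy_density X (\<lambda>i. n i s x) (T s x)) differentiable at t \<and>
           (\<lambda>z. energy_flux X (\<lambda>i. n i t z) (\<lambda>i. u i t z) (T t z)) differentiable at x \<and>
           deriv (\<lambda>s. energy_density X (\<lambda>i. n i s x) (T s x)) t
             + divergence (\<lambda>z. energy_flux X (\<lambda>i. n i t z) (\<lambda>i. u i t z) (T t z)) x
           = - reaction_heat X * A t x"
proof -
  interpret reacting_mixture X
    by unfold_locales (fact masses mass_balance heat boltzmann exponent weight_nonneg weight_nonzero Phi_meas b_meas convergent)+
  \<comment> \<open>The witness is the leading rate at the limit fields. It is reached in two ways: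
    from the expansion of \<open>A\<epsilon>\<close> and as the limit of the third reactive
    moment.\<close>
  define A where "A t x = rate_leading X y (T t x) (\<lambda>i. n i t x)" for t x
  have main: "((\<lambda>\<epsilon>. A\<epsilon> \<epsilon> t x) \<longlongrightarrow> A t x) (at_right 0) \<and>
           (\<lambda>s. energy_density X (\<lambda>i. n i s x) (T s x)) differentiable at t \<and>
           (\<lambda>z. energy_flux X (\<lambda>i. n i t z) (\<lambda>i. u i t z) (T t z)) differentiable at x \<and>
           deriv (\<lambda>s. energy_density X (\<lambda>i. n i s x) (T s x)) t
             + divergence (\<lambda>z. energy_flux X (\<lambda>i. n i t z) (\<lambda>i. u i t z) (T t z)) x
           = - reaction_heat X * A t x" if t: "t > 0" and x: "x \<in> \<Omega>" for t x
  proof -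

    \<comment> \<open>Limits of the fields at a fixed point\<close>
    define \<tau> where "\<tau> i \<epsilon> = (\<lambda>t x. T t x + \<epsilon> * T\<epsilon> i \<epsilon> t x)" for i \<epsilon>
    have ev: "\<forall>\<^sub>F \<epsilon> in at_right 0. 0 < \<epsilon> \<and> \<epsilon> < \<epsilon>0"
      using eps0 by (auto simp: eventually_at_right_field intro!: exI[of _ \<epsilon>0])
    \<comment> \<open>Positivity of the limit temperature is stated jointly with that of the scaled
      fields, so an admissible \<epsilon> and a species have to be named.\<close>
    have Tp: "T t x > 0" using positive[of "\<epsilon>0 / 2" 1 t x] eps0 t x by auto
    have \<tau>p: "\<tau> i \<epsilon> t x > 0" if "0 < \<epsilon>" "\<epsilon> < \<epsilon>0" "i \<in> {1..4}" for i \<epsilon>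
      using positive[OF that, of t x] t x that by (simp add: \<tau>_def add_pos_pos)
    have eps: "((\<lambda>\<epsilon>::real. \<epsilon>) \<longlongrightarrow> 0) (at_right 0)" by (rule tendsto_ident_at)
    note fl = formal_limit_def[THEN iffD1, rule_format, OF _ t x]
    have limit_\<tau>: "formal_limit \<epsilon>0 \<Omega> (\<tau> i) T" if "i \<in> {1..4}" for i
      using limit_T[OF that] unfolding \<tau>_def[abs_def] .
    note Ln = fl[OF limit_n] and Lu = fl[OF limit_u] and LT = fl[OF limit_\<tau>]
    have nl: "((\<lambda>\<epsilon>. n\<epsilon> i \<epsilon> t x) \<longlongrightarrow> n i t x) (at_right 0)"
      and ul: "((\<lambda>\<epsilon>. u\<epsilon> i \<epsilon> t x) \<longlongrightarrow> u i t x) (at_right 0)"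
      and Tl: "((\<lambda>\<epsilon>. \<tau> i \<epsilon> t x) \<longlongrightarrow> T t x) (at_right 0)" if "i \<in> {1..4}" for i
      using Ln[OF that] Lu[OF that] LT[OF that] by auto
    have eul: "((\<lambda>\<epsilon>. \<epsilon> *\<^sub>R u\<epsilon> i \<epsilon> t x) \<longlongrightarrow> 0) (at_right 0)" if "i \<in> {1..4}" for i
      using tendsto_scaleR[OF eps ul[OF that]] by simp

    \<comment> \<open>Derivatives of the scaled fields and of their limits\<close>
    define nt where "nt i \<epsilon> = vector_derivative (\<lambda>s. n\<epsilon> i \<epsilon> s x) (at t)" for i \<epsilon>
    define ut where "ut i \<epsilon> = vector_derivative (\<lambda>s. u\<epsilon> i \<epsilon> s x) (at t)" for i \<epsilon>
    define Tt where "Tt i \<epsilon> = vector_derivative (\<lambda>s. \<tau> i \<epsilon> s x) (at t)" for i \<epsilon>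
    define nx where "nx i \<epsilon> = frechet_derivative (n\<epsilon> i \<epsilon> t) (at x)" for i \<epsilon>
    define ux where "ux i \<epsilon> = frechet_derivative (u\<epsilon> i \<epsilon> t) (at x)" for i \<epsilon>
    define Tx where "Tx i \<epsilon> = frechet_derivative (\<tau> i \<epsilon> t) (at x)" for i \<epsilon>
    define nt0 where "nt0 i = vector_derivative (\<lambda>s. n i s x) (at t)" for i
    define ut0 where "ut0 i = vector_derivative (\<lambda>s. u i s x) (at t)" for i
    define Tt0 where "Tt0 = vector_derivative (\<lambda>s. T s x) (at t)"
    define nx0 where "nx0 i = frechet_derivative (n i t) (at x)" for i
    define ux0 where "ux0 i = frechet_derivative (u i t) (at x)" for i
    define Tx0 where "Tx0 = frechet_derivative (T t) (at x)"
    define E\<epsilon> where "E\<epsilon> i \<epsilon> = energy_rate i (n\<epsilon> i \<epsilon> t x) (\<epsilon> *\<^sub>R u\<epsilon> i \<epsilon> t x) (\<tau> i \<epsilon> t x) (nt i \<epsilon>) (\<epsilon> *\<^sub>R ut i \<epsilon>) (Tt i \<epsilon>)" for i \<epsilon>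
    define F\<epsilon> where "F\<epsilon> i k \<epsilon> = flux_rate i (\<epsilon>\<^sup>2) (axis k 1) (n\<epsilon> i \<epsilon> t x) (u\<epsilon> i \<epsilon> t x) (\<tau> i \<epsilon> t x)
        (nx i \<epsilon> (axis k 1)) (ux i \<epsilon> (axis k 1)) (Tx i \<epsilon> (axis k 1))" for i and k :: 3 and \<epsilon>
    define m3 where "m3 \<epsilon> = moment (\<lambda>v I. Qreact X 3 (\<lambda>k. f \<epsilon> k t x) v I * weight X 3 I)" for \<epsilon>

    \<comment> \<open>Energy balance for fixed \<epsilon>\<close>
    have balance: "(\<Sum>i=1..4. E\<epsilon> i \<epsilon>) + (\<Sum>i=1..4. \<Sum>k\<in>UNIV. F\<epsilon> i k \<epsilon>) = - reaction_heat X * m3 \<epsilon>"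
      if e: "0 < \<epsilon>" "\<epsilon> < \<epsilon>0" for \<epsilon>
    proof -
      let ?f = "\<lambda>k. f \<epsilon> k t x"
      let ?el = "\<lambda>i j. moment (\<lambda>v I. kin_energy X i v I * Qel X i j (?f i) (?f j) v I * weight X i I)"
      let ?re = "\<lambda>i. moment (\<lambda>v I. kin_energy X i v I * Qreact X i ?f v I * weight X i I)"
      note cc = collision_convergent[OF e t x] and cl = conservation[OF e t x]
      have "\<epsilon> * E\<epsilon> i \<epsilon> + \<epsilon> * (\<Sum>k\<in>UNIV. F\<epsilon> i k \<epsilon>) = 1 / \<epsilon> * (\<Sum>j=1..4. ?el i j) + \<epsilon> * ?re i" if i: "i \<in> {1..4}" for i
      proof (rule kinetic_moment[OF i cc])
        show "AE (v, I) in phase_measure. \<epsilon> * deriv (\<lambda>s. f \<epsilon> i s x v I) t + v \<bullet> grad (\<lambda>z. f \<epsilon> i t z v I) x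
            = 1 / \<epsilon> * (\<Sum>j=1..4. Qel X i j (?f i) (?f j) v I) + \<epsilon> * Qreact X i ?f v I"
          by (rule kinetic[OF e i t x])
        show "has_bochner_integral phase_measure
          (\<lambda>(v, I). kin_energy X i v I * (\<epsilon> * deriv (\<lambda>s. f \<epsilon> i s x v I) t + v \<bullet> grad (\<lambda>z. f \<epsilon> i t z v I) x) * weight X i I)
          (\<epsilon> * E\<epsilon> i \<epsilon> + \<epsilon> * (\<Sum>k\<in>UNIV. F\<epsilon> i k \<epsilon>))"
          unfolding E\<epsilon>_def F\<epsilon>_def
        proof (rule transport_moment[OF i t domain(1) x])
          show "\<tau> i \<epsilon> t x > 0" by (rule \<tau>p[OF e i])
          show "f \<epsilon> i s z v I = maxwellian X i (n\<epsilon> i \<epsilon> s z) (\<epsilon> *\<^sub>R u\<epsilon> i \<epsilon> s z) (\<tau> i \<epsilon> s z) v I"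
            if "s \<ge> 0" "z \<in> \<Omega>" "I \<ge> 0" for s z v I
            using maxwell[OF e i that] by (simp add: \<tau>_def)
        qed (use Ln[OF i] Lu[OF i] LT[OF i] e in \<open>auto simp: nt_def ut_def Tt_def nx_def ux_def Tx_def
              vector_derivative_works[symmetric] frechet_derivative_works[symmetric]\<close>)
      qed
      then have "(\<Sum>i=1..4. \<epsilon> * E\<epsilon> i \<epsilon> + \<epsilon> * (\<Sum>k\<in>UNIV. F\<epsilon> i k \<epsilon>)) = (\<Sum>i=1..4. 1 / \<epsilon> * (\<Sum>j=1..4. ?el i j) + \<epsilon> * ?re i)"
        by (intro sum.cong refl)
      also have "\<dots> = 1 / \<epsilon> * (\<Sum>i=1..4. \<Sum>j=1..4. ?el i j) + \<epsilon> * (\<Sum>i=1..4. ?re i)"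
        by (simp only: sum.distrib sum_distrib_left)
      \<comment> \<open>The elastic sum behind the singular factor 1/\<epsilon> vanishes
        identically, not merely in the limit. Both sides are then multiples of \<epsilon>, which is
        cancelled below.\<close>
      also have "\<dots> = \<epsilon> * (- reaction_heat X * m3 \<epsilon>)"
        unfolding collision_energy_sum[OF cl cc] m3_def by simp
      finally have "\<epsilon> * ((\<Sum>i=1..4. E\<epsilon> i \<epsilon>) + (\<Sum>i=1..4. \<Sum>k\<in>UNIV. F\<epsilon> i k \<epsilon>)) = \<epsilon> * (- reaction_heat X * m3 \<epsilon>)"
        by (simp only: sum.distrib sum_distrib_left distrib_left)
      then show ?thesis using e by (subst (asm) mult_left_cancel) auto
    qed

    \<comment> \<open>Passage to the limit in the balance\<close>
    define E0 where "E0 i = energy_rate i (n i t x) 0 (T t x) (nt0 i) 0 Tt0" for i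
    define F0 where "F0 i k = flux_rate i 0 (axis k 1) (n i t x) (u i t x) (T t x)
        (nx0 i (axis k 1)) (ux0 i (axis k 1)) (Tx0 (axis k 1))" for i and k :: 3
    have El: "(E\<epsilon> i \<longlongrightarrow> E0 i) (at_right 0)" if i: "i \<in> {1..4}" for i
    proof -
      have "(nt i \<longlongrightarrow> nt0 i) (at_right 0)" "(ut i \<longlongrightarrow> ut0 i) (at_right 0)" "(Tt i \<longlongrightarrow> Tt0) (at_right 0)"
        using Ln[OF i] Lu[OF i] LT[OF i] by (auto simp: nt_def[abs_def] ut_def[abs_def] Tt_def[abs_def] nt0_def ut0_def Tt0_def)
      \<comment> \<open>The time derivative of u converges, so its multiple by \<epsilon>
        disappears; together with \<open>eul\<close> this puts the limit at zero velocity.\<close>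
      moreover from this(2) have "((\<lambda>\<epsilon>. \<epsilon> *\<^sub>R ut i \<epsilon>) \<longlongrightarrow> 0) (at_right 0)"
        using tendsto_scaleR[OF eps] by fastforce
      ultimately show ?thesis
        unfolding E\<epsilon>_def[abs_def] E0_def energy_rate_def
        by (intro tendsto_intros qratio_tendsto heat_slope_tendsto nl Tl eul i Tp) auto
    qed
    have Fl: "(F\<epsilon> i k \<longlongrightarrow> F0 i k) (at_right 0)" if i: "i \<in> {1..4}" for i k
    proof -
      have "((\<lambda>\<epsilon>. nx i \<epsilon> h) \<longlongrightarrow> nx0 i h) (at_right 0)" "((\<lambda>\<epsilon>. ux i \<epsilon> h) \<longlongrightarrow> ux0 i h) (at_right 0)"
        "((\<lambda>\<epsilon>. Tx i \<epsilon> h) \<longlongrightarrow> Tx0 h) (at_right 0)" for h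
        using Ln[OF i] Lu[OF i] LT[OF i] by (auto simp: nx_def ux_def Tx_def nx0_def ux0_def Tx0_def)
      moreover have "((\<lambda>\<epsilon>::real. \<epsilon>\<^sup>2) \<longlongrightarrow> 0) (at_right 0)" using tendsto_power[OF eps, of 2] by simp
      ultimately show ?thesis
        unfolding F\<epsilon>_def[abs_def] F0_def flux_rate_def
        by (intro tendsto_intros qratio_tendsto heat_slope_tendsto nl ul Tl i Tp) auto
    qed
    have m3l: "(m3 \<longlongrightarrow> A t x) (at_right 0)"
      unfolding m3_def[abs_def] A_def
    proof (rule reactive_moment_tendsto[OF Tp unit_y nl eul Tl])
      show "\<forall>\<^sub>F \<epsilon> in at_right 0. \<forall>i\<in>{1..4}. \<forall>v I. I \<ge> 0 \<longrightarrow>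
          f \<epsilon> i t x v I = maxwellian X i (n\<epsilon> i \<epsilon> t x) (\<epsilon> *\<^sub>R u\<epsilon> i \<epsilon> t x) (\<tau> i \<epsilon> t x) v I"
        using ev by eventually_elim (use maxwell t x in \<open>simp add: \<tau>_def\<close>)
      show "\<forall>\<^sub>F \<epsilon> in at_right 0. moment_converges (\<lambda>v I. Qreact X 3 (\<lambda>k. f \<epsilon> k t x) v I * weight X 3 I)"
        using ev
      proof eventually_elim
        case (elim \<epsilon>)
        then show ?case using collision_convergent[of \<epsilon> t x] t x by (simp add: collision_moments_converge_def)
      qed
    qed
    have "((\<lambda>\<epsilon>. (\<Sum>i=1..4. E\<epsilon> i \<epsilon>) + (\<Sum>i=1..4. \<Sum>k\<in>UNIV. F\<epsilon> i k \<epsilon>)) \<longlongrightarrow>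
        (\<Sum>i=1..4. E0 i) + (\<Sum>i=1..4. \<Sum>k\<in>UNIV. F0 i k)) (at_right 0)"
      by (intro tendsto_add tendsto_sum El Fl)
    moreover have "((\<lambda>\<epsilon>. (\<Sum>i=1..4. E\<epsilon> i \<epsilon>) + (\<Sum>i=1..4. \<Sum>k\<in>UNIV. F\<epsilon> i k \<epsilon>)) \<longlongrightarrow> - reaction_heat X * A t x) (at_right 0)"
    proof (rule Lim_transform_eventually)
      show "((\<lambda>\<epsilon>. - reaction_heat X * m3 \<epsilon>) \<longlongrightarrow> - reaction_heat X * A t x) (at_right 0)"
        by (intro tendsto_intros m3l)
      show "\<forall>\<^sub>F \<epsilon> in at_right 0. - reaction_heat X * m3 \<epsilon> = (\<Sum>i=1..4. E\<epsilon> i \<epsilon>) + (\<Sum>i=1..4. \<Sum>k\<in>UNIV. F\<epsilon> i k \<epsilon>)"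
        using ev by eventually_elim (rule balance[symmetric], auto)
    qed
    ultimately have lim_eq: "(\<Sum>i=1..4. E0 i) + (\<Sum>i=1..4. \<Sum>k\<in>UNIV. F0 i k) = - reaction_heat X * A t x"
      by (rule tendsto_unique[OF trivial_limit_at_right_real])

    \<comment> \<open>Identification with the macroscopic energy balance\<close>
    have ED: "((\<lambda>s. energy_density X (\<lambda>i. n i s x) (T s x)) has_real_derivative (\<Sum>i=1..4. E0 i)) (at t)"
      unfolding E0_def
    proof (rule energy_density_has_derivative[where n = "\<lambda>i s. n i s x" and T = "\<lambda>s. T s x", OF Tp])
      show "((\<lambda>s. T s x) has_real_derivative Tt0) (at t)"
        using LT[of 1] by (simp add: Tt0_def vector_derivative_works has_real_derivative_iff_has_vector_derivative)
      show "((\<lambda>s. n i s x) has_real_derivative nt0 i) (at t)" if "i \<in> {1..4}" for i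
        using Ln[OF that] by (simp add: nt0_def vector_derivative_works has_real_derivative_iff_has_vector_derivative)
    qed
    have dT: "(T t has_derivative Tx0) (at x)"
      using LT[of 1] by (simp add: Tx0_def frechet_derivative_works[symmetric])
    have dn: "(n i t has_derivative nx0 i) (at x)" if "i \<in> {1..4}" for i
      using Ln[OF that] by (simp add: nx0_def frechet_derivative_works[symmetric])
    have du: "(u i t has_derivative ux0 i) (at x)" if "i \<in> {1..4}" for i
      using Lu[OF that] by (simp add: ux0_def frechet_derivative_works[symmetric])
    note FD = energy_flux_has_derivative[where n = "\<lambda>i. n i t" and u = "\<lambda>i. u i t" and T = "T t", OF Tp dT dn du]

    have "((\<lambda>\<epsilon>. A\<epsilon> \<epsilon> t x) \<longlongrightarrow> A t x) (at_right 0)"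
    proof -
      have "((\<lambda>\<epsilon>. A\<epsilon> \<epsilon> t x - rate_leading X y (T t x) (\<lambda>i. n\<epsilon> i \<epsilon> t x)) \<longlongrightarrow> 0) (at_right 0)"
      proof -
        obtain c where "\<forall>\<^sub>F \<epsilon> in at_right 0. norm (A\<epsilon> \<epsilon> t x - rate_leading X y (T t x) (\<lambda>i. n\<epsilon> i \<epsilon> t x)) \<le> c * norm \<epsilon>"
          using A_expansion[OF t x] by (elim landau_o.bigE)
        moreover have "((\<lambda>\<epsilon>::real. c * norm \<epsilon>) \<longlongrightarrow> 0) (at_right 0)"
          using tendsto_mult_right_zero[OF tendsto_norm_zero[OF eps]] .
        ultimately show ?thesis by (rule Lim_null_comparison)
      qed
      \<comment> \<open>In the leading rate only the densities depend on \<epsilon>; it is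
        polynomial in them, over fixed positive denominators.\<close>
      moreover have "((\<lambda>\<epsilon>. rate_leading X y (T t x) (\<lambda>i. n\<epsilon> i \<epsilon> t x)) \<longlongrightarrow> A t x) (at_right 0)"
        unfolding A_def rate_leading_def
        using qmom_0_pos[OF _ Tp] by (intro tendsto_intros nl) (auto simp: qint_eq_qmom less_imp_neq[THEN not_sym])
      ultimately show ?thesis using tendsto_add by fastforce
    qed
    moreover have "(\<lambda>s. energy_density X (\<lambda>i. n i s x) (T s x)) differentiable at t"
      using ED by (auto simp: real_differentiable_def)
    moreover have "deriv (\<lambda>s. energy_density X (\<lambda>i. n i s x) (T s x)) t
        + divergence (\<lambda>z. energy_flux X (\<lambda>i. n i t z) (\<lambda>i. u i t z) (T t z)) x = - reaction_heat X * A t x"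
      using lim_eq DERIV_imp_deriv[OF ED] FD(2) by (simp add: F0_def)
    ultimately show ?thesis using FD(1) by simp
  qed
  show ?thesis by (rule exI[of _ A]) (use main in blast)
qed

end
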